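(* Let $\mu$ be a box-like self-affine measure and let $\gamma:[0,\infty)\to\mathbb{R}$ be its moment scaling function. Then: (1) For $q\in[0,1]$, $\overline{T}_{\mathrm C,\mu}(q)=\overline{T}_{\mathrm P,\mu}(q)=\overline{\tau}_\mu(q)\leq\gamma(q)$. (2) For $q\geq1$, $\gamma(q)\leq\underline{T}_{\mathrm P,\mu}(q)=\underline{\tau}_\mu(q)$. (3) If, in addition, $\mu$ satisfies the rectangular open set condition (ROSC), then for all $q\geq0$ the lower and upper versions of the following quantities coincide and $T_{\mathrm P,\mu}(q)=\tau_\mu(q)=\gamma(q)$.
   Context: Box-like self-affine measure: Let $\mathcal I$ be a finite index set with $|\mathcal I|\ge2$. For each $i\in\mathcal I$ let $S_i=T_i\circ L_i+t_i:\mathbb{R}^2\to\mathbb{R}^2$, where $T_i=\mathrm{diag}(c_i,d_i)$ with $c_i,d_i\in(0,1)$, $L_i$ is a linear isometry of $\mathbb{R}^2$ with $L_i([-1,1]^2)=[-1,1]^2$, and $t_i\in\mathbb{R}^2$, such that $S_i([0,1]^2)\subseteq[0,1]^2$. Let $(p_i)_{i\in\mathcal I}$ be a probability vector with all $p_i\in(0,1)$. Let $\mu$ be the unique Borel probability measure with $\mu=\sum_{i\in\mathcal I}p_i\,\mu\circ S_i^{-1}$; its support is the unique non-empty compact $F$ with $F=\bigcup_iS_i(F)$. ROSC: there is a non-empty open rectangle $R=(a,b)\times(c,d)\subset\mathbb{R}^2$ such that the sets $S_i(R)$, $i\in\mathcal I$, are pairwise disjoint subsets of $R$. Dimension functions: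 for a compactly supported Borel probability measure $\nu$ on $\mathbb{R}^n$ and $q\in\mathbb{R}$, $\underline\tau_\nu(q)$ and $\overline\tau_\nu(q)$ are the $\liminf$ and $\limsup$ as $\delta\to0$ of $\log\int_{\operatorname{supp}\nu}\nu(B(x,\delta))^{q-1}d\nu(x)/(-\log\delta)$; write $\tau_\nu(q)$ if they agree. The lower/upper covering multifractal box dimensions $\underline T_{\mathrm C,\nu}(q),\overline T_{\mathrm C,\nu}(q)$ are the $\liminf/\limsup$ of $\log N_\delta^q/(-\log\delta)$, where $N_\delta^q=\inf\sum_k\nu(B(x_k,\delta))^q$ over all countable covers of $\operatorname{supp}\nu$ by balls of radius $\delta$ centred in $\operatorname{supp}\nu$. The lower/upper packing multifractal box dimensions $\underline T_{\mathrm P,\nu}(q),\overline T_{\mathrm P,\nu}(q)$ are the $\liminf/\limsup$ of $\log M_\delta^q/(-\log\delta)$, where $M_\delta^q=\sup\sum_k\nu(B(x_k,\delta))^q$ over all families of pairwise disjoint balls of radius $\delta$ centred in $\operatorname{supp}\nu$. Write $T_{\mathrm P,\nu}(q)$ for the common value if lower and upper agree. Moment scaling function: $\mathcal I^*=\bigcup_{k\ge1}\mathcal I^k$; for $\mathbf i=(i_1,\dots,i_k)$, $S_{\mathbf i}=S_{i_1}\circ\cdots\circ S_{i_k}$, $p(\mathbf i)=p_{i_1}\cdots p_{i_k}$; $\alpha_1(\mathbf i)\ge\alpha_2(\mathbf i)$ are the singular values of the linear part of $S_{\mathbf i}$ (the side lengths of $S_{\mathbf i}([0,1]^2)$). $\pi_1(x,y)=x$,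 $\pi_2(x,y)=y$; $\pi_j(\mu)=\mu\circ\pi_j^{-1}$; $\tau_j(q)=\tau_{\pi_j(\mu)}(q)$, which exists for all $q\ge0$. Let $b(\mathbf i)$, $h(\mathbf i)$ be the base (horizontal) and height (vertical) lengths of $S_{\mathbf i}([0,1]^2)$. If $S_{\mathbf i}$ maps horizontal lines to horizontal lines, put $\tau_{\mathbf i}=\tau_1$ if $b(\mathbf i)\ge h(\mathbf i)$ and $\tau_{\mathbf i}=\tau_2$ if $b(\mathbf i)<h(\mathbf i)$; if $S_{\mathbf i}$ maps horizontal lines to vertical lines, put $\tau_{\mathbf i}=\tau_1$ if $b(\mathbf i)<h(\mathbf i)$ and $\tau_{\mathbf i}=\tau_2$ if $b(\mathbf i)\ge h(\mathbf i)$. For $s\in\mathbb{R}$, $q\ge0$, define $\psi^{s,q}(\mathbf i)=p(\mathbf i)^q\alpha_1(\mathbf i)^{\tau_{\mathbf i}(q)}\alpha_2(\mathbf i)^{s-\tau_{\mathbf i}(q)}$, $\Psi_k^{s,q}=\sum_{\mathbf i\in\mathcal I^k}\psi^{s,q}(\mathbf i)$ and $P(s,q)=\lim_{k\to\infty}(\Psi_k^{s,q})^{1/k}$ (the limit exists). For each $q\ge0$, $\gamma(q)$ is the unique real number with $P(\gamma(q),q)=1$. *)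

theory Defs
  imports "HOL-Probability.Probability"
begin

definition measure_support :: "'a::topological_space measure \<Rightarrow> 'a set" where
  "measure_support \<nu> = {x. \<forall>U. open U \<and> x \<in> U \<longrightarrow> emeasure \<nu> U > 0}"

definition elog :: "ennreal \<Rightarrow> ereal" where
  "elog x = (if x = 0 then -\<infinity> else if x = \<infinity> then \<infinity> else ereal (ln (enn2real x)))"

definition scaling_liminf :: "(real \<Rightarrow> ennreal) \<Rightarrow> ereal" where
  "scaling_liminf f = Liminf (at_right 0) (\<lambda>\<delta>. elog (f \<delta>) / ereal (- ln \<delta>))"

definition scaling_limsup :: "(real \<Rightarrow> ennreal) \<Rightarrow> ereal" where
  "scaling_limsup f = Limsup (at_right 0) (\<lambda>\<delta>. elog (f \<delta>) / ereal (- ln \<delta>))"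

text \<open>
  Balls \<open>B(x, \<delta>)\<close> are closed.  All of them are centred in the support, hence have positive
  measure, so that the convention \<open>0 powr q = 0\<close> is never met, not even for \<open>q \<le> 0\<close>.
\<close>

definition Lq_integral :: "'a::euclidean_space measure \<Rightarrow> real \<Rightarrow> real \<Rightarrow> ennreal" where
  "Lq_integral \<nu> q \<delta> =
     (\<integral>\<^sup>+x\<in>measure_support \<nu>. ennreal (measure \<nu> (cball x \<delta>) powr (q - 1)) \<partial>\<nu>)"

definition lower_Lq :: "'a::euclidean_space measure \<Rightarrow> real \<Rightarrow> ereal" where
  "lower_Lq \<nu> q = scaling_liminf (Lq_integral \<nu> q)"

definition upper_Lq :: "'a::euclidean_space measure \<Rightarrow> real \<Rightarrow> ereal" where
  "upper_Lq \<nu> q = scaling_limsup (Lq_integral \<nu> q)"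

definition Lq_spectrum :: "'a::euclidean_space measure \<Rightarrow> real \<Rightarrow> real" where
  "Lq_spectrum \<nu> q = (THE t. lower_Lq \<nu> q = ereal t \<and> upper_Lq \<nu> q = ereal t)"

text \<open>
  A family of balls of radius \<open>\<delta>\<close> is given by its set \<open>C\<close> of centres.  Repeated balls cannot
  occur in a disjoint family and do not affect the infimum over covers.
\<close>

definition covering_sum :: "'a::euclidean_space measure \<Rightarrow> real \<Rightarrow> real \<Rightarrow> ennreal" where
  "covering_sum \<nu> q \<delta> =
     (INF C\<in>{C. countable C \<and> C \<subseteq> measure_support \<nu> \<and> measure_support \<nu> \<subseteq> (\<Union>x\<in>C. cball x \<delta>)}.
        \<Sum>\<^sub>\<infinity>x\<in>C. ennreal (measure \<nu> (cball x \<delta>) powr q))"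

definition packing_sum :: "'a::euclidean_space measure \<Rightarrow> real \<Rightarrow> real \<Rightarrow> ennreal" where
  "packing_sum \<nu> q \<delta> =
     (SUP C\<in>{C. C \<subseteq> measure_support \<nu> \<and> disjoint_family_on (\<lambda>x. cball x \<delta>) C}.
        \<Sum>\<^sub>\<infinity>x\<in>C. ennreal (measure \<nu> (cball x \<delta>) powr q))"

definition lower_covering_dim :: "'a::euclidean_space measure \<Rightarrow> real \<Rightarrow> ereal" where
  "lower_covering_dim \<nu> q = scaling_liminf (covering_sum \<nu> q)"

definition upper_covering_dim :: "'a::euclidean_space measure \<Rightarrow> real \<Rightarrow> ereal" where
  "upper_covering_dim \<nu> q = scaling_limsup (covering_sum \<nu> q)"

definition lower_packing_dim :: "'a::euclidean_space measure \<Rightarrow> real \<Rightarrow> ereal" where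
  "lower_packing_dim \<nu> q = scaling_liminf (packing_sum \<nu> q)"

definition upper_packing_dim :: "'a::euclidean_space measure \<Rightarrow> real \<Rightarrow> ereal" where
  "upper_packing_dim \<nu> q = scaling_limsup (packing_sum \<nu> q)"

definition unit_square :: "(real \<times> real) set" where
  "unit_square = {0..1} \<times> {0..1}"

definition box_like_map :: "(real \<times> real \<Rightarrow> real \<times> real) \<Rightarrow> bool" where
  "box_like_map S \<longleftrightarrow>
     (\<exists>c d L t. 0 < c \<and> c < 1 \<and> 0 < d \<and> d < 1 \<and>
        orthogonal_transformation L \<and> L ` ({-1..1} \<times> {-1..1}) = {-1..1} \<times> {-1..1} \<and>
        S = (\<lambda>x. (c * fst (L x), d * snd (L x)) + t)) \<and>
     S ` unit_square \<subseteq> unit_square"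

locale box_like_measure =
  fixes I :: "'i set"
    and S :: "'i \<Rightarrow> real \<times> real \<Rightarrow> real \<times> real"
    and p :: "'i \<Rightarrow> real"
    and \<mu> :: "(real \<times> real) measure"
  assumes finite_I: "finite I" and card_I: "card I \<ge> 2"
    and box_like: "\<And>i. i \<in> I \<Longrightarrow> box_like_map (S i)"
    and p_bounds: "\<And>i. i \<in> I \<Longrightarrow> 0 < p i \<and> p i < 1" and sum_p: "(\<Sum>i\<in>I. p i) = 1"
    and prob: "prob_space \<mu>" and borel: "sets \<mu> = sets borel"
    and self_affine: "\<And>A. A \<in> sets borel \<Longrightarrow> measure \<mu> A = (\<Sum>i\<in>I. p i * measure \<mu> (S i -` A))"

definition ROSC :: "'i set \<Rightarrow> ('i \<Rightarrow> real \<times> real \<Rightarrow> real \<times> real) \<Rightarrow> bool" where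
  "ROSC I S \<longleftrightarrow>
     (\<exists>a b c d. a < b \<and> c < d \<and>
        (\<forall>i\<in>I. S i ` ({a<..<b} \<times> {c<..<d}) \<subseteq> {a<..<b} \<times> {c<..<d}) \<and>
        disjoint_family_on (\<lambda>i. S i ` ({a<..<b} \<times> {c<..<d})) I)"

definition word_map :: "('i \<Rightarrow> 'a \<Rightarrow> 'a) \<Rightarrow> 'i list \<Rightarrow> 'a \<Rightarrow> 'a" where
  "word_map S w = foldr (\<lambda>i f. S i \<circ> f) w id"

definition linear_part :: "('a \<Rightarrow> 'a) \<Rightarrow> 'a \<Rightarrow> 'a::real_vector" where
  "linear_part f = (\<lambda>x. f x - f 0)"

definition singular_values :: "('a::euclidean_space \<Rightarrow> 'a) \<Rightarrow> real set" where
  "singular_values A = {s. s \<ge> 0 \<and> (\<exists>v. v \<noteq> 0 \<and> adjoint A (A v) = s\<^sup>2 *\<^sub>R v)}"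

text \<open>
  In the plane there are two singular values, counted with multiplicity, so the larger and the
  smaller one are the maximum and the minimum of the set of singular values.
\<close>

definition alpha1 :: "('a::euclidean_space \<Rightarrow> 'a) \<Rightarrow> real" where
  "alpha1 f = Max (singular_values (linear_part f))"

definition alpha2 :: "('a::euclidean_space \<Rightarrow> 'a) \<Rightarrow> real" where
  "alpha2 f = Min (singular_values (linear_part f))"

definition base_length :: "(real \<times> real \<Rightarrow> real \<times> real) \<Rightarrow> real" where
  "base_length f = Sup (fst ` f ` unit_square) - Inf (fst ` f ` unit_square)"

definition height_length :: "(real \<times> real \<Rightarrow> real \<times> real) \<Rightarrow> real" where
  "height_length f = Sup (snd ` f ` unit_square) - Inf (snd ` f ` unit_square)"

definition horizontal_to_horizontal :: "(real \<times> real \<Rightarrow> real \<times> real) \<Rightarrow> bool" where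
  "horizontal_to_horizontal f \<longleftrightarrow> (\<forall>y. \<exists>y'. f ` (UNIV \<times> {y}) = UNIV \<times> {y'})"

text \<open>
  Compositions of box-like maps send horizontal lines either to horizontal lines or to vertical
  lines; the outer \<open>else\<close> branch is the latter case.
\<close>

definition tau_word :: "(real \<times> real) measure \<Rightarrow> (real \<times> real \<Rightarrow> real \<times> real) \<Rightarrow> real \<Rightarrow> real" where
  "tau_word \<mu> f q =
     (let \<tau>\<^sub>1 = Lq_spectrum (distr \<mu> borel fst) q; \<tau>\<^sub>2 = Lq_spectrum (distr \<mu> borel snd) q in
      if horizontal_to_horizontal f
      then (if base_length f \<ge> height_length f then \<tau>\<^sub>1 else \<tau>\<^sub>2)
      else (if base_length f < height_length f then \<tau>\<^sub>1 else \<tau>\<^sub>2))"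

definition psi :: "('i \<Rightarrow> real \<times> real \<Rightarrow> real \<times> real) \<Rightarrow> ('i \<Rightarrow> real) \<Rightarrow> (real \<times> real) measure
    \<Rightarrow> real \<Rightarrow> real \<Rightarrow> 'i list \<Rightarrow> real" where
  "psi S p \<mu> s q w =
     (let f = word_map S w; \<tau> = tau_word \<mu> f q in
      prod_list (map p w) powr q * alpha1 f powr \<tau> * alpha2 f powr (s - \<tau>))"

definition Psi_sum :: "'i set \<Rightarrow> ('i \<Rightarrow> real \<times> real \<Rightarrow> real \<times> real) \<Rightarrow> ('i \<Rightarrow> real)
    \<Rightarrow> (real \<times> real) measure \<Rightarrow> real \<Rightarrow> real \<Rightarrow> nat \<Rightarrow> real" where
  "Psi_sum I S p \<mu> s q k = (\<Sum>w\<in>{w. set w \<subseteq> I \<and> length w = k}. psi S p \<mu> s q w)"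

definition pressure :: "'i set \<Rightarrow> ('i \<Rightarrow> real \<times> real \<Rightarrow> real \<times> real) \<Rightarrow> ('i \<Rightarrow> real)
    \<Rightarrow> (real \<times> real) measure \<Rightarrow> real \<Rightarrow> real \<Rightarrow> real" where
  "pressure I S p \<mu> s q = lim (\<lambda>k. Psi_sum I S p \<mu> s q k powr (1 / real k))"

definition moment_scaling :: "'i set \<Rightarrow> ('i \<Rightarrow> real \<times> real \<Rightarrow> real \<times> real) \<Rightarrow> ('i \<Rightarrow> real)
    \<Rightarrow> (real \<times> real) measure \<Rightarrow> real \<Rightarrow> real" where
  "moment_scaling I S p \<mu> q = (THE s. pressure I S p \<mu> s q = 1)"

end

theory Submission
  imports Defs
begin

text \<open>
  All the dimensions are exponents of one quantity, the sum of \<open>\<mu>(Q)\<^sup>q\<close> over the cells \<open>Q\<close> of a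
  mesh of size \<open>\<delta>\<close>; for the \<open>L\<^sup>q\<close>-integral at \<open>q = 0\<close> this uses that the balls centred in the
  support have at least polynomial mass.  Cut the tree of words where the shorter side of the image
  of the unit square falls below \<open>\<delta>\<close>.  A mesh of size \<open>\<delta>\<close> sees the piece of \<open>\<mu>\<close> on such an image
  as a projection of \<open>\<mu>\<close> at scale \<open>\<delta> / \<alpha>\<^sub>1\<close>, whose sum is about \<open>(\<alpha>\<^sub>1 / \<delta>)\<close> to the power of the
  spectrum of the projection, so that the sum over all pieces is about \<open>\<delta>\<close> to the power \<open>-s\<close> times
  the sum of \<open>\<psi>\<close> at \<open>(s, q)\<close> over the cut.  The latter is bounded for \<open>s > \<gamma>(q)\<close> and bounded
  below for \<open>s < \<gamma>(q)\<close>, as \<open>\<psi>\<close> is sub- or supermultiplicative.  The pieces add up to \<open>\<mu>\<close> by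
  subadditivity of \<open>x\<^sup>q\<close> for \<open>q \<le> 1\<close>, by superadditivity for \<open>q \<ge> 1\<close>, and in both directions under
  the open set condition, when only boundedly many images meet a given cell.
\<close>

section \<open>Power sums\<close>

lemma powr_ge_tangent:
  fixes t q :: real
  assumes "t \<ge> 0" "q \<ge> 1"
  shows "1 + q * (t - 1) \<le> t powr q"
proof (cases "t = 0")
  case False
  then have t: "t > 0" using assms by simp
  have "(1 - 1/q) *\<^sub>R 1 + (1/q) *\<^sub>R t powr q \<ge> 1 powr (1 - 1/q) * (t powr q) powr (1/q)"
    using Youngs_inequality_0[of "1 - 1/q" "1/q" 1 "t powr q"] assms t by (simp add: mult.commute)
  then have "t \<le> (1 - 1/q) + (1/q) * t powr q"
    using assms t by (simp add: powr_powr)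
  then have "q * t \<le> q * ((1 - 1/q) + (1/q) * t powr q)"
    using assms by (intro mult_left_mono) auto
  also have "\<dots> = q - 1 + t powr q" using assms by (simp add: field_simps)
  finally show ?thesis by (simp add: algebra_simps)
qed (use assms in auto)

lemma powr_le_tangent:
  fixes t q :: real
  assumes "t \<ge> 0" "0 \<le> q" "q \<le> 1"
  shows "t powr q \<le> 1 + q * (t - 1)"
proof (cases "t = 0")
  case False
  then have t: "t > 0" using assms by simp
  show ?thesis
    using Youngs_inequality_0[of "1 - q" "q" 1 t] assms t by (simp add: algebra_simps)
qed (use assms in auto)

lemma powr_sum_le:
  fixes a :: "'k \<Rightarrow> real"
  assumes "finite K" "\<And>k. k \<in> K \<Longrightarrow> a k \<ge> 0" "q \<ge> 0"
  shows "(\<Sum>k\<in>K. a k) powr q \<le> real (card K) powr q * (\<Sum>k\<in>K. a k powr q)"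
proof (cases "K = {}")
  case False
  define m where "m = Max (a ` K)"
  have "m \<in> a ` K" unfolding m_def using assms False by (intro Max_in) auto
  then obtain k0 where k0: "k0 \<in> K" "m = a k0" by auto
  have le: "a k \<le> m" if "k \<in> K" for k unfolding m_def using that assms by auto
  have "(\<Sum>k\<in>K. a k) \<le> real (card K) * m" using sum_bounded_above[of K a m] le by simp
  then have "(\<Sum>k\<in>K. a k) powr q \<le> (real (card K) * m) powr q"
    using assms by (intro powr_mono2) (auto intro: sum_nonneg)
  also have "\<dots> = real (card K) powr q * a k0 powr q"
    using assms k0 by (simp add: powr_mult)
  also have "\<dots> \<le> real (card K) powr q * (\<Sum>k\<in>K. a k powr q)"
    using k0 assms by (intro mult_left_mono member_le_sum) auto
  finally show ?thesis .
qed simp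

lemma powr_sum_le_sum_powr:
  fixes a :: "'k \<Rightarrow> real"
  assumes "finite K" "\<And>k. k \<in> K \<Longrightarrow> a k \<ge> 0" "0 \<le> q" "q \<le> 1"
  shows "(\<Sum>k\<in>K. a k) powr q \<le> (\<Sum>k\<in>K. a k powr q)"
proof (cases "(\<Sum>k\<in>K. a k) = 0")
  case True
  then show ?thesis by (simp add: sum_nonneg)
next
  case False
  define s where "s = (\<Sum>k\<in>K. a k)"
  have s: "s > 0" using False assms unfolding s_def by (simp add: order_less_le sum_nonneg)
  have "a k / s \<le> (a k / s) powr q" if "k \<in> K" for k
  proof (cases "a k = 0")
    case False
    have "a k \<le> s" unfolding s_def using that assms by (intro member_le_sum) auto
    then have "a k / s \<le> 1" using s by simp
    then have "(a k / s) powr 1 \<le> (a k / s) powr q"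
      using assms that s False by (intro powr_mono') auto
    then show ?thesis using assms that s by simp
  qed simp
  then have "(\<Sum>k\<in>K. a k / s) \<le> (\<Sum>k\<in>K. (a k / s) powr q)" by (intro sum_mono)
  moreover have "(\<Sum>k\<in>K. a k / s) = 1"
    using s unfolding sum_divide_distrib[symmetric] s_def[symmetric] by simp
  moreover have "(\<Sum>k\<in>K. (a k / s) powr q) = (\<Sum>k\<in>K. a k powr q) / s powr q"
    using s assms unfolding sum_divide_distrib by (intro sum.cong) (auto simp: powr_divide)
  ultimately have "1 \<le> (\<Sum>k\<in>K. a k powr q) / s powr q" by simp
  then have "1 * s powr q \<le> (\<Sum>k\<in>K. a k powr q)"
    using s by (subst (asm) pos_le_divide_eq) auto
  then show ?thesis unfolding s_def by simp
qed

lemma sum_powr_le_powr_sum: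
  fixes a :: "'k \<Rightarrow> real"
  assumes "finite K" "\<And>k. k \<in> K \<Longrightarrow> a k \<ge> 0" "q \<ge> 1"
  shows "(\<Sum>k\<in>K. a k powr q) \<le> (\<Sum>k\<in>K. a k) powr q"
proof -
  have "(\<Sum>k\<in>K. a k powr q) = ((\<Sum>k\<in>K. a k powr q) powr (1/q)) powr q"
    using assms by (simp add: powr_powr sum_nonneg)
  also have "\<dots> \<le> (\<Sum>k\<in>K. (a k powr q) powr (1/q)) powr q"
    using assms by (intro powr_mono2 powr_sum_le_sum_powr) auto
  also have "\<dots> = (\<Sum>k\<in>K. a k) powr q"
    using assms by (simp add: powr_powr)
  finally show ?thesis .
qed

lemma sum_powr_le_card:
  fixes a :: "'k \<Rightarrow> real"
  assumes "finite K" "\<And>k. k \<in> K \<Longrightarrow> a k \<ge> 0" "q \<ge> 0"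
  shows "(\<Sum>k\<in>K. a k powr q) \<le> real (card K) * (\<Sum>k\<in>K. a k) powr q"
proof -
  have "(\<Sum>k\<in>K. a k powr q) \<le> (\<Sum>k\<in>K. (\<Sum>k\<in>K. a k) powr q)"
    using assms by (intro sum_mono powr_mono2 member_le_sum) auto
  then show ?thesis by simp
qed

lemma weighted_mean_tangent:
  fixes x v :: "'k \<Rightarrow> real"
  assumes "finite K" "\<And>k. k \<in> K \<Longrightarrow> x k \<ge> 0" "\<And>k. k \<in> K \<Longrightarrow> v k \<ge> 0" "(\<Sum>k\<in>K. v k * x k) \<noteq> 0"
  obtains y where "y > 0" "sum v K > 0" "sum v K * y = (\<Sum>k\<in>K. v k * x k)"
    "\<And>q. (\<Sum>k\<in>K. v k * (1 + q * (x k / y - 1))) = sum v K"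
proof -
  define V where "V = sum v K"
  define y where "y = (\<Sum>k\<in>K. v k * x k) / V"
  have "V \<noteq> 0"
  proof
    assume "V = 0"
    then have "v k = 0" if "k \<in> K" for k
      using assms that unfolding V_def by (simp add: sum_nonneg_eq_0_iff)
    then show False using assms(4) by simp
  qed
  then have V: "V > 0" using assms unfolding V_def by (simp add: order_less_le sum_nonneg)
  then have y: "y > 0" using assms unfolding y_def by (auto simp: order_less_le sum_nonneg)
  have "(\<Sum>k\<in>K. v k * (1 + q * (x k / y - 1))) = V" for q
  proof -
    have "(\<Sum>k\<in>K. v k * (1 + q * (x k / y - 1))) = (\<Sum>k\<in>K. v k * (1 - q) + q / y * (v k * x k))"
      by (intro sum.cong) (auto simp: algebra_simps)
    also have "\<dots> = V * (1 - q) + q / y * (V * y)"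
      using V unfolding y_def V_def sum.distrib sum_distrib_left[symmetric] sum_distrib_right[symmetric] by simp
    also have "\<dots> = V" using y by (simp add: algebra_simps)
    finally show ?thesis .
  qed
  moreover have "V * y = (\<Sum>k\<in>K. v k * x k)" using V unfolding y_def by simp
  ultimately show thesis using V y unfolding V_def by (intro that[of y]) auto
qed

lemma powr_weighted_sum_le:
  fixes x :: "'k \<Rightarrow> real"
  assumes "finite K" "\<And>k. k \<in> K \<Longrightarrow> x k \<ge> 0" "\<And>k. k \<in> K \<Longrightarrow> v k \<ge> 0" "q \<ge> 1"
  shows "(\<Sum>k\<in>K. v k * x k) powr q \<le> (\<Sum>k\<in>K. v k) powr (q - 1) * (\<Sum>k\<in>K. v k * x k powr q)"
proof (cases "(\<Sum>k\<in>K. v k * x k) = 0")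
  case True
  then show ?thesis using assms by (auto intro!: mult_nonneg_nonneg sum_nonneg)
next
  case False
  obtain y where y: "y > 0" and V: "sum v K > 0" and mean: "sum v K * y = (\<Sum>k\<in>K. v k * x k)"
    and tangent: "\<And>q. (\<Sum>k\<in>K. v k * (1 + q * (x k / y - 1))) = sum v K"
    using weighted_mean_tangent[OF assms(1-3) False] by blast
  have "sum v K \<le> (\<Sum>k\<in>K. v k * (x k / y) powr q)"
    unfolding tangent[of q, symmetric] using assms y by (intro sum_mono mult_left_mono powr_ge_tangent) auto
  also have "\<dots> = (\<Sum>k\<in>K. v k * x k powr q) / y powr q"
    using assms y by (simp add: powr_divide sum_divide_distrib)
  finally have "sum v K * y powr q \<le> (\<Sum>k\<in>K. v k * x k powr q)"
    using y by (simp add: field_simps)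
  then have "sum v K powr (q - 1) * (sum v K * y powr q) \<le> sum v K powr (q - 1) * (\<Sum>k\<in>K. v k * x k powr q)"
    by (intro mult_left_mono) auto
  moreover have "sum v K powr (q - 1) * (sum v K * y powr q) = (sum v K * y) powr q"
    using V y by (simp add: powr_mult powr_diff)
  ultimately show ?thesis unfolding mean by simp
qed

lemma powr_weighted_sum_ge:
  fixes x :: "'k \<Rightarrow> real"
  assumes "finite K" "\<And>k. k \<in> K \<Longrightarrow> x k \<ge> 0" "\<And>k. k \<in> K \<Longrightarrow> v k \<ge> 0" "0 \<le> q" "q \<le> 1"
  shows "(\<Sum>k\<in>K. v k) powr (q - 1) * (\<Sum>k\<in>K. v k * x k powr q) \<le> (\<Sum>k\<in>K. v k * x k) powr q"
proof (cases "(\<Sum>k\<in>K. v k * x k) = 0")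
  case True
  then have "v k * x k = 0" if "k \<in> K" for k
    using assms that by (simp add: sum_nonneg_eq_0_iff)
  then have "v k * x k powr q = 0" if "k \<in> K" for k using that by force
  then have "(\<Sum>k\<in>K. v k * x k powr q) = 0" by (intro sum.neutral) auto
  then show ?thesis by simp
next
  case False
  obtain y where y: "y > 0" and V: "sum v K > 0" and mean: "sum v K * y = (\<Sum>k\<in>K. v k * x k)"
    and tangent: "\<And>q. (\<Sum>k\<in>K. v k * (1 + q * (x k / y - 1))) = sum v K"
    using weighted_mean_tangent[OF assms(1-3) False] by blast
  have "(\<Sum>k\<in>K. v k * x k powr q) / y powr q = (\<Sum>k\<in>K. v k * (x k / y) powr q)"
    using assms y by (simp add: powr_divide sum_divide_distrib)
  also have "\<dots> \<le> sum v K"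
    unfolding tangent[of q, symmetric] using assms y by (intro sum_mono mult_left_mono powr_le_tangent) auto
  finally have "(\<Sum>k\<in>K. v k * x k powr q) \<le> sum v K * y powr q"
    using y by (simp add: field_simps)
  then have "sum v K powr (q - 1) * (\<Sum>k\<in>K. v k * x k powr q) \<le> sum v K powr (q - 1) * (sum v K * y powr q)"
    by (intro mult_left_mono) auto
  moreover have "sum v K powr (q - 1) * (sum v K * y powr q) = (sum v K * y) powr q"
    using V y by (simp add: powr_mult powr_diff)
  ultimately show ?thesis unfolding mean by simp
qed

lemma powr_comparable:
  fixes a b x :: real
  assumes "0 < a" "0 < b" "a \<le> L * b" "b \<le> L * a"
  shows "a powr x \<le> L powr \<bar>x\<bar> * b powr x"
proof -
  have L: "L > 0" using assms by (metis less_le_trans zero_less_mult_pos2)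
  show ?thesis
  proof (cases "x \<ge> 0")
    case True
    then have "a powr x \<le> (L * b) powr x" using assms by (intro powr_mono2) auto
    then show ?thesis using True assms L by (simp add: powr_mult)
  next
    case False
    then have "a powr x \<le> (b / L) powr x" using assms L by (intro powr_mono2') (auto simp: field_simps)
    then show ?thesis using False assms L by (simp add: powr_divide powr_minus_divide)
  qed
qed

lemma powr_minus_1_mult: "(a::real) > 0 \<Longrightarrow> a powr (q - 1) * a = a powr q"
  by (simp add: powr_diff)

lemma abs_ln_le_power: "0 < a \<Longrightarrow> a ^ k \<le> x \<Longrightarrow> x \<le> 1 \<Longrightarrow> \<bar>ln x\<bar> \<le> real k * \<bar>ln a\<bar>" for a x :: real
proof -
  assume a: "0 < a" "a ^ k \<le> x" "x \<le> 1"
  then have x: "x > 0" using zero_less_power[of a k] by linarith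
  have "ln (a ^ k) \<le> ln x" using a x by (subst ln_le_cancel_iff) auto
  then have "real k * ln a \<le> ln x" using a by (simp add: ln_realpow)
  moreover have "ln x \<le> 0" using a x by simp
  moreover have "- (real k * \<bar>ln a\<bar>) \<le> real k * ln a"
    using mult_left_mono[of "- \<bar>ln a\<bar>" "ln a" "real k"] by auto
  ultimately show ?thesis by linarith
qed

lemma sum_powr_band:
  fixes a b :: "int \<Rightarrow> real"
  assumes fin: "finite T" "finite K" and nonneg: "\<And>t. t \<in> T \<Longrightarrow> a t \<ge> 0" "\<And>k. k \<in> K \<Longrightarrow> b k \<ge> 0"
    and le: "\<And>t. t \<in> T \<Longrightarrow> a t \<le> (\<Sum>k\<in>{k\<in>K. \<bar>k - t\<bar> \<le> 1}. b k)" and q: "q \<ge> 0"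
  shows "(\<Sum>t\<in>T. a t powr q) \<le> 3 powr q * 3 * (\<Sum>k\<in>K. b k powr q)"
proof -
  have card3: "card {k\<in>A. \<bar>k - t\<bar> \<le> 1} \<le> 3" for A and t :: int
  proof -
    have "card {k\<in>A. \<bar>k - t\<bar> \<le> 1} \<le> card {t-1..t+1}" by (intro card_mono) auto
    then show ?thesis by simp
  qed
  have "(\<Sum>t\<in>T. a t powr q) \<le> (\<Sum>t\<in>T. 3 powr q * (\<Sum>k\<in>{k\<in>K. \<bar>k - t\<bar> \<le> 1}. b k powr q))"
  proof (rule sum_mono)
    fix t assume t: "t \<in> T"
    have "a t powr q \<le> (\<Sum>k\<in>{k\<in>K. \<bar>k - t\<bar> \<le> 1}. b k) powr q"
      using t nonneg le q by (intro powr_mono2) auto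
    also have "\<dots> \<le> real (card {k\<in>K. \<bar>k - t\<bar> \<le> 1}) powr q * (\<Sum>k\<in>{k\<in>K. \<bar>k - t\<bar> \<le> 1}. b k powr q)"
      using fin nonneg q by (intro powr_sum_le) auto
    also have "\<dots> \<le> 3 powr q * (\<Sum>k\<in>{k\<in>K. \<bar>k - t\<bar> \<le> 1}. b k powr q)"
      using card3[of K t] q by (intro mult_right_mono powr_mono2 sum_nonneg) auto
    finally show "a t powr q \<le> 3 powr q * (\<Sum>k\<in>{k\<in>K. \<bar>k - t\<bar> \<le> 1}. b k powr q)" .
  qed
  also have "\<dots> = 3 powr q * (\<Sum>k\<in>K. \<Sum>t\<in>{t\<in>T. \<bar>k - t\<bar> \<le> 1}. b k powr q)"
    unfolding sum_distrib_left[symmetric] sum.swap_restrict[OF fin] ..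
  also have "\<dots> \<le> 3 powr q * (\<Sum>k\<in>K. 3 * b k powr q)"
  proof (intro mult_left_mono sum_mono)
    fix k
    have "card {t\<in>T. \<bar>k - t\<bar> \<le> 1} \<le> 3" using card3[of T k] by (simp add: abs_minus_commute)
    then show "(\<Sum>t\<in>{t\<in>T. \<bar>k - t\<bar> \<le> 1}. b k powr q) \<le> 3 * b k powr q"
      by (simp add: mult_right_mono)
  qed simp
  finally show ?thesis by (simp add: sum_distrib_left mult.assoc)
qed

section \<open>Fekete's lemma\<close>

lemma fekete_subadditive:
  fixes b :: "nat \<Rightarrow> real"
  assumes sub: "\<And>m n. m \<ge> 1 \<Longrightarrow> n \<ge> 1 \<Longrightarrow> b (m + n) \<le> b m + b n"
    and lower: "\<And>n. n \<ge> 1 \<Longrightarrow> c * real n \<le> b n"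
  obtains L where "(\<lambda>n. b n / real n) \<longlonglongrightarrow> L" "\<And>n. n \<ge> 1 \<Longrightarrow> L * real n \<le> b n"
proof -
  define X where "X = (\<lambda>n. b n / real n) ` {1..}"
  define L where "L = Inf X"
  have bdd: "bdd_below X"
    unfolding X_def by (rule bdd_belowI[of _ c]) (use lower in \<open>auto simp: field_simps\<close>)
  have L_le: "L \<le> b n / real n" if "n \<ge> 1" for n
    unfolding L_def by (rule cInf_lower[OF _ bdd]) (use that in \<open>auto simp: X_def\<close>)
  have mult: "b (k * m + r) \<le> real k * b m + b r" if "m \<ge> 1" "r \<ge> 1" for k m r
  proof (induction k)
    case (Suc k)
    have "b (m + (k * m + r)) \<le> b m + b (k * m + r)" using that by (intro sub) auto
    with Suc show ?case by (simp add: algebra_simps)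
  qed simp
  have "(\<lambda>n. b n / real n) \<longlonglongrightarrow> L"
  proof (rule LIMSEQ_I)
    fix e :: real assume e: "e > 0"
    have "Inf X < L + e / 2" using e unfolding L_def by simp
    then obtain m where m: "m \<ge> 1" "b m / real m < L + e / 2"
      using cInf_lessD[of X "L + e/2"] unfolding X_def by auto
    define B where "B = Max ((\<lambda>r. \<bar>b r\<bar> + \<bar>b m\<bar>) ` {1..2*m})"
    have B: "\<bar>b r\<bar> + \<bar>b m\<bar> \<le> B" if "r \<in> {1..2*m}" for r unfolding B_def using that by auto
    obtain n0 :: nat where n0: "real n0 > (2 * B + 2 * \<bar>L + e/2\<bar> * 2 * real m) / e" using reals_Archimedean2 by blast
    show "\<exists>no. \<forall>n\<ge>no. norm (b n / real n - L) < e"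
    proof (intro exI[of _ "max (n0+1) (2*m+1)"] allI impI)
      fix n assume n: "max (n0+1) (2*m+1) \<le> n"
      define k where "k = (n - 1) div m"
      define r where "r = (n - 1) mod m + 1"
      have nk: "n = k * m + r" unfolding k_def r_def using n by simp
      have r: "1 \<le> r" "r \<le> m" unfolding r_def using m by (auto simp: Suc_leI)
      have "b n \<le> real k * b m + b r" unfolding nk using m r by (intro mult) auto
      also have "real k * b m \<le> real k * (real m * (L + e/2))"
        using m by (intro mult_left_mono) (auto simp: field_simps)
      also have "real k * (real m * (L + e/2)) = (real n - real r) * (L + e/2)" unfolding nk by simp
      also have "\<dots> \<le> real n * (L + e/2) + real m * \<bar>L + e/2\<bar>"
      proof -
        have "- (real r * (L + e/2)) \<le> real r * \<bar>L + e/2\<bar>"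
          using abs_ge_minus_self[of "real r * (L+e/2)"] by (simp add: abs_mult)
        also have "\<dots> \<le> real m * \<bar>L + e/2\<bar>" using r by (intro mult_right_mono) auto
        finally show ?thesis by (simp add: algebra_simps)
      qed
      finally have "b n \<le> real n * (L + e/2) + real m * \<bar>L + e/2\<bar> + B" using B[of r] r by auto
      moreover have "real m * \<bar>L + e/2\<bar> + B < real n * (e/2)"
      proof -
        have "2 * B + 2 * \<bar>L + e/2\<bar> * 2 * real m < real n0 * e" using n0 e by (simp add: field_simps)
        moreover have "real n0 * e \<le> real n * e" using n e by (intro mult_right_mono) auto
        moreover have "0 \<le> \<bar>L + e/2\<bar> * real m" by simp
        ultimately have "2 * B + 2 * (\<bar>L + e/2\<bar> * real m) < real n * e" by linarith
        then show ?thesis by (simp add: mult.commute)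
      qed
      ultimately have "b n < real n * (L + e)" by (simp add: algebra_simps)
      then have "b n / real n < L + e" using n by (simp add: field_simps)
      then show "norm (b n / real n - L) < e" using L_le[of n] n by simp
    qed
  qed
  moreover have "L * real n \<le> b n" if "n \<ge> 1" for n using L_le[OF that] that by (simp add: field_simps)
  ultimately show thesis by (rule that)
qed

lemma ex_bound_if_tendsto:
  fixes b :: "nat \<Rightarrow> real"
  assumes lim: "(\<lambda>n. b n / real n) \<longlonglongrightarrow> L" and \<epsilon>: "\<epsilon> > 0"
  shows "\<exists>K\<ge>0. \<forall>n. \<bar>b n - L * real n\<bar> \<le> \<epsilon> * real n + K"
proof -
  obtain n0 where n0: "\<And>n. n \<ge> n0 \<Longrightarrow> \<bar>b n / real n - L\<bar> < \<epsilon>"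
    using LIMSEQ_D[OF lim \<epsilon>] by auto
  define K where "K = (\<Sum>n\<le>n0. \<bar>b n - L * real n\<bar>)"
  have "\<bar>b n - L * real n\<bar> \<le> \<epsilon> * real n + K" for n
  proof (cases "n \<le> n0")
    case True
    then have "\<bar>b n - L * real n\<bar> \<le> K" unfolding K_def by (intro member_le_sum) auto
    then show ?thesis using \<epsilon> by (simp add: add_increasing)
  next
    case False
    then have "\<bar>b n - L * real n\<bar> = \<bar>b n / real n - L\<bar> * real n"
      using abs_mult[of "b n / real n - L" "real n"] by (simp add: left_diff_distrib)
    also have "\<dots> \<le> \<epsilon> * real n" using n0[of n] False by (intro mult_right_mono) auto
    finally show ?thesis unfolding K_def by (simp add: add_increasing2 sum_nonneg)
  qed
  moreover have "K \<ge> 0" unfolding K_def by (intro sum_nonneg) auto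
  ultimately show ?thesis by blast
qed

section \<open>Comparison of scaling exponents\<close>

definition dominated :: "(real \<Rightarrow> ennreal) \<Rightarrow> (real \<Rightarrow> ennreal) \<Rightarrow> bool" where
  "dominated f g \<longleftrightarrow> (\<forall>\<epsilon>>0. \<forall>\<^sub>F \<delta> in at_right 0. f \<delta> \<le> ennreal (\<delta> powr (-\<epsilon>)) * g \<delta>)"

lemma eventually_at_right_0_less: "(a::real) > 0 \<Longrightarrow> \<forall>\<^sub>F \<delta> in at_right 0. 0 < \<delta> \<and> \<delta> < a"
  unfolding eventually_at_right_field by auto

lemma eventually_const_le_powr:
  fixes C \<epsilon> :: real
  assumes "\<epsilon> > 0"
  shows "\<forall>\<^sub>F \<delta> in at_right 0. C \<le> \<delta> powr (-\<epsilon>)"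
proof -
  define a where "a = (max C 1) powr (-1/\<epsilon>)"
  have a: "a > 0" unfolding a_def by simp
  show ?thesis
    using eventually_at_right_0_less[OF a]
  proof eventually_elim
    case (elim \<delta>)
    have "C \<le> max C 1" by simp
    also have "\<dots> = a powr (-\<epsilon>)" unfolding a_def using assms by (simp add: powr_powr)
    also have "\<dots> \<le> \<delta> powr (-\<epsilon>)" using elim assms a by (intro powr_mono2') auto
    finally show ?case .
  qed
qed

lemma dominated_const:
  assumes "\<And>\<epsilon>. \<epsilon> > 0 \<Longrightarrow> \<exists>C. \<forall>\<^sub>F \<delta> in at_right 0. f \<delta> \<le> ennreal (C * \<delta> powr (-\<epsilon>)) * g \<delta>"
  shows "dominated f g"
  unfolding dominated_def
proof (intro allI impI)
  fix \<epsilon> :: real assume e: "\<epsilon> > 0"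
  then obtain C where C: "\<forall>\<^sub>F \<delta> in at_right 0. f \<delta> \<le> ennreal (C * \<delta> powr (-(\<epsilon>/2))) * g \<delta>"
    using assms[of "\<epsilon>/2"] by auto
  show "\<forall>\<^sub>F \<delta> in at_right 0. f \<delta> \<le> ennreal (\<delta> powr (-\<epsilon>)) * g \<delta>"
    using C eventually_const_le_powr[OF half_gt_zero[OF e], of C]
  proof eventually_elim
    case (elim \<delta>)
    have "C * \<delta> powr (-(\<epsilon>/2)) \<le> \<delta> powr (-(\<epsilon>/2)) * \<delta> powr (-(\<epsilon>/2))"
      using elim by (intro mult_right_mono) auto
    also have "\<dots> = \<delta> powr (-\<epsilon>)" by (simp add: powr_add[symmetric])
    finally have "ennreal (C * \<delta> powr (-(\<epsilon>/2))) * g \<delta> \<le> ennreal (\<delta> powr (-\<epsilon>)) * g \<delta>"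
      by (intro mult_right_mono ennreal_leI) auto
    then show ?case using elim by simp
  qed
qed

lemma dominated_bounded:
  assumes "\<forall>\<^sub>F \<delta> in at_right 0. f \<delta> \<le> ennreal C * g \<delta>"
  shows "dominated f g"
proof (rule dominated_const)
  fix \<epsilon> :: real assume e: "\<epsilon> > 0"
  have "\<forall>\<^sub>F \<delta> in at_right 0. f \<delta> \<le> ennreal (max C 0 * \<delta> powr (-\<epsilon>)) * g \<delta>"
    using assms eventually_const_le_powr[OF e, of 1]
  proof eventually_elim
    case (elim \<delta>)
    have "max C 0 * 1 \<le> max C 0 * \<delta> powr (-\<epsilon>)" using elim by (intro mult_left_mono) auto
    then have "C \<le> max C 0 * \<delta> powr (-\<epsilon>)" by simp
    then have "ennreal C * g \<delta> \<le> ennreal (max C 0 * \<delta> powr (-\<epsilon>)) * g \<delta>"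
      by (intro mult_right_mono ennreal_leI) auto
    then show ?case using elim by simp
  qed
  then show "\<exists>C. \<forall>\<^sub>F \<delta> in at_right 0. f \<delta> \<le> ennreal (C * \<delta> powr (-\<epsilon>)) * g \<delta>" by blast
qed

lemma dominated_trans:
  assumes "dominated f g" "dominated g h"
  shows "dominated f h"
  unfolding dominated_def
proof (intro allI impI)
  fix \<epsilon> :: real assume e: "\<epsilon> > 0"
  have "\<forall>\<^sub>F \<delta> in at_right 0. f \<delta> \<le> ennreal (\<delta> powr (-(\<epsilon>/2))) * g \<delta>"
    "\<forall>\<^sub>F \<delta> in at_right 0. g \<delta> \<le> ennreal (\<delta> powr (-(\<epsilon>/2))) * h \<delta>"
    using assms e unfolding dominated_def by (auto dest!: spec[of _ "\<epsilon>/2"])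
  then show "\<forall>\<^sub>F \<delta> in at_right 0. f \<delta> \<le> ennreal (\<delta> powr (-\<epsilon>)) * h \<delta>"
  proof eventually_elim
    case (elim \<delta>)
    have "f \<delta> \<le> ennreal (\<delta> powr (-(\<epsilon>/2))) * (ennreal (\<delta> powr (-(\<epsilon>/2))) * h \<delta>)"
      using elim by (meson mult_left_mono order_trans zero_le)
    also have "\<dots> = ennreal (\<delta> powr (-(\<epsilon>/2)) * \<delta> powr (-(\<epsilon>/2))) * h \<delta>"
      by (simp add: ennreal_mult mult.assoc)
    also have "\<delta> powr (-(\<epsilon>/2)) * \<delta> powr (-(\<epsilon>/2)) = \<delta> powr (-\<epsilon>)" by (simp add: powr_add[symmetric])
    finally show ?case .
  qed
qed

lemma elog_mono: "x \<le> y \<Longrightarrow> elog x \<le> elog y"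
  by (cases x; cases y) (auto simp: elog_def top_unique ennreal_eq_0_iff)

lemma elog_mult_ennreal:
  assumes "c > 0"
  shows "elog (ennreal c * x) = ereal (ln c) + elog x"
proof (cases x)
  case (real r)
  then show ?thesis using assms
    by (cases "r = 0") (auto simp: elog_def ennreal_mult[symmetric] ln_mult)
qed (use assms in \<open>auto simp: elog_def ennreal_mult_top\<close>)

lemma dominated_elog:
  assumes "dominated f g" "\<epsilon> > 0"
  shows "\<forall>\<^sub>F \<delta> in at_right 0. elog (f \<delta>) / ereal (- ln \<delta>) \<le> elog (g \<delta>) / ereal (- ln \<delta>) + ereal \<epsilon>"
proof -
  have "\<forall>\<^sub>F \<delta> in at_right 0. f \<delta> \<le> ennreal (\<delta> powr (-\<epsilon>)) * g \<delta>"
    using assms unfolding dominated_def by auto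
  then show ?thesis using eventually_at_right_0_less[of 1, OF zero_less_one]
  proof eventually_elim
    case (elim \<delta>)
    then have ln: "- ln \<delta> > 0" by simp
    have "elog (f \<delta>) \<le> ereal (\<epsilon> * - ln \<delta>) + elog (g \<delta>)"
      using elog_mono[OF elim(1)] elim by (simp add: elog_mult_ennreal ln_powr)
    then have "elog (f \<delta>) / ereal (- ln \<delta>) \<le> (ereal (\<epsilon> * - ln \<delta>) + elog (g \<delta>)) / ereal (- ln \<delta>)"
      using ln by (intro ereal_divide_right_mono) auto
    also have "\<dots> = elog (g \<delta>) / ereal (- ln \<delta>) + ereal \<epsilon>"
      using ln elim by (cases "elog (g \<delta>)") (auto simp: field_simps)
    finally show ?case .
  qed
qed

lemma scaling_mono:
  assumes "dominated f g"
  shows "scaling_liminf f \<le> scaling_liminf g" "scaling_limsup f \<le> scaling_limsup g"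
proof -
  have F: "at_right (0::real) \<noteq> bot" by simp
  show "scaling_liminf f \<le> scaling_liminf g"
  proof (rule ereal_le_epsilon)
    fix e :: ereal assume e: "e > 0"
    show "scaling_liminf f \<le> scaling_liminf g + e"
    proof (cases e)
      case (real r)
      then have "r > 0" using e by simp
      from Liminf_mono[OF dominated_elog[OF assms this]]
      show ?thesis unfolding scaling_liminf_def real using F by (subst (asm) Liminf_add_ereal_right) auto
    qed (use e in auto)
  qed
  show "scaling_limsup f \<le> scaling_limsup g"
  proof (rule ereal_le_epsilon)
    fix e :: ereal assume e: "e > 0"
    show "scaling_limsup f \<le> scaling_limsup g + e"
    proof (cases e)
      case (real r)
      then have "r > 0" using e by simp
      from Limsup_mono[OF dominated_elog[OF assms this]]
      show ?thesis unfolding scaling_limsup_def real using F by (subst (asm) Limsup_add_ereal_right) auto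
    qed (use e in auto)
  qed
qed

lemma scaling_powr:
  shows "scaling_liminf (\<lambda>\<delta>. ennreal (\<delta> powr (-s))) = ereal s"
    and "scaling_limsup (\<lambda>\<delta>. ennreal (\<delta> powr (-s))) = ereal s"
proof -
  have F: "at_right (0::real) \<noteq> bot" by simp
  have "\<forall>\<^sub>F \<delta> in at_right 0. elog (ennreal (\<delta> powr (-s))) / ereal (- ln \<delta>) = ereal s"
    using eventually_at_right_0_less[of 1, OF zero_less_one]
  proof eventually_elim
    case (elim \<delta>)
    then have ln: "- ln \<delta> > 0" by simp
    then show ?case using elim by (simp add: elog_def ln_powr)
  qed
  then have "((\<lambda>\<delta>. elog (ennreal (\<delta> powr (-s))) / ereal (- ln \<delta>)) \<longlongrightarrow> ereal s) (at_right 0)"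
    by (rule tendsto_eventually)
  then show "scaling_liminf (\<lambda>\<delta>. ennreal (\<delta> powr (-s))) = ereal s"
    "scaling_limsup (\<lambda>\<delta>. ennreal (\<delta> powr (-s))) = ereal s"
    unfolding scaling_liminf_def scaling_limsup_def
    using lim_imp_Liminf[OF F] lim_imp_Limsup[OF F] by auto
qed

definition comparable :: "(real \<Rightarrow> ennreal) \<Rightarrow> (real \<Rightarrow> ennreal) \<Rightarrow> bool" where
  "comparable f g \<longleftrightarrow> dominated f g \<and> dominated g f"

lemma scaling_cong:
  assumes "comparable f g"
  shows "scaling_liminf f = scaling_liminf g" "scaling_limsup f = scaling_limsup g"
  using assms scaling_mono unfolding comparable_def by (auto intro!: antisym)

lemma comparable_trans: "comparable f g \<Longrightarrow> comparable g h \<Longrightarrow> comparable f h"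
  unfolding comparable_def by (auto intro: dominated_trans)

lemma dominated_upper:
  assumes "\<And>s. s > \<gamma> \<Longrightarrow> \<exists>C>0. \<forall>\<kappa>\<ge>2. F \<kappa> \<le> C * \<kappa> powr s"
  shows "dominated (\<lambda>\<delta>. ennreal (F (2 / \<delta>))) (\<lambda>\<delta>. ennreal (\<delta> powr (- \<gamma>)))"
proof (rule dominated_const)
  fix \<epsilon> :: real assume "\<epsilon> > 0"
  then obtain C where C: "C > 0" "\<And>\<kappa>. \<kappa> \<ge> 2 \<Longrightarrow> F \<kappa> \<le> C * \<kappa> powr (\<gamma> + \<epsilon>)"
    using assms[of "\<gamma> + \<epsilon>"] by auto
  have "\<forall>\<^sub>F \<delta> in at_right 0. ennreal (F (2 / \<delta>)) \<le> ennreal (C * 2 powr (\<gamma> + \<epsilon>) * \<delta> powr - \<epsilon>) * ennreal (\<delta> powr - \<gamma>)"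
    using eventually_at_right_0_less[of 1, OF zero_less_one]
  proof eventually_elim
    case (elim \<delta>)
    have "F (2 / \<delta>) \<le> C * (2 / \<delta>) powr (\<gamma> + \<epsilon>)" using elim by (intro C(2)) (simp add: field_simps)
    also have "\<dots> = C * 2 powr (\<gamma> + \<epsilon>) * \<delta> powr - \<epsilon> * \<delta> powr - \<gamma>"
      using elim by (simp add: powr_divide powr_add powr_minus_divide)
    finally show ?case by (subst ennreal_mult''[symmetric]) (auto intro!: ennreal_leI)
  qed
  then show "\<exists>C. \<forall>\<^sub>F \<delta> in at_right 0. ennreal (F (2 / \<delta>)) \<le> ennreal (C * \<delta> powr - \<epsilon>) * ennreal (\<delta> powr - \<gamma>)"
    by blast
qed

lemma dominated_lower:
  assumes "\<And>s. s < \<gamma> \<Longrightarrow> \<exists>C>0. \<forall>\<kappa>\<ge>2. \<kappa> powr s \<le> C * F \<kappa>"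
  shows "dominated (\<lambda>\<delta>. ennreal (\<delta> powr (- \<gamma>))) (\<lambda>\<delta>. ennreal (F (2 / \<delta>)))"
proof (rule dominated_const)
  fix \<epsilon> :: real assume "\<epsilon> > 0"
  then obtain C where C: "C > 0" "\<And>\<kappa>. \<kappa> \<ge> 2 \<Longrightarrow> \<kappa> powr (\<gamma> - \<epsilon>) \<le> C * F \<kappa>"
    using assms[of "\<gamma> - \<epsilon>"] by auto
  have "\<forall>\<^sub>F \<delta> in at_right 0. ennreal (\<delta> powr - \<gamma>) \<le> ennreal (2 powr - (\<gamma> - \<epsilon>) * C * \<delta> powr - \<epsilon>) * ennreal (F (2 / \<delta>))"
    using eventually_at_right_0_less[of 1, OF zero_less_one]
  proof eventually_elim
    case (elim \<delta>)
    have "\<delta> powr - \<gamma> = 2 powr - (\<gamma> - \<epsilon>) * \<delta> powr - \<epsilon> * (2 / \<delta>) powr (\<gamma> - \<epsilon>)"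
      using elim by (simp add: powr_divide powr_diff powr_minus_divide field_simps)
    also have "\<dots> \<le> 2 powr - (\<gamma> - \<epsilon>) * \<delta> powr - \<epsilon> * (C * F (2 / \<delta>))"
      using elim by (intro mult_left_mono C(2)) (auto simp: field_simps)
    also have "\<dots> = 2 powr - (\<gamma> - \<epsilon>) * C * \<delta> powr - \<epsilon> * F (2 / \<delta>)" by (simp add: ac_simps)
    finally show ?case
      using C(1) by (subst ennreal_mult'[symmetric]) (auto intro!: ennreal_leI)
  qed
  then show "\<exists>C. \<forall>\<^sub>F \<delta> in at_right 0. ennreal (\<delta> powr - \<gamma>) \<le> ennreal (C * \<delta> powr - \<epsilon>) * ennreal (F (2 / \<delta>))"
    by blast
qed

section \<open>Partition sums\<close>

definition cell_sum :: "'a measure \<Rightarrow> 'a set \<Rightarrow> real \<Rightarrow> ('a \<Rightarrow> 'k) \<Rightarrow> real" where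
  "cell_sum M U q g = (\<Sum>k\<in>g ` U. measure M {x\<in>U. g x = k} powr q)"

lemma cell_sum_nonneg: "cell_sum M U q g \<ge> 0"
  unfolding cell_sum_def by (intro sum_nonneg) auto

lemma cell_sum_superset:
  assumes "finite K" "g ` U \<subseteq> K"
  shows "cell_sum M U q g = (\<Sum>k\<in>K. measure M {x\<in>U. g x = k} powr q)"
  unfolding cell_sum_def
proof (rule sum.mono_neutral_left[OF assms], rule ballI)
  fix k assume "k \<in> K - g ` U"
  then have e: "{x\<in>U. g x = k} = {}" by auto
  show "measure M {x\<in>U. g x = k} powr q = 0" unfolding e by simp
qed

lemma cell_sum_compare:
  fixes g :: "'a \<Rightarrow> 'k" and h :: "'a \<Rightarrow> 'l"
  assumes "finite_measure M"
    and fin: "finite (g ` U)" "finite (h ` U)"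
    and meas: "\<And>k. {x\<in>U. h x = k} \<in> sets M"
    and N1: "\<And>x. x \<in> U \<Longrightarrow> card (h ` {y\<in>U. g y = g x}) \<le> N"
    and N2: "\<And>x. x \<in> U \<Longrightarrow> card (g ` {y\<in>U. h y = h x}) \<le> N"
    and q: "q \<ge> 0"
  shows "cell_sum M U q g \<le> real N powr q * real N * cell_sum M U q h"
proof -
  interpret finite_measure M by fact
  define c where "c l = measure M {x\<in>U. h x = l}" for l
  define nb where "nb k = h ` {y\<in>U. g y = k}" for k
  have nb_fin: "finite (nb k)" for k unfolding nb_def using fin by (auto intro: finite_subset[of _ "h ` U"])
  have le: "measure M {x\<in>U. g x = k} powr q \<le> real N powr q * (\<Sum>l\<in>nb k. c l powr q)" if "k \<in> g ` U" for k
  proof -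
    have "measure M {x\<in>U. g x = k} \<le> measure M (\<Union>l\<in>nb k. {x\<in>U. h x = l})"
    proof (rule finite_measure_mono)
      show "(\<Union>l\<in>nb k. {x\<in>U. h x = l}) \<in> sets M"
        using meas nb_fin by (intro sets.finite_UN) auto
    qed (auto simp: nb_def)
    also have "\<dots> \<le> (\<Sum>l\<in>nb k. c l)"
      unfolding c_def using meas nb_fin by (intro finite_measure_subadditive_finite) auto
    finally have "measure M {x\<in>U. g x = k} powr q \<le> (\<Sum>l\<in>nb k. c l) powr q"
      using q by (intro powr_mono2) auto
    also have "\<dots> \<le> real (card (nb k)) powr q * (\<Sum>l\<in>nb k. c l powr q)"
      using nb_fin q by (intro powr_sum_le) (auto simp: c_def)
    also have "\<dots> \<le> real N powr q * (\<Sum>l\<in>nb k. c l powr q)"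
      using N1 that q unfolding nb_def by (intro mult_right_mono powr_mono2 sum_nonneg) auto
    finally show ?thesis .
  qed
  have "cell_sum M U q g \<le> (\<Sum>k\<in>g ` U. real N powr q * (\<Sum>l\<in>nb k. c l powr q))"
    unfolding cell_sum_def by (intro sum_mono le)
  also have "\<dots> = real N powr q * (\<Sum>k\<in>g ` U. \<Sum>l\<in>{l\<in>h ` U. l \<in> nb k}. c l powr q)"
    unfolding sum_distrib_left[symmetric] by (intro arg_cong2[where f="(*)"] sum.cong) (auto simp: nb_def)
  also have "(\<Sum>k\<in>g ` U. \<Sum>l\<in>{l\<in>h ` U. l \<in> nb k}. c l powr q)
      = (\<Sum>l\<in>h ` U. \<Sum>k\<in>{k\<in>g ` U. l \<in> nb k}. c l powr q)"
    by (rule sum.swap_restrict[OF fin])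
  also have "\<dots> \<le> (\<Sum>l\<in>h ` U. real N * c l powr q)"
  proof (rule sum_mono)
    fix l assume "l \<in> h ` U"
    then obtain x where x: "x \<in> U" "l = h x" by auto
    have "{k\<in>g ` U. l \<in> nb k} \<subseteq> g ` {y\<in>U. h y = h x}"
    proof
      fix k assume "k \<in> {k\<in>g ` U. l \<in> nb k}"
      then obtain y where "y \<in> U" "g y = k" "l = h y" unfolding nb_def by blast
      then show "k \<in> g ` {y\<in>U. h y = h x}" using x(2) by auto
    qed
    moreover have "finite (g ` {y\<in>U. h y = h x})"
      by (rule finite_subset[OF _ fin(1)]) auto
    ultimately have "card {k\<in>g ` U. l \<in> nb k} \<le> N"
      using N2[OF x(1)] by (meson card_mono order_trans)
    then show "(\<Sum>k\<in>{k\<in>g ` U. l \<in> nb k}. c l powr q) \<le> real N * c l powr q"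
      by (simp add: mult_right_mono)
  qed
  also have "\<dots> = real N * cell_sum M U q h"
    unfolding cell_sum_def c_def by (simp add: sum_distrib_left)
  finally show ?thesis by (simp add: mult.assoc mult_left_mono)
qed

lemma (in prob_space) cell_sum_bounds:
  assumes fin: "finite (g ` U)" and meas: "\<And>k. {x\<in>U. g x = k} \<in> sets M"
    and U: "prob U = 1" and q: "q \<ge> 0"
  shows "cell_sum M U q g \<le> real (card (g ` U))" "1 \<le> real (card (g ` U)) powr q * cell_sum M U q g"
proof -
  have "cell_sum M U q g \<le> (\<Sum>k\<in>g ` U. 1)"
    unfolding cell_sum_def using q by (intro sum_mono powr_le1) auto
  then show "cell_sum M U q g \<le> real (card (g ` U))" by simp
  have "U = (\<Union>k\<in>g ` U. {x\<in>U. g x = k})" by auto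
  then have "1 \<le> (\<Sum>k\<in>g ` U. prob {x\<in>U. g x = k})"
    using finite_measure_subadditive_finite[of "g ` U" "\<lambda>k. {x\<in>U. g x = k}"] fin meas U by auto
  then have "1 powr q \<le> (\<Sum>k\<in>g ` U. prob {x\<in>U. g x = k}) powr q"
    using q by (intro powr_mono2) auto
  also have "\<dots> \<le> real (card (g ` U)) powr q * cell_sum M U q g"
    unfolding cell_sum_def using fin q by (intro powr_sum_le) auto
  finally show "1 \<le> real (card (g ` U)) powr q * cell_sum M U q g" by simp
qed

section \<open>The support of a measure\<close>

lemma closed_measure_support: "closed (measure_support \<nu>)"
proof -
  have "- measure_support \<nu> = \<Union>{U. open U \<and> emeasure \<nu> U = 0}"
    unfolding measure_support_def by (auto simp: zero_less_iff_neq_zero)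
  then have "open (- measure_support \<nu>)" by auto
  then show ?thesis by (simp add: closed_def)
qed

lemma measure_support_subset_closed:
  assumes "prob_space \<nu>" "sets \<nu> = sets borel" "closed U" "measure \<nu> U = 1"
  shows "measure_support \<nu> \<subseteq> U"
proof
  interpret prob_space \<nu> by fact
  have "measure \<nu> (space \<nu> - U) = 0" using assms prob_compl[of U] by auto
  moreover have "space \<nu> = UNIV" using assms(2) by (metis sets_eq_imp_space_eq space_borel)
  ultimately have "emeasure \<nu> (- U) = 0" by (simp add: emeasure_eq_measure Compl_eq_Diff_UNIV)
  moreover fix x assume "x \<in> measure_support \<nu>"
  ultimately show "x \<in> U"
    using assms(3) unfolding measure_support_def by (auto simp: open_Compl dest!: spec[of _ "- U"])
qed

lemma emeasure_Compl_support:
  fixes \<nu> :: "'a::second_countable_topology measure"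
  assumes "sets \<nu> = sets borel"
  shows "emeasure \<nu> (- measure_support \<nu>) = 0"
proof -
  obtain B :: "'a set set" where B: "countable B" "topological_basis B"
    using ex_countable_basis by blast
  define B0 where "B0 = {b\<in>B. emeasure \<nu> b = 0}"
  have "- measure_support \<nu> \<subseteq> \<Union>B0"
  proof
    fix x assume "x \<in> - measure_support \<nu>"
    then obtain W where W: "open W" "x \<in> W" "emeasure \<nu> W = 0"
      unfolding measure_support_def by (auto simp: zero_less_iff_neq_zero)
    then obtain b where b: "b \<in> B" "x \<in> b" "b \<subseteq> W" using B(2) by (meson topological_basisE)
    have "emeasure \<nu> b \<le> emeasure \<nu> W" using b W assms by (intro emeasure_mono) auto
    then show "x \<in> \<Union>B0" using b W unfolding B0_def by auto
  qed
  moreover have "emeasure \<nu> (\<Union>B0) = 0"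
  proof -
    have "(\<Union>b\<in>B0. b) \<in> null_sets \<nu>"
      using B assms unfolding B0_def
      by (intro null_sets_UN') (auto simp: null_sets_def dest: topological_basis_open)
    then show ?thesis by auto
  qed
  moreover have "\<Union>B0 \<in> sets \<nu>"
    unfolding assms using B unfolding B0_def by (intro borel_open open_Union) (auto dest: topological_basis_open)
  ultimately show ?thesis using emeasure_mono[of "- measure_support \<nu>" "\<Union>B0" \<nu>] by (simp add: le_zero_eq)
qed

lemma measure_support_ball_pos:
  assumes "prob_space \<nu>" "sets \<nu> = sets borel" "x \<in> measure_support \<nu>" "r > 0"
  shows "measure \<nu> (ball x r) > 0"
proof -
  interpret \<nu>: prob_space \<nu> by fact
  have "emeasure \<nu> (ball x r) > 0" using assms(3,4) unfolding measure_support_def by auto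
  then show ?thesis by (simp add: \<nu>.emeasure_eq_measure)
qed

lemma ex_sparse_heavy_subset:
  fixes w :: "'a \<Rightarrow> real"
  assumes "finite X" "\<And>x. x \<in> X \<Longrightarrow> w x \<ge> 0" "\<And>x. R x x" "\<And>x y. R x y \<Longrightarrow> R y x"
    and "\<And>x. x \<in> X \<Longrightarrow> card {y\<in>X. R x y} \<le> N"
  shows "\<exists>Y\<subseteq>X. (\<forall>x\<in>Y. \<forall>y\<in>Y. R x y \<longrightarrow> x = y) \<and> sum w X \<le> real N * sum w Y"
  using assms(1,2,5)
proof (induction X rule: finite_psubset_induct)
  case (psubset X)
  show ?case
  proof (cases "X = {}")
    case False
    define m where "m = Max (w ` X)"
    have "m \<in> w ` X" unfolding m_def using False psubset by (intro Max_in) auto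
    then obtain x where x: "x \<in> X" "m = w x" by auto
    have le: "w y \<le> w x" if "y \<in> X" for y
      unfolding x(2)[symmetric] m_def using that psubset by auto
    define Z where "Z = {y\<in>X. R x y}"
    have "x \<in> Z" using x assms unfolding Z_def by auto
    then have sub: "X - Z \<subset> X" using x by auto
    have "card {y\<in>X - Z. R x y} \<le> N" if "x \<in> X - Z" for x
      using psubset.prems(2)[of x] that card_mono[of "{y\<in>X. R x y}" "{y\<in>X - Z. R x y}"] psubset.hyps
      by (auto intro: order_trans)
    then have "\<exists>Y\<subseteq>X - Z. (\<forall>x\<in>Y. \<forall>y\<in>Y. R x y \<longrightarrow> x = y) \<and> sum w (X - Z) \<le> real N * sum w Y"
      using psubset.prems(1) by (intro psubset.IH[OF sub]) auto
    then obtain Y where Y: "Y \<subseteq> X - Z" "\<forall>x\<in>Y. \<forall>y\<in>Y. R x y \<longrightarrow> x = y" "sum w (X - Z) \<le> real N * sum w Y"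
      by blast
    have xY: "x \<notin> Y" using Y \<open>x \<in> Z\<close> by auto
    have finY: "finite Y" using Y psubset.hyps by (meson finite_Diff finite_subset)
    have "sum w X = sum w Z + sum w (X - Z)"
      using psubset.hyps by (subst sum.subset_diff[of Z X]) (auto simp: Z_def)
    also have "sum w Z \<le> real (card Z) * w x"
      using le sum_bounded_above[of Z w "w x"] unfolding Z_def by auto
    also have "\<dots> \<le> real N * w x"
      using psubset.prems x unfolding Z_def by (intro mult_right_mono) auto
    finally have "sum w X \<le> real N * sum w (insert x Y)"
      using Y(3) xY finY by (simp add: algebra_simps)
    moreover have "\<forall>a\<in>insert x Y. \<forall>b\<in>insert x Y. R a b \<longrightarrow> a = b"
      using Y assms(4) unfolding Z_def by blast
    ultimately show ?thesis using Y x by (intro exI[of _ "insert x Y"]) auto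
  qed auto
qed

lemma nn_integral_count_space_le_infsum:
  fixes f :: "'a \<Rightarrow> ennreal"
  assumes "countable C"
  shows "(\<integral>\<^sup>+x. f x \<partial>count_space C) \<le> (\<Sum>\<^sub>\<infinity>x\<in>C. f x)"
proof (cases "finite C")
  case True
  then show ?thesis by (simp add: nn_integral_count_space_finite)
next
  case False
  define h where "h = from_nat_into C"
  have bij: "bij_betw h UNIV C" unfolding h_def using assms False by (rule bij_betw_from_nat_into)
  have "(\<integral>\<^sup>+x. f x \<partial>count_space C) = (\<integral>\<^sup>+n. f (h n) \<partial>count_space UNIV)"
    by (rule nn_integral_bij_count_space[OF bij, symmetric])
  also have "\<dots> = (SUP n. \<Sum>i<n. f (h i))"
    by (simp add: nn_integral_count_space_nat suminf_eq_SUP)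
  also have "\<dots> \<le> (\<Sum>\<^sub>\<infinity>x\<in>C. f x)"
  proof (rule SUP_least)
    fix n
    have inj: "inj_on h {..<n}" using bij by (auto simp: bij_betw_def intro: inj_on_subset)
    have "(\<Sum>i<n. f (h i)) = sum f (h ` {..<n})" using inj by (simp add: sum.reindex)
    also have "\<dots> \<le> (\<Sum>\<^sub>\<infinity>x\<in>C. f x)"
      unfolding nonneg_infsum_complete[OF zero_le]
      using bij by (intro SUP_upper) (auto simp: bij_betw_def)
    finally show "(\<Sum>i<n. f (h i)) \<le> (\<Sum>\<^sub>\<infinity>x\<in>C. f x)" .
  qed
  finally show ?thesis .
qed

lemma emeasure_UN_le_nn_integral:
  assumes "countable C" "\<And>x. x \<in> C \<Longrightarrow> A x \<in> sets M"
  shows "emeasure M (\<Union>x\<in>C. A x) \<le> (\<integral>\<^sup>+x. emeasure M (A x) \<partial>count_space C)"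
proof -
  have meas: "(\<Union>x\<in>C. A x) \<in> sets M" using assms by (intro sets.countable_UN'') auto
  have "emeasure M (\<Union>x\<in>C. A x) = (\<integral>\<^sup>+y. indicator (\<Union>x\<in>C. A x) y \<partial>M)"
    using meas by simp
  also have "\<dots> \<le> (\<integral>\<^sup>+y. \<integral>\<^sup>+x. indicator (A x) y \<partial>count_space C \<partial>M)"
  proof (intro nn_integral_mono)
    fix y
    show "indicator (\<Union>x\<in>C. A x) y \<le> (\<integral>\<^sup>+x. indicator (A x) y \<partial>count_space C :: ennreal)"
    proof (cases "y \<in> (\<Union>x\<in>C. A x)")
      case True
      then obtain x0 where x0: "x0 \<in> C" "y \<in> A x0" by auto
      have "(1::ennreal) = (\<integral>\<^sup>+x. indicator {x0} x \<partial>count_space C)"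
        using x0 by simp
      also have "\<dots> \<le> (\<integral>\<^sup>+x. indicator (A x) y \<partial>count_space C)"
        using x0 by (intro nn_integral_mono) (auto simp: indicator_def)
      finally show ?thesis using True by simp
    qed simp
  qed
  also have "\<dots> = (\<integral>\<^sup>+x. \<integral>\<^sup>+y. indicator (A x) y \<partial>M \<partial>count_space C)"
    using assms by (intro nn_integral_count_space_nn_integral) auto
  also have "\<dots> = (\<integral>\<^sup>+x. emeasure M (A x) \<partial>count_space C)"
    using assms by (intro nn_integral_cong) simp
  finally show ?thesis .
qed

section \<open>Partition sums and the multifractal dimensions\<close>

locale mesh = prob_space \<nu> for \<nu> :: "'a::euclidean_space measure" +
  fixes U :: "'a set" and g :: "'a \<Rightarrow> 'k" and N :: nat and \<delta> :: real
  assumes borel: "sets \<nu> = sets borel"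
    and closed_U: "closed U" and prob_U: "prob U = 1"
    and finite_cells: "finite (g ` U)"
    and meas_cell: "\<And>k. {x\<in>U. g x = k} \<in> sets borel"
    and pos: "\<delta> > 0"
    and small: "\<And>x y. x \<in> U \<Longrightarrow> y \<in> U \<Longrightarrow> g x = g y \<Longrightarrow> dist x y \<le> \<delta>"
    and card_near: "\<And>x. x \<in> U \<Longrightarrow> card (g ` (U \<inter> cball x (2 * \<delta>))) \<le> N"
begin

definition cell where "cell k = {x\<in>U. g x = k}"

definition mass where "mass k = prob (cell k)"

definition nbs where "nbs k = g ` (\<Union>x\<in>cell k. U \<inter> cball x \<delta>)"

definition nb_mass where "nb_mass k = (\<Sum>l\<in>nbs k. mass l)"

lemma cell_sum_eq: "cell_sum \<nu> U q g = (\<Sum>k\<in>g ` U. mass k powr q)"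
  unfolding cell_sum_def mass_def cell_def ..

lemma cell_sets [simp]: "cell k \<in> sets \<nu>"
  unfolding cell_def borel by (rule meas_cell)

lemma cell_borel [simp]: "cell k \<in> sets borel"
  unfolding cell_def by (rule meas_cell)

lemma mass_nonneg [simp]: "mass k \<ge> 0" unfolding mass_def by simp

lemma support_subset: "measure_support \<nu> \<subseteq> U"
  by (rule measure_support_subset_closed[OF prob_space_axioms borel closed_U prob_U])

lemma finite_nbs [simp]: "finite (nbs k)"
  unfolding nbs_def using finite_cells by (auto intro: finite_subset[of _ "g ` U"])

lemma nbs_subset: "nbs k \<subseteq> g ` U" unfolding nbs_def by auto

lemma nbs_refl: "k \<in> g ` U \<Longrightarrow> k \<in> nbs k"
  unfolding nbs_def cell_def using pos by force

lemma nbs_sym: "l \<in> nbs k \<Longrightarrow> k \<in> nbs l"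
  unfolding nbs_def cell_def by (force simp: dist_commute)

lemma card_nbs: assumes "k \<in> g ` U" shows "card (nbs k) \<le> N"
proof -
  obtain x where x: "x \<in> U" "k = g x" using assms by auto
  have "nbs k \<subseteq> g ` (U \<inter> cball x (2 * \<delta>))"
  proof -
    have "dist x y \<le> 2 * \<delta>" if "z \<in> U" "g z = g x" "dist z y \<le> \<delta>" for y z
      using small[of x z] that x dist_triangle[of x y z] by simp
    then show ?thesis unfolding nbs_def cell_def x by auto
  qed
  then have "card (nbs k) \<le> card (g ` (U \<inter> cball x (2 * \<delta>)))"
    using finite_cells by (intro card_mono) (auto intro: finite_subset[of _ "g ` U"])
  then show ?thesis using card_near[OF x(1)] by simp
qed

lemma N_pos: "real N > 0"
proof -
  obtain x where "x \<in> U" using prob_U by fastforce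
  then have "g x \<in> nbs (g x)" by (intro nbs_refl) auto
  then have "card (nbs (g x)) > 0" by (auto simp: card_gt_0_iff)
  then show ?thesis using card_nbs[of "g x"] \<open>x \<in> U\<close> by auto
qed

lemma mass_le_ball: "x \<in> cell k \<Longrightarrow> mass k \<le> prob (cball x \<delta>)"
  unfolding mass_def cell_def using small borel by (intro finite_measure_mono) auto

lemma prob_Int_U: assumes "A \<in> sets borel" shows "prob A = prob (A \<inter> U)"
proof -
  have "AE x in \<nu>. x \<in> U" using prob_U borel closed_U by (intro AE_prob_1) auto
  then show ?thesis using assms borel closed_U
    by (intro finite_measure_eq_AE) auto
qed

lemma ball_le_nb_mass:
  assumes "x \<in> U" shows "prob (cball x \<delta>) \<le> nb_mass (g x)"
proof -
  have "prob (cball x \<delta>) = prob (cball x \<delta> \<inter> U)" by (rule prob_Int_U) auto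
  also have "\<dots> \<le> prob (\<Union>l\<in>nbs (g x). cell l)"
  proof (rule finite_measure_mono)
    show "(\<Union>l\<in>nbs (g x). cell l) \<in> events" by (intro sets.finite_UN) auto
  qed (use assms in \<open>auto simp: nbs_def cell_def\<close>)
  also have "\<dots> \<le> nb_mass (g x)"
    unfolding nb_mass_def mass_def by (intro finite_measure_subadditive_finite) auto
  finally show ?thesis .
qed

lemma sum_nb_mass:
  assumes q: "q \<ge> 0"
  shows "(\<Sum>k\<in>g ` U. nb_mass k powr q) \<le> real N powr q * real N * cell_sum \<nu> U q g"
proof -
  have "nb_mass k powr q \<le> real N powr q * (\<Sum>l\<in>nbs k. mass l powr q)" if "k \<in> g ` U" for k
  proof -
    have "nb_mass k powr q \<le> real (card (nbs k)) powr q * (\<Sum>l\<in>nbs k. mass l powr q)"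
      unfolding nb_mass_def using q by (intro powr_sum_le) auto
    also have "\<dots> \<le> real N powr q * (\<Sum>l\<in>nbs k. mass l powr q)"
      using card_nbs[OF that] q by (intro mult_right_mono powr_mono2 sum_nonneg) auto
    finally show ?thesis .
  qed
  then have "(\<Sum>k\<in>g ` U. nb_mass k powr q) \<le> (\<Sum>k\<in>g ` U. real N powr q * (\<Sum>l\<in>nbs k. mass l powr q))"
    by (rule sum_mono)
  also have "\<dots> = real N powr q * (\<Sum>k\<in>g ` U. \<Sum>l\<in>{l\<in>g ` U. l \<in> nbs k}. mass l powr q)"
    unfolding sum_distrib_left[symmetric] using nbs_subset
    by (intro arg_cong2[where f="(*)"] sum.cong) auto
  also have "(\<Sum>k\<in>g ` U. \<Sum>l\<in>{l\<in>g ` U. l \<in> nbs k}. mass l powr q)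
      = (\<Sum>l\<in>g ` U. \<Sum>k\<in>{k\<in>g ` U. l \<in> nbs k}. mass l powr q)"
    by (rule sum.swap_restrict[OF finite_cells finite_cells])
  also have "\<dots> \<le> (\<Sum>l\<in>g ` U. real N * mass l powr q)"
  proof (rule sum_mono)
    fix l assume l: "l \<in> g ` U"
    have "card {k\<in>g ` U. l \<in> nbs k} \<le> card (nbs l)"
      by (intro card_mono) (auto dest: nbs_sym)
    then show "(\<Sum>k\<in>{k\<in>g ` U. l \<in> nbs k}. mass l powr q) \<le> real N * mass l powr q"
      using card_nbs[OF l] by (simp add: mult_right_mono)
  qed
  also have "\<dots> = real N * cell_sum \<nu> U q g" unfolding cell_sum_eq by (simp add: sum_distrib_left)
  finally show ?thesis by (simp add: mult.assoc mult_left_mono)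
qed

lemma sum_balls_le:
  assumes "X \<subseteq> U" "inj_on g X" "q \<ge> 0"
  shows "(\<Sum>x\<in>X. prob (cball x \<delta>) powr q) \<le> real N powr q * real N * cell_sum \<nu> U q g"
proof -
  have "(\<Sum>x\<in>X. prob (cball x \<delta>) powr q) \<le> (\<Sum>x\<in>X. nb_mass (g x) powr q)"
    using assms ball_le_nb_mass by (intro sum_mono powr_mono2) auto
  also have "\<dots> = (\<Sum>k\<in>g ` X. nb_mass k powr q)" using assms by (simp add: sum.reindex)
  also have "\<dots> \<le> (\<Sum>k\<in>g ` U. nb_mass k powr q)"
    using assms finite_cells by (intro sum_mono2) auto
  finally show ?thesis using sum_nb_mass[OF assms(3)] by simp
qed

lemma packing_sum_le:
  assumes q: "q \<ge> 0"
  shows "packing_sum \<nu> q \<delta> \<le> ennreal (real N powr q * real N) * ennreal (cell_sum \<nu> U q g)"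
  unfolding packing_sum_def
proof (rule SUP_least)
  fix C assume "C \<in> {C. C \<subseteq> measure_support \<nu> \<and> disjoint_family_on (\<lambda>x. cball x \<delta>) C}"
  then have C: "C \<subseteq> U" "disjoint_family_on (\<lambda>x. cball x \<delta>) C" using support_subset by auto
  have inj: "inj_on g C"
  proof (rule inj_onI, rule ccontr)
    fix x y assume xy: "x \<in> C" "y \<in> C" "g x = g y" "x \<noteq> y"
    then have "y \<in> cball x \<delta> \<inter> cball y \<delta>" using small[of x y] C pos by auto
    then show False using C xy unfolding disjoint_family_on_def by blast
  qed
  show "(\<Sum>\<^sub>\<infinity>x\<in>C. ennreal (prob (cball x \<delta>) powr q))
      \<le> ennreal (real N powr q * real N) * ennreal (cell_sum \<nu> U q g)"
    unfolding nonneg_infsum_complete[OF zero_le]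
  proof (rule SUP_least)
    fix F assume F: "F \<in> {F. finite F \<and> F \<subseteq> C}"
    then have "(\<Sum>x\<in>F. prob (cball x \<delta>) powr q) \<le> real N powr q * real N * cell_sum \<nu> U q g"
      using C inj q by (intro sum_balls_le) (auto intro: inj_on_subset)
    then show "(\<Sum>x\<in>F. ennreal (prob (cball x \<delta>) powr q))
      \<le> ennreal (real N powr q * real N) * ennreal (cell_sum \<nu> U q g)"
      by (simp add: sum_ennreal ennreal_leI ennreal_mult'[symmetric] cell_sum_nonneg)
  qed
qed

lemma emeasure_cell_support: "emeasure \<nu> (cell k \<inter> measure_support \<nu>) = ennreal (mass k)"
proof -
  have "AE x in \<nu>. x \<in> measure_support \<nu>"
  proof (rule AE_I)
    show "emeasure \<nu> (- measure_support \<nu>) = 0" by (rule emeasure_Compl_support[OF borel])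
    show "- measure_support \<nu> \<in> sets \<nu>" using borel closed_measure_support[of \<nu>] by (simp add: borel_open open_Compl)
  qed auto
  then have "emeasure \<nu> (cell k \<inter> measure_support \<nu>) = emeasure \<nu> (cell k)"
  proof (intro emeasure_eq_AE)
    show "cell k \<inter> measure_support \<nu> \<in> events"
      using closed_measure_support[of \<nu>] by (intro sets.Int) (auto simp: borel)
  qed auto
  then show ?thesis unfolding mass_def by (simp add: emeasure_eq_measure)
qed

lemma ex_cell_support: assumes "mass k > 0" shows "\<exists>x. x \<in> cell k \<inter> measure_support \<nu>"
proof (rule ccontr)
  assume "\<nexists>x. x \<in> cell k \<inter> measure_support \<nu>"
  then have "cell k \<inter> measure_support \<nu> = {}" by auto
  then have "emeasure \<nu> (cell k \<inter> measure_support \<nu>) = 0" by (simp only: emeasure_empty)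
  then show False unfolding emeasure_cell_support using assms by simp
qed

definition centre where "centre k = (SOME x. x \<in> cell k \<inter> measure_support \<nu>)"

lemma centre:
  assumes "mass k > 0"
  shows "centre k \<in> U" "g (centre k) = k" "centre k \<in> measure_support \<nu>" "mass k \<le> prob (cball (centre k) \<delta>)"
proof -
  have "centre k \<in> cell k \<inter> measure_support \<nu>"
    unfolding centre_def using someI_ex[OF ex_cell_support[OF assms]] .
  then show "centre k \<in> U" "g (centre k) = k" "centre k \<in> measure_support \<nu>" "mass k \<le> prob (cball (centre k) \<delta>)"
    using mass_le_ball[of "centre k" k] by (auto simp: cell_def)
qed

definition charged where "charged = {k\<in>g ` U. mass k > 0}"

lemma finite_charged [simp]: "finite charged" unfolding charged_def using finite_cells by auto

lemma cell_sum_charged: "cell_sum \<nu> U q g = (\<Sum>k\<in>charged. mass k powr q)"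
  unfolding cell_sum_eq using finite_cells
  by (intro sum.mono_neutral_right) (auto simp: charged_def order_less_le)

lemma inj_centre: "inj_on centre charged"
  by (rule inj_on_inverseI[of _ g]) (auto simp: charged_def centre)

lemma cell_sum_le_centres:
  assumes "q \<ge> 0"
  shows "cell_sum \<nu> U q g \<le> (\<Sum>x\<in>centre ` charged. prob (cball x \<delta>) powr q)"
  unfolding cell_sum_charged sum.reindex[OF inj_centre] o_def
  using assms centre by (intro sum_mono powr_mono2) (auto simp: charged_def)

lemma cell_sum_le_packing:
  assumes q: "q \<ge> 0"
  shows "ennreal (cell_sum \<nu> U q g) \<le> ennreal (real N) * packing_sum \<nu> q \<delta>"
proof -
  define X where "X = centre ` charged"
  define w where "w x = prob (cball x \<delta>) powr q" for x
  have X: "finite X" "X \<subseteq> U" "X \<subseteq> measure_support \<nu>" "inj_on g X"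
    unfolding X_def using centre by (auto intro!: inj_onI) (auto simp: charged_def)
  have "\<exists>Y\<subseteq>X. (\<forall>x\<in>Y. \<forall>y\<in>Y. dist x y \<le> 2 * \<delta> \<longrightarrow> x = y) \<and> sum w X \<le> real N * sum w Y"
  proof (rule ex_sparse_heavy_subset)
    fix x assume x: "x \<in> X"
    have "card {y\<in>X. dist x y \<le> 2 * \<delta>} = card (g ` {y\<in>X. dist x y \<le> 2 * \<delta>})"
      using X by (intro card_image[symmetric]) (auto intro: inj_on_subset)
    also have "\<dots> \<le> card (g ` (U \<inter> cball x (2 * \<delta>)))"
      using finite_cells X by (intro card_mono) (auto intro: finite_subset[of _ "g ` U"])
    finally show "card {y\<in>X. dist x y \<le> 2 * \<delta>} \<le> N" using card_near[of x] X x by auto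
  qed (use X pos in \<open>auto simp: w_def dist_commute\<close>)
  then obtain Y where Y: "Y \<subseteq> X" "\<And>x y. x \<in> Y \<Longrightarrow> y \<in> Y \<Longrightarrow> dist x y \<le> 2 * \<delta> \<Longrightarrow> x = y"
    "sum w X \<le> real N * sum w Y" by blast
  have "disjoint_family_on (\<lambda>x. cball x \<delta>) Y"
    unfolding disjoint_family_on_def
  proof (intro ballI impI)
    fix x y assume xy: "x \<in> Y" "y \<in> Y" "x \<noteq> y"
    then have "dist x y > 2 * \<delta>" using Y(2)[of x y] by force
    then show "cball x \<delta> \<inter> cball y \<delta> = {}" by (intro disjoint_cballI) simp
  qed
  then have "(\<Sum>\<^sub>\<infinity>x\<in>Y. ennreal (w x)) \<le> packing_sum \<nu> q \<delta>"
    unfolding packing_sum_def w_def using Y X by (intro SUP_upper) auto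
  moreover have "finite Y" using Y X by (auto intro: finite_subset)
  ultimately have "ennreal (sum w Y) \<le> packing_sum \<nu> q \<delta>" by (simp add: w_def sum_ennreal)
  moreover have "ennreal (cell_sum \<nu> U q g) \<le> ennreal (real N) * ennreal (sum w Y)"
    using cell_sum_le_centres[OF q] Y(3) unfolding X_def[symmetric] w_def[symmetric]
    by (simp add: ennreal_mult''[symmetric] sum_nonneg w_def ennreal_leI)
  ultimately show ?thesis by (meson mult_left_mono order_trans zero_le)
qed

lemma covering_sum_le:
  assumes q: "q \<ge> 0"
  shows "covering_sum \<nu> q \<delta> \<le> ennreal (real N powr q * real N) * ennreal (cell_sum \<nu> U q g)"
proof -
  define S where "S = measure_support \<nu>"
  define c where "c k = (SOME x. x \<in> S \<and> g x = k)" for k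
  have c: "c k \<in> S" "g (c k) = k" if "k \<in> g ` S" for k
    using someI_ex[of "\<lambda>x. x \<in> S \<and> g x = k"] that unfolding c_def by auto
  define X where "X = c ` g ` S"
  have SU: "S \<subseteq> U" unfolding S_def by (rule support_subset)
  then have fin: "finite X" unfolding X_def using finite_cells by (metis finite_imageI finite_subset image_mono)
  have X: "X \<subseteq> S" "inj_on g X" unfolding X_def using c by (auto intro!: inj_onI)
  have "S \<subseteq> (\<Union>x\<in>X. cball x \<delta>)"
  proof
    fix x assume x: "x \<in> S"
    then have "dist (c (g x)) x \<le> \<delta>" using c[of "g x"] SU by (intro small) auto
    then show "x \<in> (\<Union>x\<in>X. cball x \<delta>)" unfolding X_def using x by auto
  qed
  then have "covering_sum \<nu> q \<delta> \<le> (\<Sum>\<^sub>\<infinity>x\<in>X. ennreal (prob (cball x \<delta>) powr q))"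
    unfolding covering_sum_def S_def[symmetric] using X fin by (intro INF_lower) (auto intro: countable_finite)
  also have "\<dots> = ennreal (\<Sum>x\<in>X. prob (cball x \<delta>) powr q)" using fin by (simp add: sum_ennreal)
  also have "\<dots> \<le> ennreal (real N powr q * real N * cell_sum \<nu> U q g)"
    using X SU q by (intro ennreal_leI sum_balls_le) auto
  finally show ?thesis by (simp add: ennreal_mult'[symmetric] cell_sum_nonneg)
qed

lemma cell_sum_le_covering:
  assumes q: "0 \<le> q" "q \<le> 1"
  shows "ennreal (cell_sum \<nu> U q g) \<le> ennreal (real N) * covering_sum \<nu> q \<delta>"
proof -
  have bound: "ennreal (cell_sum \<nu> U q g) \<le> ennreal (real N) * (\<Sum>\<^sub>\<infinity>x\<in>C. ennreal (prob (cball x \<delta>) powr q))"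
    if C: "countable C" "C \<subseteq> measure_support \<nu>" "measure_support \<nu> \<subseteq> (\<Union>x\<in>C. cball x \<delta>)" for C
  proof -
    have CU: "C \<subseteq> U" using C support_subset by auto
    define f where "f x = ennreal (prob (cball x \<delta>) powr q)" for x
    define meets where "meets k = {x\<in>C. k \<in> nbs (g x)}" for k
    have key: "ennreal (mass k powr q) \<le> (\<integral>\<^sup>+x. f x * indicator (meets k) x \<partial>count_space C)"
      if k: "k \<in> charged" for k
    proof -
      define A where "A x = cball x \<delta> \<inter> cell k" for x
      have m: "mass k > 0" using k unfolding charged_def by auto
      have A: "A x \<in> sets \<nu>" for x unfolding A_def by (intro sets.Int) (auto simp: borel)
      have pt: "ennreal (mass k powr (q - 1)) * emeasure \<nu> (A x) \<le> f x * indicator (meets k) x" if x: "x \<in> C" for x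
      proof (cases "prob (A x) = 0")
        case True then show ?thesis by (simp add: emeasure_eq_measure)
      next
        case False
        then have "A x \<noteq> {}" by auto
        then have "x \<in> meets k" using x CU unfolding meets_def nbs_def A_def cell_def by force
        have a: "0 < prob (A x)" using False by (simp add: order_less_le)
        have "prob (A x) \<le> mass k" unfolding mass_def by (rule finite_measure_mono) (auto simp: A_def)
        then have "mass k powr (q - 1) * prob (A x) \<le> prob (A x) powr (q - 1) * prob (A x)"
          using q a by (intro mult_right_mono powr_mono2') auto
        also have "\<dots> = prob (A x) powr q" using a by (simp add: powr_diff)
        also have "\<dots> \<le> prob (cball x \<delta>) powr q"
          using q borel by (intro powr_mono2 finite_measure_mono) (auto simp: A_def)
        finally show ?thesis using \<open>x \<in> meets k\<close> unfolding f_def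
          by (simp add: emeasure_eq_measure ennreal_mult'[symmetric] ennreal_leI)
      qed
      have "ennreal (mass k) = emeasure \<nu> (cell k \<inter> measure_support \<nu>)" by (rule emeasure_cell_support[symmetric])
      also have "\<dots> \<le> emeasure \<nu> (\<Union>x\<in>C. A x)"
      proof (intro emeasure_mono)
        show "(\<Union>x\<in>C. A x) \<in> sets \<nu>" using C A by (intro sets.countable_UN'') auto
      qed (use C in \<open>auto simp: A_def\<close>)
      also have "\<dots> \<le> (\<integral>\<^sup>+x. emeasure \<nu> (A x) \<partial>count_space C)"
        using C A by (intro emeasure_UN_le_nn_integral) auto
      finally have "ennreal (mass k powr (q - 1)) * ennreal (mass k)
          \<le> ennreal (mass k powr (q - 1)) * (\<integral>\<^sup>+x. emeasure \<nu> (A x) \<partial>count_space C)"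
        by (intro mult_left_mono) auto
      also have "\<dots> = (\<integral>\<^sup>+x. ennreal (mass k powr (q - 1)) * emeasure \<nu> (A x) \<partial>count_space C)"
        by (simp add: nn_integral_cmult)
      also have "\<dots> \<le> (\<integral>\<^sup>+x. f x * indicator (meets k) x \<partial>count_space C)"
        by (intro nn_integral_mono) (auto intro: pt)
      finally show ?thesis using m by (simp add: ennreal_mult'[symmetric] powr_diff)
    qed
    have "ennreal (cell_sum \<nu> U q g) = (\<Sum>k\<in>charged. ennreal (mass k powr q))"
      unfolding cell_sum_charged by (simp add: sum_ennreal)
    also have "\<dots> \<le> (\<Sum>k\<in>charged. \<integral>\<^sup>+x. f x * indicator (meets k) x \<partial>count_space C)"
      by (intro sum_mono key)
    also have "\<dots> = (\<integral>\<^sup>+x. (\<Sum>k\<in>charged. f x * indicator (meets k) x) \<partial>count_space C)"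
      by (intro nn_integral_sum[symmetric]) auto
    also have "\<dots> \<le> (\<integral>\<^sup>+x. ennreal (real N) * f x \<partial>count_space C)"
    proof (intro nn_integral_mono)
      fix x assume "x \<in> space (count_space C)"
      then have x: "x \<in> C" by simp
      have "(\<Sum>k\<in>charged. indicator (meets k) x :: ennreal) = (\<Sum>k\<in>charged \<inter> nbs (g x). 1)"
        unfolding sum.inter_restrict[OF finite_charged]
        using x by (intro sum.cong) (auto simp: meets_def indicator_def)
      also have "\<dots> = ennreal (real (card (charged \<inter> nbs (g x))))" by (simp add: ennreal_of_nat_eq_real_of_nat)
      also have "\<dots> \<le> ennreal (real N)"
        using card_mono[of "nbs (g x)" "charged \<inter> nbs (g x)"] card_nbs[of "g x"] x CU
        by (intro ennreal_leI) (auto intro: order_trans)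
      finally have "f x * (\<Sum>k\<in>charged. indicator (meets k) x) \<le> f x * ennreal (real N)"
        by (intro mult_left_mono) auto
      then show "(\<Sum>k\<in>charged. f x * indicator (meets k) x) \<le> ennreal (real N) * f x"
        unfolding sum_distrib_left mult.commute[of "ennreal (real N)"] .
    qed
    also have "\<dots> = ennreal (real N) * (\<integral>\<^sup>+x. f x \<partial>count_space C)" by (simp add: nn_integral_cmult)
    also have "\<dots> \<le> ennreal (real N) * (\<Sum>\<^sub>\<infinity>x\<in>C. f x)"
      using C by (intro mult_left_mono nn_integral_count_space_le_infsum) auto
    finally show ?thesis unfolding f_def .
  qed
  have "ennreal (cell_sum \<nu> U q g) / ennreal (real N) \<le> covering_sum \<nu> q \<delta>"
    unfolding covering_sum_def
  proof (rule INF_greatest)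
    fix C assume "C \<in> {C. countable C \<and> C \<subseteq> measure_support \<nu> \<and> measure_support \<nu> \<subseteq> (\<Union>x\<in>C. cball x \<delta>)}"
    then show "ennreal (cell_sum \<nu> U q g) / ennreal (real N) \<le> (\<Sum>\<^sub>\<infinity>x\<in>C. ennreal (prob (cball x \<delta>) powr q))"
      using bound[of C] N_pos by (intro divide_le_posI_ennreal) (auto simp: mult.commute)
  qed
  then have "ennreal (real N) * (ennreal (cell_sum \<nu> U q g) / ennreal (real N)) \<le> ennreal (real N) * covering_sum \<nu> q \<delta>"
    by (intro mult_left_mono) auto
  then show ?thesis using N_pos by (simp add: ennreal_times_divide ennreal_mult'[symmetric] divide_ennreal cell_sum_nonneg)
qed

lemma Lq_integral_le:
  assumes q: "q \<ge> 0"
  shows "Lq_integral \<nu> q \<delta> \<le> ennreal (real N powr q * real N + 1) * ennreal (cell_sum \<nu> U q g)"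
proof -
  define v :: "'k \<Rightarrow> ennreal" where
    "v k = (if q \<ge> 1 then ennreal (nb_mass k powr (q - 1))
            else if mass k = 0 then \<top> else ennreal (mass k powr (q - 1)))" for k
  have "Lq_integral \<nu> q \<delta> \<le> (\<integral>\<^sup>+x. (\<Sum>k\<in>g ` U. v k * indicator (cell k) x) \<partial>\<nu>)"
    unfolding Lq_integral_def
  proof (intro nn_integral_mono)
    fix x
    show "ennreal (prob (cball x \<delta>) powr (q - 1)) * indicator (measure_support \<nu>) x
        \<le> (\<Sum>k\<in>g ` U. v k * indicator (cell k) x)"
    proof (cases "x \<in> measure_support \<nu>")
      case True
      then have x: "x \<in> U" "x \<in> cell (g x)" using support_subset by (auto simp: cell_def)
      have "ennreal (prob (cball x \<delta>) powr (q - 1)) \<le> v (g x)"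
      proof (cases "q \<ge> 1")
        case True
        then show ?thesis unfolding v_def using ball_le_nb_mass[OF x(1)]
          by (auto intro!: ennreal_leI powr_mono2)
      next
        case False
        then show ?thesis unfolding v_def using mass_le_ball[OF x(2)]
          by (auto intro!: ennreal_leI powr_mono2' simp: order_less_le)
      qed
      also have "v (g x) = v (g x) * indicator (cell (g x)) x" using x by simp
      also have "\<dots> \<le> (\<Sum>k\<in>g ` U. v k * indicator (cell k) x)"
        using x finite_cells by (intro member_le_sum) auto
      finally show ?thesis using True by simp
    qed simp
  qed
  also have "\<dots> = (\<Sum>k\<in>g ` U. v k * emeasure \<nu> (cell k))"
    by (subst nn_integral_sum)
      (auto simp: nn_integral_cmult_indicator intro!: borel_measurable_times_ennreal borel_measurable_indicator)
  also have "\<dots> \<le> ennreal ((real N powr q * real N + 1) * cell_sum \<nu> U q g)"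
  proof (cases "q \<ge> 1")
    case True
    have "v k * emeasure \<nu> (cell k) \<le> ennreal (nb_mass k powr q)" if k: "k \<in> g ` U" for k
    proof -
      have "mass k \<le> nb_mass k"
        unfolding nb_mass_def using nbs_refl[OF k] by (intro member_le_sum) auto
      then have "nb_mass k powr (q - 1) * mass k \<le> nb_mass k powr (q - 1) * nb_mass k"
        by (intro mult_left_mono) auto
      also have "\<dots> = nb_mass k powr q"
        using order_trans[OF mass_nonneg \<open>mass k \<le> nb_mass k\<close>] by (cases "nb_mass k = 0") (auto simp: powr_diff)
      finally show ?thesis unfolding v_def using True
        by (simp add: emeasure_eq_measure mass_def[symmetric] ennreal_mult'[symmetric] ennreal_leI)
    qed
    then have "(\<Sum>k\<in>g ` U. v k * emeasure \<nu> (cell k)) \<le> (\<Sum>k\<in>g ` U. ennreal (nb_mass k powr q))"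
      by (rule sum_mono)
    also have "\<dots> = ennreal (\<Sum>k\<in>g ` U. nb_mass k powr q)" by (simp add: sum_ennreal)
    also have "\<dots> \<le> ennreal ((real N powr q * real N + 1) * cell_sum \<nu> U q g)"
      using sum_nb_mass[OF q] by (intro ennreal_leI) (simp add: distrib_right cell_sum_nonneg add_increasing2)
    finally show ?thesis .
  next
    case False
    have "v k * emeasure \<nu> (cell k) = ennreal (mass k powr q)" for k
      unfolding v_def using False mass_nonneg[of k]
      by (auto simp: emeasure_eq_measure mass_def[symmetric] ennreal_mult'[symmetric] powr_diff)
    then have "(\<Sum>k\<in>g ` U. v k * emeasure \<nu> (cell k)) = ennreal (cell_sum \<nu> U q g)"
      by (simp add: cell_sum_eq sum_ennreal)
    also have "\<dots> \<le> ennreal ((real N powr q * real N + 1) * cell_sum \<nu> U q g)"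
      by (intro ennreal_leI) (simp add: distrib_right cell_sum_nonneg)
    finally show ?thesis .
  qed
  finally show ?thesis by (simp add: ennreal_mult' cell_sum_nonneg)
qed

lemma Lq_integral_ge_sum:
  assumes v: "\<And>x k. x \<in> cell k \<Longrightarrow> mass k > 0 \<Longrightarrow> v k \<le> prob (cball x \<delta>) powr (q - 1)"
    and nonneg: "\<And>k. v k \<ge> 0"
  shows "ennreal (\<Sum>k\<in>charged. v k * mass k) \<le> Lq_integral \<nu> q \<delta>"
proof -
  define S where "S = measure_support \<nu>"
  have S: "S \<in> sets \<nu>" unfolding S_def borel by (rule borel_closed[OF closed_measure_support])
  have "ennreal (\<Sum>k\<in>charged. v k * mass k) = (\<Sum>k\<in>charged. ennreal (v k) * emeasure \<nu> (cell k \<inter> S))"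
    unfolding S_def emeasure_cell_support using nonneg by (simp add: sum_ennreal[symmetric] ennreal_mult)
  also have "\<dots> = (\<integral>\<^sup>+x. (\<Sum>k\<in>charged. ennreal (v k) * indicator (cell k \<inter> S) x) \<partial>\<nu>)"
  proof -
    have "cell k \<inter> S \<in> sets \<nu>" for k using S by (intro sets.Int) auto
    then show ?thesis
      by (subst nn_integral_sum)
        (auto simp: nn_integral_cmult_indicator intro!: borel_measurable_times_ennreal borel_measurable_indicator)
  qed
  also have "\<dots> \<le> Lq_integral \<nu> q \<delta>"
    unfolding Lq_integral_def S_def[symmetric]
  proof (intro nn_integral_mono)
    fix x
    have "(\<Sum>k\<in>charged. ennreal (v k) * indicator (cell k \<inter> S) x)
        = (\<Sum>k\<in>charged. if k = g x then ennreal (v k) * indicator (cell k \<inter> S) x else 0)"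
      by (intro sum.cong) (auto simp: cell_def)
    also have "\<dots> \<le> ennreal (prob (cball x \<delta>) powr (q - 1)) * indicator S x"
      using v[of x "g x"] by (auto simp: sum.delta indicator_def) (auto simp: charged_def ennreal_leI)
    finally show "(\<Sum>k\<in>charged. ennreal (v k) * indicator (cell k \<inter> S) x)
      \<le> ennreal (prob (cball x \<delta>) powr (q - 1)) * indicator S x" .
  qed
  finally show ?thesis .
qed

lemma cell_sum_le_Lq:
  assumes q: "q > 0"
  shows "ennreal (cell_sum \<nu> U q g)
    \<le> ennreal (2 * (2 * real N powr q * real N) powr ((1 - q) / q) + 1) * Lq_integral \<nu> q \<delta>"
proof (cases "q \<ge> 1")
  case True
  have "ennreal (\<Sum>k\<in>charged. mass k powr (q - 1) * mass k) \<le> Lq_integral \<nu> q \<delta>"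
    using True mass_le_ball by (intro Lq_integral_ge_sum powr_mono2) auto
  also have "(\<Sum>k\<in>charged. mass k powr (q - 1) * mass k) = cell_sum \<nu> U q g"
    unfolding cell_sum_charged by (intro sum.cong) (auto simp: charged_def powr_diff)
  also have "Lq_integral \<nu> q \<delta> = ennreal 1 * Lq_integral \<nu> q \<delta>" by simp
  also have "\<dots> \<le> ennreal (2 * (2 * real N powr q * real N) powr ((1 - q) / q) + 1) * Lq_integral \<nu> q \<delta>"
    by (intro mult_right_mono ennreal_leI) auto
  finally show ?thesis .
next
  case False
  define L where "L = (\<Sum>k\<in>charged. nb_mass k powr (q - 1) * mass k)"
  define D where "D = cell_sum \<nu> U q g"
  define B where "B = real N powr q * real N"
  define T where "T = (2 * B) powr (1 / q)"
  have nbm: "mass k \<le> nb_mass k" if "k \<in> charged" for k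
    unfolding nb_mass_def using nbs_refl that by (intro member_le_sum) (auto simp: charged_def)
  have B: "B > 0" and T: "T > 0" unfolding T_def B_def using N_pos by auto
  have "mass k powr q \<le> T powr (1 - q) * (nb_mass k powr (q - 1) * mass k) + T powr (- q) * nb_mass k powr q"
    if k: "k \<in> charged" for k
  proof -
    have m: "mass k > 0" "nb_mass k > 0" using k nbm[OF k] unfolding charged_def by auto
    show ?thesis
    proof (cases "nb_mass k \<le> T * mass k")
      case True
      then have "mass k powr (q - 1) \<le> (nb_mass k / T) powr (q - 1)"
        using m T False by (intro powr_mono2') (auto simp: field_simps)
      also have "\<dots> = T powr (1 - q) * nb_mass k powr (q - 1)"
        using m T by (simp add: powr_divide powr_minus_divide[symmetric] powr_diff field_simps)
      finally have "mass k powr (q - 1) * mass k \<le> T powr (1 - q) * nb_mass k powr (q - 1) * mass k"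
        using m by (intro mult_right_mono) auto
      moreover have "mass k powr (q - 1) * mass k = mass k powr q" using m by (simp add: powr_diff)
      moreover have "T powr (- q) * nb_mass k powr q \<ge> 0" by simp
      ultimately show ?thesis unfolding mult.assoc by linarith
    next
      case False
      then have "mass k powr q \<le> (nb_mass k / T) powr q"
        using m T q by (intro powr_mono2) (auto simp: field_simps)
      also have "\<dots> = T powr (- q) * nb_mass k powr q"
        using m T by (simp add: powr_divide powr_minus field_simps)
      finally show ?thesis using m by (simp add: add_increasing)
    qed
  qed
  then have "D \<le> (\<Sum>k\<in>charged. T powr (1 - q) * (nb_mass k powr (q - 1) * mass k) + T powr (- q) * nb_mass k powr q)"
    unfolding D_def cell_sum_charged by (intro sum_mono)
  also have "\<dots> = T powr (1 - q) * L + T powr (- q) * (\<Sum>k\<in>charged. nb_mass k powr q)"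
    unfolding L_def by (simp add: sum.distrib sum_distrib_left)
  also have "(\<Sum>k\<in>charged. nb_mass k powr q) \<le> (\<Sum>k\<in>g ` U. nb_mass k powr q)"
    using finite_cells by (intro sum_mono2) (auto simp: charged_def)
  also have "\<dots> \<le> B * D" unfolding B_def D_def using sum_nb_mass q by simp
  also have "T powr (- q) = 1 / (2 * B)" unfolding T_def using q B by (simp add: powr_powr powr_minus_divide)
  finally have "D \<le> T powr (1 - q) * L + 1 / (2 * B) * (B * D)" using B by (simp add: mult_left_mono)
  then have "D \<le> T powr (1 - q) * L + D / 2" using B by simp
  then have "D \<le> 2 * T powr (1 - q) * L" by simp
  also have "T powr (1 - q) = (2 * B) powr ((1 - q) / q)" unfolding T_def by (simp add: powr_powr)
  finally have DL: "D \<le> 2 * (2 * B) powr ((1 - q) / q) * L" .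
  have L0: "L \<ge> 0" unfolding L_def by (intro sum_nonneg) auto
  have "ennreal L \<le> Lq_integral \<nu> q \<delta>"
    unfolding L_def
  proof (rule Lq_integral_ge_sum)
    fix x k assume xk: "x \<in> cell k" "mass k > 0"
    then show "nb_mass k powr (q - 1) \<le> prob (cball x \<delta>) powr (q - 1)"
      using ball_le_nb_mass[of x] mass_le_ball[of x k] False by (intro powr_mono2') (auto simp: cell_def)
  qed simp
  then have "ennreal (2 * (2 * B) powr ((1 - q) / q) + 1) * ennreal L
      \<le> ennreal (2 * (2 * B) powr ((1 - q) / q) + 1) * Lq_integral \<nu> q \<delta>"
    by (intro mult_left_mono) auto
  moreover have "ennreal D \<le> ennreal ((2 * (2 * B) powr ((1 - q) / q) + 1) * L)"
    using DL L0 by (intro ennreal_leI) (simp add: distrib_right)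
  ultimately show ?thesis unfolding D_def B_def using L0 by (simp add: ennreal_mult'' mult.assoc)
qed

lemma cell_sum_0_le_Lq:
  assumes \<epsilon>: "\<epsilon> > 0" and m: "m > 0" "\<And>x. x \<in> measure_support \<nu> \<Longrightarrow> m \<le> prob (cball x \<delta>)"
  shows "ennreal (cell_sum \<nu> U 0 g)
    \<le> ennreal (m powr (-\<epsilon>) * (real N powr \<epsilon> * real N * (2 * (2 * real N powr \<epsilon> * real N) powr ((1 - \<epsilon>) / \<epsilon>) + 1)))
      * Lq_integral \<nu> 0 \<delta>"
proof -
  define K where "K = 2 * (2 * real N powr \<epsilon> * real N) powr ((1 - \<epsilon>) / \<epsilon>) + 1"
  have K: "K > 0" unfolding K_def by (simp add: add_nonneg_pos)
  have "cell_sum \<nu> U 0 g \<le> (\<Sum>x\<in>centre ` charged. prob (cball x \<delta>) powr 0)"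
    by (rule cell_sum_le_centres) simp
  also have "\<dots> \<le> (\<Sum>x\<in>centre ` charged. m powr (-\<epsilon>) * prob (cball x \<delta>) powr \<epsilon>)"
  proof (rule sum_mono)
    fix x assume "x \<in> centre ` charged"
    then have "m \<le> prob (cball x \<delta>)" using centre m by (auto simp: charged_def)
    then have "m powr (-\<epsilon>) * m powr \<epsilon> \<le> m powr (-\<epsilon>) * prob (cball x \<delta>) powr \<epsilon>"
      using m \<epsilon> by (intro mult_left_mono powr_mono2) auto
    then show "prob (cball x \<delta>) powr 0 \<le> m powr (-\<epsilon>) * prob (cball x \<delta>) powr \<epsilon>"
      using m by (simp add: powr_minus)
  qed
  also have "\<dots> = m powr (-\<epsilon>) * (\<Sum>x\<in>centre ` charged. prob (cball x \<delta>) powr \<epsilon>)"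
    by (simp add: sum_distrib_left)
  also have "\<dots> \<le> m powr (-\<epsilon>) * (real N powr \<epsilon> * real N * cell_sum \<nu> U \<epsilon> g)"
    using \<epsilon> centre by (intro mult_left_mono sum_balls_le) (auto simp: charged_def intro!: inj_onI)
  finally have "ennreal (cell_sum \<nu> U 0 g) \<le> ennreal (m powr (-\<epsilon>) * (real N powr \<epsilon> * real N) * cell_sum \<nu> U \<epsilon> g)"
    by (intro ennreal_leI) (simp add: mult.assoc)
  also have "\<dots> = ennreal (m powr (-\<epsilon>) * (real N powr \<epsilon> * real N)) * ennreal (cell_sum \<nu> U \<epsilon> g)"
    by (simp add: ennreal_mult'' cell_sum_nonneg)
  also have "\<dots> \<le> ennreal (m powr (-\<epsilon>) * (real N powr \<epsilon> * real N)) * (ennreal K * Lq_integral \<nu> \<epsilon> \<delta>)"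
    unfolding K_def by (intro mult_left_mono cell_sum_le_Lq \<epsilon>) auto
  also have "Lq_integral \<nu> \<epsilon> \<delta> \<le> Lq_integral \<nu> 0 \<delta>"
    unfolding Lq_integral_def
  proof (intro nn_integral_mono mult_right_mono ennreal_leI)
    fix x
    show "prob (cball x \<delta>) powr (\<epsilon> - 1) \<le> prob (cball x \<delta>) powr (0 - 1)"
      using \<epsilon> powr_mono'[of "-1" "\<epsilon> - 1" "prob (cball x \<delta>)"] by simp
  qed auto
  finally show ?thesis unfolding K_def[symmetric] using K
    by (simp add: ennreal_mult'' ennreal_mult' mult.assoc mult_left_mono)
qed

end

lemma mesh_family_comparable:
  fixes g :: "real \<Rightarrow> 'a::euclidean_space \<Rightarrow> 'k"
  assumes mesh: "\<And>\<delta>. \<delta> > 0 \<Longrightarrow> mesh \<nu> U (g \<delta>) N \<delta>" and q: "q \<ge> 0"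
    and c: "c > 0"
    and mass: "\<And>\<delta> x. 0 < \<delta> \<Longrightarrow> \<delta> \<le> 1 \<Longrightarrow> x \<in> measure_support \<nu> \<Longrightarrow> c * \<delta> powr s \<le> measure \<nu> (cball x \<delta>)"
  shows "comparable (packing_sum \<nu> q) (\<lambda>\<delta>. ennreal (cell_sum \<nu> U q (g \<delta>)))"
    and "q \<le> 1 \<Longrightarrow> comparable (covering_sum \<nu> q) (\<lambda>\<delta>. ennreal (cell_sum \<nu> U q (g \<delta>)))"
    and "comparable (Lq_integral \<nu> q) (\<lambda>\<delta>. ennreal (cell_sum \<nu> U q (g \<delta>)))"
proof -
  have bounded: "dominated f h" if "\<And>\<delta>. \<delta> > 0 \<Longrightarrow> f \<delta> \<le> ennreal C * h \<delta>" for f h C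
    by (rule dominated_bounded[of _ C], rule eventually_mono[OF eventually_at_right_0_less[of 1]]) (auto intro: that)
  show "comparable (packing_sum \<nu> q) (\<lambda>\<delta>. ennreal (cell_sum \<nu> U q (g \<delta>)))"
    unfolding comparable_def
    using mesh.packing_sum_le[OF mesh q] mesh.cell_sum_le_packing[OF mesh q] by (auto intro!: bounded)
  show "comparable (covering_sum \<nu> q) (\<lambda>\<delta>. ennreal (cell_sum \<nu> U q (g \<delta>)))" if "q \<le> 1"
    unfolding comparable_def
    using mesh.covering_sum_le[OF mesh q] mesh.cell_sum_le_covering[OF mesh q that] by (auto intro!: bounded)
  have "dominated (\<lambda>\<delta>. ennreal (cell_sum \<nu> U q (g \<delta>))) (Lq_integral \<nu> q)"
  proof (cases "q = 0")
    case False
    with q have q': "q > 0" by simp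
    show ?thesis by (rule bounded) (rule mesh.cell_sum_le_Lq[OF mesh q'])
  next
    case True
    show ?thesis unfolding True
    proof (rule dominated_const)
      fix \<epsilon> :: real assume \<epsilon>: "\<epsilon> > 0"
      define \<epsilon>' where "\<epsilon>' = \<epsilon> / (\<bar>s\<bar> + 1)"
      have \<epsilon>': "\<epsilon>' > 0" unfolding \<epsilon>'_def using \<epsilon> by (intro divide_pos_pos) auto
      define K where "K = real N powr \<epsilon>' * real N * (2 * (2 * real N powr \<epsilon>' * real N) powr ((1 - \<epsilon>') / \<epsilon>') + 1)"
      have K: "K \<ge> 0" unfolding K_def by auto
      have "\<forall>\<^sub>F \<delta> in at_right 0. ennreal (cell_sum \<nu> U 0 (g \<delta>))
          \<le> ennreal (c powr (-\<epsilon>') * K * \<delta> powr (-\<epsilon>)) * Lq_integral \<nu> 0 \<delta>"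
        using eventually_at_right_0_less[of 1, OF zero_less_one]
      proof eventually_elim
        case (elim \<delta>)
        have "s * \<epsilon>' \<le> \<epsilon>"
        proof -
          have "s * \<epsilon>' \<le> (\<bar>s\<bar> + 1) * \<epsilon>'" using \<epsilon>' by (intro mult_right_mono) auto
          moreover have "(\<bar>s\<bar> + 1) * \<epsilon>' = \<epsilon>"
            unfolding \<epsilon>'_def using add_nonneg_pos[OF abs_ge_zero zero_less_one, of s] by simp
          ultimately show ?thesis by simp
        qed
        then have "(c * \<delta> powr s) powr (-\<epsilon>') \<le> c powr (-\<epsilon>') * \<delta> powr (-\<epsilon>)"
          using elim c by (simp add: powr_mult powr_powr powr_mono')
        then have "(c * \<delta> powr s) powr (-\<epsilon>') * K \<le> c powr (-\<epsilon>') * K * \<delta> powr (-\<epsilon>)"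
          using mult_right_mono[OF _ K] by (fastforce simp: ac_simps)
        moreover have "ennreal (cell_sum \<nu> U 0 (g \<delta>)) \<le> ennreal ((c * \<delta> powr s) powr (-\<epsilon>') * K) * Lq_integral \<nu> 0 \<delta>"
          unfolding K_def using elim c \<epsilon>' mass by (intro mesh.cell_sum_0_le_Lq[OF mesh]) auto
        ultimately show ?case
          by (meson ennreal_leI mult_right_mono order_trans zero_le)
      qed
      then show "\<exists>C. \<forall>\<^sub>F \<delta> in at_right 0. ennreal (cell_sum \<nu> U 0 (g \<delta>)) \<le> ennreal (C * \<delta> powr (-\<epsilon>)) * Lq_integral \<nu> 0 \<delta>"
        by blast
    qed
  qed
  then show "comparable (Lq_integral \<nu> q) (\<lambda>\<delta>. ennreal (cell_sum \<nu> U q (g \<delta>)))"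
    unfolding comparable_def by (auto intro: bounded mesh.Lq_integral_le[OF mesh q])
qed

section \<open>Floors\<close>

lemma card_floor_image:
  fixes f :: "'a \<Rightarrow> real"
  assumes "\<And>x y. x \<in> X \<Longrightarrow> y \<in> X \<Longrightarrow> \<bar>f x - f y\<bar> \<le> real L"
  shows "finite ((\<lambda>x. \<lfloor>f x\<rfloor>) ` X)" "card ((\<lambda>x. \<lfloor>f x\<rfloor>) ` X) \<le> L + 1"
proof -
  have "(\<lambda>x. \<lfloor>f x\<rfloor>) ` X \<subseteq> {\<lfloor>Inf (f ` X)\<rfloor>..\<lfloor>Inf (f ` X)\<rfloor> + int L}"
  proof
    fix k assume "k \<in> (\<lambda>x. \<lfloor>f x\<rfloor>) ` X"
    then obtain x where x: "x \<in> X" "k = \<lfloor>f x\<rfloor>" by auto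
    have lb: "f x - real L \<le> f y" if "y \<in> X" for y using assms[OF x(1) that] by (simp add: abs_le_iff)
    have "Inf (f ` X) \<le> f x" using x lb by (intro cInf_lower bdd_belowI2[of _ "f x - real L"]) auto
    moreover have "f x - real L \<le> Inf (f ` X)" using x lb by (intro cInf_greatest) auto
    ultimately have "\<lfloor>Inf (f ` X)\<rfloor> \<le> \<lfloor>f x\<rfloor>" "\<lfloor>f x\<rfloor> \<le> \<lfloor>Inf (f ` X)\<rfloor> + int L"
      by linarith+
    then show "k \<in> {\<lfloor>Inf (f ` X)\<rfloor>..\<lfloor>Inf (f ` X)\<rfloor> + int L}"
      unfolding x by simp
  qed
  then show "finite ((\<lambda>x. \<lfloor>f x\<rfloor>) ` X)" "card ((\<lambda>x. \<lfloor>f x\<rfloor>) ` X) \<le> L + 1"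
    by (auto dest: finite_subset card_mono[rotated])
qed

lemma abs_diff_less_if_floor_eq: "\<lfloor>x\<rfloor> = \<lfloor>y\<rfloor> \<Longrightarrow> \<bar>x - y\<bar> < (1::real)"
  by linarith

lemma abs_scaled_diff: "(a::real) \<ge> 0 \<Longrightarrow> \<bar>a * x - a * y\<bar> = a * \<bar>x - y\<bar>"
  by (simp add: abs_mult flip: right_diff_distrib)

text \<open>Of the two sides of \<open>y\<close> in an interval of length at least \<open>3 * \<theta>\<close>, one has room for a multiple of \<open>\<theta>\<close>.\<close>

lemma ex_lattice_point:
  fixes A B :: real
  assumes A: "A \<noteq> 0" and \<theta>: "\<theta> > 0" and t0: "lo \<le> t0" "t0 \<le> hi" and len: "3 * \<theta> \<le> \<bar>A\<bar> * (hi - lo)"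
  shows "\<exists>t n. lo < t \<and> t < hi \<and> A * t + B = real_of_int n * \<theta> \<and> \<bar>real_of_int n * \<theta> - (A * t0 + B)\<bar> \<le> \<theta>"
proof -
  define y where "y = A * t0 + B"
  define r where "r = y / \<theta>"
  have y: "y = r * \<theta>" unfolding r_def using \<theta> by simp
  have up: "\<exists>n. 0 < real_of_int n * \<theta> - y \<and> real_of_int n * \<theta> - y \<le> \<theta>"
  proof (intro exI conjI)
    have "r < real_of_int (\<lfloor>r\<rfloor> + 1)" "real_of_int (\<lfloor>r\<rfloor> + 1) \<le> r + 1" by linarith+
    from mult_strict_right_mono[OF this(1) \<theta>] mult_right_mono[OF this(2), of \<theta>] \<theta>
    show "0 < real_of_int (\<lfloor>r\<rfloor> + 1) * \<theta> - y" "real_of_int (\<lfloor>r\<rfloor> + 1) * \<theta> - y \<le> \<theta>"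
      unfolding y by (auto simp: distrib_right)
  qed
  have down: "\<exists>n. 0 < y - real_of_int n * \<theta> \<and> y - real_of_int n * \<theta> \<le> \<theta>"
  proof -
    obtain n :: int where n: "real_of_int n < r" "r \<le> real_of_int n + 1"
      by (rule that[of "\<lceil>r\<rceil> - 1"]) linarith+
    from mult_strict_right_mono[OF n(1) \<theta>] mult_right_mono[OF n(2), of \<theta>] \<theta>
    show ?thesis unfolding y by (intro exI[of _ n]) (auto simp: distrib_right)
  qed
  have "\<exists>n. \<bar>real_of_int n * \<theta> - y\<bar> \<le> \<theta> \<and> lo < t0 + (real_of_int n * \<theta> - y) / A \<and> t0 + (real_of_int n * \<theta> - y) / A < hi"
  proof (cases "\<theta> < \<bar>A\<bar> * (hi - t0)")
    case True
    then have room: "\<theta> / \<bar>A\<bar> < hi - t0" using A by (simp add: field_simps)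
    obtain n where n: "\<bar>real_of_int n * \<theta> - y\<bar> \<le> \<theta>" "0 < (real_of_int n * \<theta> - y) / A"
    proof (cases "A > 0")
      case True
      obtain n where "0 < real_of_int n * \<theta> - y" "real_of_int n * \<theta> - y \<le> \<theta>" using up by blast
      then show ?thesis using True by (intro that[of n]) auto
    next
      case False
      obtain n where "0 < y - real_of_int n * \<theta>" "y - real_of_int n * \<theta> \<le> \<theta>" using down by blast
      then show ?thesis using False A by (intro that[of n]) (auto simp: zero_less_divide_iff)
    qed
    have "(real_of_int n * \<theta> - y) / A \<le> \<bar>real_of_int n * \<theta> - y\<bar> / \<bar>A\<bar>"
      using abs_ge_self[of "(real_of_int n * \<theta> - y) / A"] by simp
    also have "\<dots> \<le> \<theta> / \<bar>A\<bar>" using n(1) by (intro divide_right_mono) auto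
    finally show ?thesis using n room t0 by (intro exI[of _ n]) linarith
  next
    case False
    have "\<bar>A\<bar> * (hi - lo) = \<bar>A\<bar> * (hi - t0) + \<bar>A\<bar> * (t0 - lo)" by (simp add: algebra_simps)
    then have "\<theta> < \<bar>A\<bar> * (t0 - lo)" using False len \<theta> by linarith
    then have room: "\<theta> / \<bar>A\<bar> < t0 - lo" using A by (simp add: field_simps)
    obtain n where n: "\<bar>real_of_int n * \<theta> - y\<bar> \<le> \<theta>" "(real_of_int n * \<theta> - y) / A < 0"
    proof (cases "A > 0")
      case True
      obtain n where "0 < y - real_of_int n * \<theta>" "y - real_of_int n * \<theta> \<le> \<theta>" using down by blast
      then show ?thesis using True by (intro that[of n]) (auto simp: divide_less_0_iff)
    next
      case False
      obtain n where "0 < real_of_int n * \<theta> - y" "real_of_int n * \<theta> - y \<le> \<theta>" using up by blast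
      then show ?thesis using False A by (intro that[of n]) (auto simp: divide_less_0_iff)
    qed
    have "- ((real_of_int n * \<theta> - y) / A) \<le> \<bar>real_of_int n * \<theta> - y\<bar> / \<bar>A\<bar>"
      using abs_ge_minus_self[of "(real_of_int n * \<theta> - y) / A"] by simp
    also have "\<dots> \<le> \<theta> / \<bar>A\<bar>" using n(1) by (intro divide_right_mono) auto
    finally show ?thesis using n room t0 by (intro exI[of _ n]) linarith
  qed
  then obtain n where n: "\<bar>real_of_int n * \<theta> - y\<bar> \<le> \<theta>" "lo < t0 + (real_of_int n * \<theta> - y) / A"
    "t0 + (real_of_int n * \<theta> - y) / A < hi" by blast
  have "A * (t0 + (real_of_int n * \<theta> - y) / A) + B = real_of_int n * \<theta>"
    using A unfolding y_def by (simp add: field_simps)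
  then show ?thesis using n unfolding y_def by blast
qed

section \<open>Coordinates of box-like maps\<close>

definition cd :: "bool \<Rightarrow> real \<times> real \<Rightarrow> real" where
  "cd j z = (if j then snd z else fst z)"

lemma cd_simps [simp]: "cd False z = fst z" "cd True z = snd z"
  by (auto simp: cd_def)

lemma cd_0 [simp]: "cd j 0 = 0" by (cases j) auto

lemma cd_diff: "cd j (x - y) = cd j x - cd j y" by (cases j) auto

lemma abs_cd_le_norm: "\<bar>cd j z\<bar> \<le> norm z"
  by (cases j; cases z) (auto simp: norm_Pair real_le_rsqrt)

lemma norm_le_cd: "norm z \<le> \<bar>cd False z\<bar> + \<bar>cd True z\<bar>"
  by (cases z) (auto simp: norm_Pair sqrt_sum_squares_le_sum_abs)

lemma continuous_cd [continuous_intros]: "continuous_on A f \<Longrightarrow> continuous_on A (\<lambda>x. cd j (f x))"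
  by (cases j) (auto intro: continuous_intros)

lemma borel_measurable_cd [measurable]: "cd j \<in> borel_measurable borel"
  by (intro borel_measurable_continuous_onI continuous_intros)

lemma coords_eqI: "(\<And>j. cd j x = cd j y) \<Longrightarrow> x = y"
  by (metis cd_simps prod_eqI)

lemma mem_unit_square: "z \<in> unit_square \<longleftrightarrow> (\<forall>j. 0 \<le> cd j z \<and> cd j z \<le> 1)"
  unfolding unit_square_def by (cases z) (auto simp: all_bool_eq)

lemma box_like_map_coords:
  assumes "box_like_map T"
  shows "\<exists>s u e. (\<forall>j z. cd j (T z) = u j * cd (j \<noteq> s) z + e j) \<and> (\<forall>j. 0 < \<bar>u j\<bar> \<and> \<bar>u j\<bar> < 1)"
proof -
  obtain c d L t where cdL: "0 < c" "c < 1" "0 < d" "d < 1" "orthogonal_transformation L"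
    "L ` ({-1..1} \<times> {-1..1}) = {-1..1} \<times> {-1..1}"
    and T: "T = (\<lambda>x. (c * fst (L x), d * snd (L x)) + t)"
    using assms unfolding box_like_map_def by auto
  have lin: "linear L" using cdL(5) by (simp add: orthogonal_transformation_linear)
  have inner: "L v \<bullet> L w = v \<bullet> w" for v w using cdL(5) unfolding orthogonal_transformation_def by blast
  have corner: "(fst (L (1, y)))\<^sup>2 = 1 \<and> (snd (L (1, y)))\<^sup>2 = 1" if "y = 1 \<or> y = -1" for y :: real
  proof -
    obtain a b where ab: "L (1, y) = (a, b)" by force
    have "L (1, y) \<in> L ` ({-1..1} \<times> {-1..1})" using that by (intro imageI) auto
    then have "\<bar>a\<bar> \<le> 1" "\<bar>b\<bar> \<le> 1" unfolding cdL(6) ab by auto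
    then have "a\<^sup>2 \<le> 1" "b\<^sup>2 \<le> 1" by (auto simp: abs_square_le_1)
    moreover have "a\<^sup>2 + b\<^sup>2 = 2"
      using inner[of "(1, y)" "(1, y)"] that unfolding ab by (auto simp: inner_prod_def power2_eq_square)
    ultimately show ?thesis unfolding ab by auto
  qed
  obtain a1 a2 where A: "L (1, 1) = (a1, a2)" by force
  obtain b1 b2 where B: "L (1, -1) = (b1, b2)" by force
  have sq: "a1\<^sup>2 = 1" "a2\<^sup>2 = 1" "b1\<^sup>2 = 1" "b2\<^sup>2 = 1"
    using corner[of 1] corner[of "-1"] unfolding A B by auto
  have orth: "a1 * b1 + a2 * b2 = 0"
    using inner[of "(1, 1)" "(1, -1)"] unfolding A B by (simp add: inner_prod_def)
  have Lz: "L (x, y) = ((x + y) / 2) *\<^sub>R (a1, a2) + ((x - y) / 2) *\<^sub>R (b1, b2)" for x y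
  proof -
    have "(x, y) = ((x + y) / 2) *\<^sub>R (1, 1) + ((x - y) / 2) *\<^sub>R (1, -1)"
      by (simp add: field_simps)
    then have "L (x, y) = L (((x + y) / 2) *\<^sub>R (1, 1) + ((x - y) / 2) *\<^sub>R (1, -1))"
      by (rule arg_cong)
    then show ?thesis unfolding linear_add[OF lin] linear_scale[OF lin] A B .
  qed
  define s where "s = (a1 \<noteq> b1)"
  define u where "u j = (if j then d * a2 else c * a1)" for j
  have vals: "a1 = 1 \<or> a1 = -1" "a2 = 1 \<or> a2 = -1" "b1 = 1 \<or> b1 = -1" "b2 = 1 \<or> b2 = -1"
    using sq by (auto simp: power2_eq_1_iff)
  have "cd j (T z) = u j * cd (j \<noteq> s) z + cd j t" for j z
  proof -
    obtain x y where z: "z = (x, y)" by force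
    have "(\<not> s \<longrightarrow> L z = (a1 * x, a2 * y)) \<and> (s \<longrightarrow> L z = (a1 * y, a2 * x))"
      unfolding z Lz s_def using vals orth by (auto simp: field_simps)
    then show ?thesis unfolding T u_def by (cases j; cases s) (auto simp: z)
  qed
  moreover have "0 < \<bar>u j\<bar> \<and> \<bar>u j\<bar> < 1" for j
    using cdL vals unfolding u_def by (auto simp: abs_mult)
  ultimately show ?thesis
    by (intro exI[of _ s] exI[of _ u] exI[of _ "\<lambda>j. cd j t"]) blast
qed

section \<open>Words\<close>

lemma word_map_Nil [simp]: "word_map S [] = id" by (simp add: word_map_def)

lemma word_map_Cons [simp]: "word_map S (i # w) = S i \<circ> word_map S w" by (simp add: word_map_def)

lemma word_map_append: "word_map S (w @ v) = word_map S w \<circ> word_map S v"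
  by (induction w) (auto simp: o_assoc)

definition words :: "'i set \<Rightarrow> nat \<Rightarrow> 'i list set" where
  "words I k = {w. set w \<subseteq> I \<and> length w = k}"

lemma finite_words [simp]: "finite I \<Longrightarrow> finite (words I k)"
  unfolding words_def by (rule finite_lists_length_eq)

lemma words_0 [simp]: "words I 0 = {[]}" unfolding words_def by auto

lemma sum_words_add:
  "(\<Sum>w\<in>words I (m + n). f w) = (\<Sum>u\<in>words I m. \<Sum>v\<in>words I n. f (u @ v))"
proof -
  have img: "words I (m + n) = (\<lambda>(u, v). u @ v) ` (words I m \<times> words I n)"
  proof
    show "words I (m + n) \<subseteq> (\<lambda>(u, v). u @ v) ` (words I m \<times> words I n)"
    proof
      fix w assume "w \<in> words I (m + n)"
      then have "(take m w, drop m w) \<in> words I m \<times> words I n"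
        unfolding words_def by (auto dest: in_set_takeD in_set_dropD)
      then show "w \<in> (\<lambda>(u, v). u @ v) ` (words I m \<times> words I n)"
        by (intro image_eqI[of _ _ "(take m w, drop m w)"]) auto
    qed
  qed (auto simp: words_def)
  have inj: "inj_on (\<lambda>(u, v). u @ v) (words I m \<times> words I n)"
    unfolding inj_on_def words_def by clarsimp
  show ?thesis unfolding img sum.reindex[OF inj] by (simp add: sum.cartesian_product o_def case_prod_unfold)
qed

lemma words_1: "words I 1 = (\<lambda>i. [i]) ` I"
  unfolding words_def by (auto simp: length_Suc_conv)

lemma sum_words_1: "(\<Sum>v\<in>words I 1. f v) = (\<Sum>i\<in>I. f [i])"
  unfolding words_1 by (subst sum.reindex) (auto simp: inj_on_def)

definition cut :: "'i set \<Rightarrow> ('i list \<Rightarrow> bool) \<Rightarrow> 'i list set" where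
  "cut I stop = {w. set w \<subseteq> I \<and> stop w \<and> (\<forall>n<length w. \<not> stop (take n w))}"

locale stopping =
  fixes I :: "'i set" and stop :: "'i list \<Rightarrow> bool" and k N :: nat
  assumes finite_I: "finite I" and k: "k \<ge> 1"
    and stop_dvd: "\<And>w. stop w \<Longrightarrow> k dvd length w"
    and stop_long: "\<And>w. set w \<subseteq> I \<Longrightarrow> length w = N * k \<Longrightarrow> stop w"
begin

lemma cut_length: assumes "w \<in> cut I stop" shows "length w \<le> N * k"
proof (rule ccontr)
  assume "\<not> length w \<le> N * k"
  then have less: "N * k < length w" by simp
  have "stop (take (N * k) w)"
    using assms less by (intro stop_long) (auto simp: cut_def dest: in_set_takeD)
  then show False using assms less unfolding cut_def by auto
qed

lemma finite_cut: "finite (cut I stop)"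
  by (rule finite_subset[OF _ finite_lists_length_le[OF finite_I, of "N * k"]])
    (use cut_length in \<open>auto simp: cut_def\<close>)

lemma cut_incomparable:
  assumes "w \<in> cut I stop" "w' \<in> cut I stop" "w' = w @ v"
  shows "v = []"
proof (rule ccontr)
  assume "v \<noteq> []"
  then have "length w < length w'" "take (length w) w' = w" using assms by auto
  then show False using assms(1,2) unfolding cut_def by auto
qed

lemma sum_cut_ge:
  fixes F :: "'i list \<Rightarrow> real"
  assumes F: "\<And>u. set u \<subseteq> I \<Longrightarrow> k dvd length u \<Longrightarrow> length u < N * k \<Longrightarrow> F u \<le> (\<Sum>v\<in>words I k. F (u @ v))"
  shows "F [] \<le> (\<Sum>w\<in>cut I stop. F w)"
proof -
  define W where "W u = {w \<in> cut I stop. take (length u) w = u}" for u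
  have "F u \<le> (\<Sum>w\<in>W u. F w)"
    if "set u \<subseteq> I" "length u + n * k = N * k" "\<And>m. m < length u \<Longrightarrow> \<not> stop (take m u)" for u n
    using that
  proof (induction n arbitrary: u)
    case (0 u)
    then have "stop u" by (intro stop_long) auto
    then have u: "u \<in> cut I stop" using 0 by (auto simp: cut_def)
    have "w = u" if "w \<in> W u" for w
      using cut_incomparable[OF u, of w "drop (length u) w"] that unfolding W_def
      by (metis (mono_tags, lifting) append.right_neutral append_take_drop_id mem_Collect_eq)
    then have "W u = {u}" using u unfolding W_def by auto
    then show ?case by simp
  next
    case (Suc n u)
    show ?case
    proof (cases "stop u")
      case True
      then have u: "u \<in> cut I stop" using Suc.prems by (auto simp: cut_def)
      have "w = u" if "w \<in> W u" for w
        using cut_incomparable[OF u, of w "drop (length u) w"] that unfolding W_def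
        by (metis (mono_tags, lifting) append.right_neutral append_take_drop_id mem_Collect_eq)
      then have "W u = {u}" using u unfolding W_def by auto
      then show ?thesis by simp
    next
      case False
      have dvd: "k dvd length u"
        using Suc.prems(2) by (metis dvd_add_left_iff dvd_triv_right)
      have "W u = (\<Union>v\<in>words I k. W (u @ v))"
      proof
        show "W u \<subseteq> (\<Union>v\<in>words I k. W (u @ v))"
        proof
          fix w assume w: "w \<in> W u"
          then have len: "length u \<le> length w" unfolding W_def by (metis (mono_tags, lifting) length_take mem_Collect_eq min.cobounded1)
          have "w \<noteq> u" using w False unfolding W_def cut_def by auto
          then have "length u < length w" using w len unfolding W_def by (cases "length u = length w") auto
          moreover have "k dvd length w" using w stop_dvd unfolding W_def cut_def by auto
          ultimately have "length u + k \<le> length w" using dvd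
            by (metis add.commute dvd_diff_nat dvd_imp_le le_diff_conv2 less_imp_le_nat zero_less_diff)
          then have "take k (drop (length u) w) \<in> words I k"
            using w unfolding W_def cut_def words_def by (auto dest!: in_set_takeD in_set_dropD)
          moreover have "w \<in> W (u @ take k (drop (length u) w))"
            using w \<open>length u + k \<le> length w\<close> unfolding W_def by (auto simp: take_add)
          ultimately show "w \<in> (\<Union>v\<in>words I k. W (u @ v))" by blast
        qed
        show "(\<Union>v\<in>words I k. W (u @ v)) \<subseteq> W u"
        proof
          fix w assume "w \<in> (\<Union>v\<in>words I k. W (u @ v))"
          then obtain v where v: "w \<in> cut I stop" "take (length u + length v) w = u @ v" unfolding W_def by auto
          have "take (length u) w = take (length u) (take (length u + length v) w)" by simp
          also have "\<dots> = u" unfolding v(2) by simp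
          finally show "w \<in> W u" using v unfolding W_def by auto
        qed
      qed
      then have "(\<Sum>w\<in>W u. F w) = (\<Sum>w\<in>(\<Union>v\<in>words I k. W (u @ v)). F w)" by simp
      also have "\<dots> = (\<Sum>v\<in>words I k. \<Sum>w\<in>W (u @ v). F w)"
      proof (rule sum.UNION_disjoint)
        show "\<forall>v\<in>words I k. finite (W (u @ v))" using finite_cut unfolding W_def by auto
        show "\<forall>v\<in>words I k. \<forall>v'\<in>words I k. v \<noteq> v' \<longrightarrow> W (u @ v) \<inter> W (u @ v') = {}"
          unfolding W_def words_def by auto
      qed (use finite_I in auto)
      finally have eq: "(\<Sum>w\<in>W u. F w) = (\<Sum>v\<in>words I k. \<Sum>w\<in>W (u @ v). F w)" .
      have "F (u @ v) \<le> (\<Sum>w\<in>W (u @ v). F w)" if v: "v \<in> words I k" for v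
      proof (rule Suc.IH)
        show "set (u @ v) \<subseteq> I" "length (u @ v) + n * k = N * k"
          using v Suc.prems unfolding words_def by auto
        fix m assume m: "m < length (u @ v)"
        show "\<not> stop (take m (u @ v))"
        proof
          assume st: "stop (take m (u @ v))"
          moreover have "length (take m (u @ v)) = m" using m by simp
          ultimately have "k dvd m" using stop_dvd[of "take m (u @ v)"] by metis
          have "m < length u + k" using m v by (simp add: words_def)
          then have "m \<le> length u"
            using \<open>k dvd m\<close> dvd k by (metis add.commute dvd_diff_nat dvd_imp_le le_diff_conv less_diff_conv2 linorder_not_le nat_less_le zero_less_diff not_less)
          then show False using st False Suc.prems(3)[of m] by (cases "m = length u") auto
        qed
      qed
      moreover have "length u < N * k" using Suc.prems(2) k by simp
      ultimately show ?thesis unfolding eq using F[OF Suc.prems(1) dvd] by (meson order_trans sum_mono)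
    qed
  qed
  from this[of "[]" N] show ?thesis by (simp add: W_def)
qed

lemma sum_cut_eq:
  fixes F :: "'i list \<Rightarrow> real"
  assumes F: "\<And>u. set u \<subseteq> I \<Longrightarrow> F u = (\<Sum>i\<in>I. F (u @ [i]))"
  shows "(\<Sum>w\<in>cut I stop. F w) = F []"
proof -
  have eq: "F u = (\<Sum>v\<in>words I n. F (u @ v))" if "set u \<subseteq> I" for u n
    using that
  proof (induction n arbitrary: u)
    case (Suc n)
    have "F u = (\<Sum>i\<in>I. F (u @ [i]))" by (rule F[OF Suc.prems])
    also have "\<dots> = (\<Sum>i\<in>I. \<Sum>v\<in>words I n. F ((u @ [i]) @ v))"
      using Suc.prems by (intro sum.cong Suc.IH) auto
    also have "\<dots> = (\<Sum>v\<in>words I (1 + n). F (u @ v))" unfolding sum_words_add sum_words_1 by simp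
    finally show ?case by simp
  qed simp
  have "F [] \<le> (\<Sum>w\<in>cut I stop. F w)" using eq by (intro sum_cut_ge) simp
  moreover have "- F [] \<le> (\<Sum>w\<in>cut I stop. - F w)"
    by (rule sum_cut_ge) (simp add: sum_negf eq[symmetric])
  ultimately show ?thesis by (simp add: sum_negf)
qed

end

section \<open>Box-like measures in coordinates\<close>

locale box_coords = box_like_measure I S p \<mu>
  for I :: "'i set" and S :: "'i \<Rightarrow> real \<times> real \<Rightarrow> real \<times> real" and p :: "'i \<Rightarrow> real"
    and \<mu> :: "(real \<times> real) measure" +
  fixes sw :: "'i \<Rightarrow> bool" and u e :: "'i \<Rightarrow> bool \<Rightarrow> real"
  assumes coords: "\<And>i j z. i \<in> I \<Longrightarrow> cd j (S i z) = u i j * cd (j \<noteq> sw i) z + e i j"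
    and u_bounds: "\<And>i j. i \<in> I \<Longrightarrow> 0 < \<bar>u i j\<bar> \<and> \<bar>u i j\<bar> < 1"
begin

sublocale prob_space \<mu> by (rule prob)

primrec swaps :: "'i list \<Rightarrow> bool" where
  "swaps [] = False"
| "swaps (i # w) = (sw i \<noteq> swaps w)"

primrec slope :: "'i list \<Rightarrow> bool \<Rightarrow> real" where
  "slope [] j = 1"
| "slope (i # w) j = u i j * slope w (j \<noteq> sw i)"

primrec shift :: "'i list \<Rightarrow> bool \<Rightarrow> real" where
  "shift [] j = 0"
| "shift (i # w) j = u i j * shift w (j \<noteq> sw i) + e i j"

definition side :: "'i list \<Rightarrow> bool \<Rightarrow> real" where "side w j = \<bar>slope w j\<bar>"

definition short :: "'i list \<Rightarrow> real" where "short w = min (side w False) (side w True)"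

definition long :: "'i list \<Rightarrow> real" where "long w = max (side w False) (side w True)"

definition pr :: "'i list \<Rightarrow> real" where "pr w = prod_list (map p w)"

definition amin :: real where "amin = Min ((\<lambda>(i, j). \<bar>u i j\<bar>) ` (I \<times> UNIV))"

definition amax :: real where "amax = Max ((\<lambda>(i, j). \<bar>u i j\<bar>) ` (I \<times> UNIV))"

definition pmin :: real where "pmin = Min (p ` I)"

lemma I_ne: "I \<noteq> {}" using card_I by auto

lemma amin_le: "i \<in> I \<Longrightarrow> amin \<le> \<bar>u i j\<bar>" and le_amax: "i \<in> I \<Longrightarrow> \<bar>u i j\<bar> \<le> amax"
  unfolding amin_def amax_def using finite_I by (auto intro!: Min_le Max_ge)

lemma amin_pos: "0 < amin" and amax_less: "amax < 1"
  unfolding amin_def amax_def using finite_I I_ne u_bounds by (auto simp: Min_gr_iff)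

lemma amin_le_amax: "amin \<le> amax"
  using I_ne amin_le le_amax by (meson ex_in_conv order_trans)

lemma amax_pos: "0 < amax" and amin_less: "amin < 1"
  using amin_le_amax amin_pos amax_less by linarith+

lemma pmin_le: "i \<in> I \<Longrightarrow> pmin \<le> p i" and pmin_pos: "0 < pmin" and pmin_less: "pmin < 1"
proof -
  show le: "i \<in> I \<Longrightarrow> pmin \<le> p i" for i unfolding pmin_def using finite_I by auto
  show "0 < pmin" unfolding pmin_def using finite_I I_ne p_bounds by (auto simp: Min_gr_iff)
  show "pmin < 1" using le I_ne p_bounds by (meson ex_in_conv order_le_less_trans)
qed

lemma word_coords:
  "set w \<subseteq> I \<Longrightarrow> cd j (word_map S w z) = slope w j * cd (j \<noteq> swaps w) z + shift w j"
proof (induction w arbitrary: j)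
  case (Cons i w)
  then have "cd (j \<noteq> sw i) (word_map S w z) = slope w (j \<noteq> sw i) * cd ((j \<noteq> sw i) \<noteq> swaps w) z + shift w (j \<noteq> sw i)"
    by auto
  moreover have "((j \<noteq> sw i) \<noteq> swaps w) = (j \<noteq> swaps (i # w))" by auto
  ultimately show ?case using Cons.prems by (simp add: coords algebra_simps)
qed auto

lemma swaps_append: "swaps (w @ v) = (swaps w \<noteq> swaps v)"
  by (induction w) auto

lemma slope_append: "slope (w @ v) j = slope w j * slope v (j \<noteq> swaps w)"
proof (induction w arbitrary: j)
  case (Cons i w)
  have "((j \<noteq> sw i) \<noteq> swaps w) = (j \<noteq> swaps (i # w))" by auto
  then show ?case using Cons by simp
qed auto

lemma side_append: "side (w @ v) j = side w j * side v (j \<noteq> swaps w)"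
  unfolding side_def slope_append by (simp add: abs_mult)

lemma side_Nil [simp]: "side [] j = 1" by (simp add: side_def)

lemma side_bounds: "set w \<subseteq> I \<Longrightarrow> amin ^ length w \<le> side w j \<and> side w j \<le> amax ^ length w"
proof (induction w arbitrary: j)
  case (Cons i w)
  have "side (i # w) j = \<bar>u i j\<bar> * side w (j \<noteq> sw i)" by (simp add: side_def abs_mult)
  then show ?case using Cons.IH[of "j \<noteq> sw i"] Cons.prems amin_le[of i j] le_amax[of i j] amin_pos
    by (auto intro!: mult_mono simp: side_def)
qed auto

lemma side_pos: "set w \<subseteq> I \<Longrightarrow> 0 < side w j"
  using side_bounds[of w j] amin_pos zero_less_power[of amin "length w"] by linarith

lemma side_le_1: "set w \<subseteq> I \<Longrightarrow> side w j \<le> 1"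
  using side_bounds[of w j] amax_less amax_pos power_le_one[of amax "length w"] by linarith

lemma short_le_side: "short w \<le> side w j" and side_le_long: "side w j \<le> long w"
  unfolding short_def long_def by (cases j; auto)+

lemma short_cases: "short w = side w False \<or> short w = side w True"
  and long_cases: "long w = side w False \<or> long w = side w True"
  unfolding short_def long_def by auto

lemma short_pos: "set w \<subseteq> I \<Longrightarrow> 0 < short w"
  using short_cases[of w] side_pos by metis

lemma long_pos: "set w \<subseteq> I \<Longrightarrow> 0 < long w"
  using long_cases[of w] side_pos by metis

lemma short_le: "set w \<subseteq> I \<Longrightarrow> short w \<le> amax ^ length w"
  using short_cases[of w] side_bounds by metis

lemma long_le_1: "set w \<subseteq> I \<Longrightarrow> long w \<le> 1"
  using long_cases[of w] side_le_1 by metis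

lemma short_append_ge:
  assumes "set w \<subseteq> I" "set v \<subseteq> I" shows "short w * amin ^ length v \<le> short (w @ v)"
proof -
  obtain j where j: "short (w @ v) = side (w @ v) j" using short_cases by metis
  have "short w * amin ^ length v \<le> side w j * side v (j \<noteq> swaps w)"
    using short_le_side side_bounds[OF assms(2)] amin_pos short_pos[OF assms(1)] side_pos[OF assms(1)]
    by (intro mult_mono) (auto intro: less_imp_le)
  then show ?thesis unfolding j side_append .
qed

lemma pr_Nil [simp]: "pr [] = 1" and pr_append: "pr (w @ v) = pr w * pr v"
  unfolding pr_def by auto

lemma pr_pos: "set w \<subseteq> I \<Longrightarrow> 0 < pr w"
  unfolding pr_def by (induction w) (use p_bounds in auto)

lemma pmin_power_le_pr: "set w \<subseteq> I \<Longrightarrow> pmin ^ length w \<le> pr w"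
  unfolding pr_def
proof (induction w)
  case (Cons i w)
  then show ?case using pmin_le[of i] pmin_pos p_bounds[of i] by (auto intro!: mult_mono simp: less_imp_le)
qed auto

lemma continuous_word_map: assumes "set w \<subseteq> I" shows "continuous_on UNIV (word_map S w)"
proof -
  have eq: "word_map S w = (\<lambda>z. (slope w False * cd (False \<noteq> swaps w) z + shift w False,
      slope w True * cd (True \<noteq> swaps w) z + shift w True))"
  proof
    fix z
    show "word_map S w z = (slope w False * cd (False \<noteq> swaps w) z + shift w False,
      slope w True * cd (True \<noteq> swaps w) z + shift w True)"
      using word_coords[OF assms, of False z] word_coords[OF assms, of True z]
      by (intro prod_eqI) auto
  qed
  show ?thesis unfolding eq by (intro continuous_intros)
qed

lemma vimage_word_map_sets:
  assumes "set w \<subseteq> I" "A \<in> sets borel" shows "word_map S w -` A \<in> sets borel"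
  using measurable_sets[OF borel_measurable_continuous_onI[OF continuous_word_map[OF assms(1)]], of A] assms by simp

lemma inj_word_map: assumes "set w \<subseteq> I" shows "inj (word_map S w)"
proof (rule injI)
  fix x y assume eq: "word_map S w x = word_map S w y"
  show "x = y"
  proof (rule coords_eqI)
    fix j
    have "slope w (j \<noteq> swaps w) * cd j x = slope w (j \<noteq> swaps w) * cd j y"
      using word_coords[OF assms, of "j \<noteq> swaps w" x] word_coords[OF assms, of "j \<noteq> swaps w" y] eq
      by (cases j; cases "swaps w") auto
    then show "cd j x = cd j y" using side_pos[OF assms, of "j \<noteq> swaps w"] by (simp add: side_def)
  qed
qed

lemma word_map_contracts:
  assumes "set w \<subseteq> I"
  shows "dist (word_map S w x) (word_map S w y) \<le> 2 * amax ^ length w * dist x y"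
proof -
  have "\<bar>cd j (word_map S w x - word_map S w y)\<bar> \<le> amax ^ length w * dist x y" for j
  proof -
    have "\<bar>cd j (word_map S w x - word_map S w y)\<bar> = side w j * \<bar>cd (j \<noteq> swaps w) (x - y)\<bar>"
      unfolding cd_diff word_coords[OF assms] side_def by (simp add: abs_mult[symmetric] algebra_simps)
    also have "\<dots> \<le> amax ^ length w * norm (x - y)"
      using side_bounds[OF assms] abs_cd_le_norm side_pos[OF assms] amax_pos by (intro mult_mono) auto
    finally show ?thesis by (simp add: dist_norm)
  qed
  from this[of False] this[of True] norm_le_cd[of "word_map S w x - word_map S w y"]
  show ?thesis by (simp add: dist_norm)
qed

lemma word_map_invariant:
  assumes "\<And>i. i \<in> I \<Longrightarrow> S i ` K \<subseteq> K" "set w \<subseteq> I" "z \<in> K"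
  shows "word_map S w z \<in> K"
  using assms(2) by (induction w) (use assms in auto)

lemma S_unit_square: "i \<in> I \<Longrightarrow> S i ` unit_square \<subseteq> unit_square"
  using box_like unfolding box_like_map_def by blast

lemma prob_step:
  assumes "set w \<subseteq> I" "A \<in> sets borel"
  shows "prob (word_map S w -` A) = (\<Sum>i\<in>I. p i * prob (word_map S (w @ [i]) -` A))"
  unfolding self_affine[OF vimage_word_map_sets[OF assms]] word_map_append vimage_comp[symmetric]
  by simp

lemma prob_cut:
  assumes "stopping I stop k N" "A \<in> sets borel"
  shows "prob A = (\<Sum>w\<in>cut I stop. pr w * prob (word_map S w -` A))"
proof -
  interpret stopping I stop k N by fact
  have "(\<Sum>w\<in>cut I stop. pr w * prob (word_map S w -` A)) = pr [] * prob (word_map S [] -` A)"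
  proof (rule sum_cut_eq)
    fix w assume w: "set w \<subseteq> I"
    show "pr w * prob (word_map S w -` A) = (\<Sum>i\<in>I. pr (w @ [i]) * prob (word_map S (w @ [i]) -` A))"
      unfolding prob_step[OF w assms(2)] sum_distrib_left
      by (intro sum.cong) (auto simp: pr_append, auto simp: pr_def)
  qed
  then show ?thesis by simp
qed

lemma sum_pr_cut:
  assumes "stopping I stop k N" shows "(\<Sum>w\<in>cut I stop. pr w) = 1"
proof -
  interpret stopping I stop k N by fact
  have "(\<Sum>w\<in>cut I stop. pr w) = pr []"
    by (rule sum_cut_eq) (simp add: pr_append sum_distrib_left[symmetric], simp add: pr_def sum_p)
  then show ?thesis by simp
qed

lemma stopping_length: "n \<ge> 1 \<Longrightarrow> stopping I (\<lambda>w. length w = n) n 1"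
  by unfold_locales (auto simp: finite_I)

lemma cut_length_eq: "n \<ge> 1 \<Longrightarrow> cut I (\<lambda>w. length w = n) = words I n"
  unfolding cut_def words_def by auto

lemma prob_compact_invariant:
  assumes K: "compact K" "K \<noteq> {}" "\<And>i. i \<in> I \<Longrightarrow> S i ` K \<subseteq> K"
  shows "prob K = 1"
proof -
  obtain z0 where z0: "z0 \<in> K" using K by auto
  have space: "space \<mu> = UNIV" using borel by (metis sets_eq_imp_space_eq space_borel)
  define V where "V \<epsilon> = {z. infdist z K \<le> \<epsilon>}" for \<epsilon> :: real
  have V: "V \<epsilon> \<in> sets borel" for \<epsilon>
    unfolding V_def by (intro borel_closed closed_Collect_le continuous_intros)
  have V1: "prob (V \<epsilon>) = 1" if \<epsilon>: "\<epsilon> > 0" for \<epsilon>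
  proof -
    have ge: "prob (cball 0 (real m)) \<le> prob (V \<epsilon>)" for m
    proof -
      define R where "R = 2 * (real m + norm z0) + 1"
      obtain n0 where n0: "amax ^ n0 < \<epsilon> / R"
        using real_arch_pow_inv[of "\<epsilon> / R" amax] amax_less \<epsilon> unfolding R_def by (auto simp: add_nonneg_pos)
      define n where "n = n0 + 1"
      have "amax * amax ^ n0 \<le> 1 * amax ^ n0"
        using amax_pos amax_less by (intro mult_right_mono) auto
      then have n: "amax ^ n \<le> \<epsilon> / R" "n \<ge> 1" using n0 unfolding n_def by simp_all
      have sub: "cball 0 (real m) \<subseteq> word_map S w -` V \<epsilon>" if w: "w \<in> words I n" for w
      proof
        fix z :: "real \<times> real" assume "z \<in> cball 0 (real m)"
        then have "dist z z0 \<le> real m + norm z0"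
          using dist_triangle[of z z0 0] by (simp add: dist_norm)
        then have "2 * amax ^ n * dist z z0 \<le> amax ^ n * R"
          using amax_pos unfolding R_def by (simp add: mult.assoc mult.left_commute)
        also have "\<dots> \<le> \<epsilon>"
        proof -
          have "R > 0" unfolding R_def by (simp add: add_nonneg_pos)
          then show ?thesis using n by (simp add: pos_le_divide_eq)
        qed
        finally have "dist (word_map S w z) (word_map S w z0) \<le> \<epsilon>"
          using word_map_contracts[of w z z0] w unfolding words_def by auto
        moreover have "word_map S w z0 \<in> K" using w z0 K unfolding words_def by (intro word_map_invariant) auto
        ultimately show "z \<in> word_map S w -` V \<epsilon>"
          using infdist_le[of "word_map S w z0" K "word_map S w z"] unfolding V_def by auto
      qed
      have "prob (cball 0 (real m)) = (\<Sum>w\<in>words I n. pr w * prob (cball 0 (real m)))"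
        using sum_pr_cut[OF stopping_length[OF n(2)]] unfolding cut_length_eq[OF n(2)]
        by (simp add: sum_distrib_right[symmetric])
      also have "\<dots> \<le> (\<Sum>w\<in>words I n. pr w * prob (word_map S w -` V \<epsilon>))"
      proof (intro sum_mono mult_left_mono)
        fix w assume w: "w \<in> words I n"
        then have wI: "set w \<subseteq> I" by (auto simp: words_def)
        show "prob (cball 0 (real m)) \<le> prob (word_map S w -` V \<epsilon>)"
          using sub[OF w] vimage_word_map_sets[OF wI V] borel by (intro finite_measure_mono) auto
        show "0 \<le> pr w" using pr_pos[OF wI] by simp
      qed
      also have "\<dots> = prob (V \<epsilon>)"
        using prob_cut[OF stopping_length[OF n(2)] V] unfolding cut_length_eq[OF n(2)] by simp
      finally show ?thesis .
    qed
    have "(\<lambda>m. prob (cball 0 (real m))) \<longlonglongrightarrow> prob (\<Union>m. cball 0 (real m))"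
    proof (rule finite_Lim_measure_incseq)
      show "range (\<lambda>m. cball 0 (real m)) \<subseteq> events" unfolding borel by auto
      show "incseq (\<lambda>m. cball (0 :: real \<times> real) (real m))"
        by (intro monoI subset_cball) simp
    qed
    moreover have "(\<Union>m. cball 0 (real m)) = space \<mu>"
      unfolding space using real_arch_simple by auto
    ultimately have "(\<lambda>m. prob (cball 0 (real m))) \<longlonglongrightarrow> 1" by (simp add: prob_space)
    then have "1 \<le> prob (V \<epsilon>)" using ge by (intro LIMSEQ_le_const2) auto
    then show ?thesis using prob_le_1[of "V \<epsilon>"] by simp
  qed
  have "AE z in \<mu>. z \<in> V (1 / real (Suc n))" for n
    using V V1 borel by (intro AE_prob_1) auto
  then have "AE z in \<mu>. \<forall>n. z \<in> V (1 / real (Suc n))" by (simp add: AE_all_countable)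
  then have "AE z in \<mu>. z \<in> K"
  proof eventually_elim
    case (elim z)
    then have "infdist z K \<le> 1 / real (Suc n)" for n unfolding V_def by auto
    then have "infdist z K \<le> 0"
      by (intro LIMSEQ_le_const[OF LIMSEQ_inverse_real_of_nat]) (auto simp: inverse_eq_divide)
    then have "infdist z K = 0" using infdist_nonneg[of z K] by linarith
    then show ?case using K by (simp add: in_closed_iff_infdist_zero compact_imp_closed)
  qed
  then show ?thesis using borel K by (simp add: prob_eq_1 compact_imp_closed)
qed

lemma closed_unit_square: "closed unit_square" and compact_unit_square: "compact unit_square"
  and unit_square_sets: "unit_square \<in> sets borel"
  unfolding unit_square_def by (auto intro!: closed_Times compact_Times borel_closed)

lemma prob_unit_square: "prob unit_square = 1"
  by (rule prob_compact_invariant[OF compact_unit_square _ S_unit_square]) (auto simp: unit_square_def)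

lemma prob_Int_unit_square:
  assumes "A \<in> sets borel" shows "prob (A \<inter> unit_square) = prob A"
proof -
  have "AE x in \<mu>. x \<in> unit_square" using prob_unit_square borel unit_square_sets by (intro AE_prob_1) auto
  then show ?thesis using assms borel unit_square_sets
    by (intro finite_measure_eq_AE) auto
qed

lemma word_map_unit_square: "set w \<subseteq> I \<Longrightarrow> z \<in> unit_square \<Longrightarrow> word_map S w z \<in> unit_square"
  by (rule word_map_invariant[OF S_unit_square])

lemma dist_unit_square: "x \<in> unit_square \<Longrightarrow> y \<in> unit_square \<Longrightarrow> dist x y \<le> 2"
  using norm_le_cd[of "x - y"] unfolding mem_unit_square cd_diff dist_norm
  by (auto simp: all_bool_eq abs_if split: if_splits)

lemma mass_lower_bound:
  obtains c s where "c > 0"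
    "\<And>\<delta> A B. 0 < \<delta> \<Longrightarrow> \<delta> \<le> 1 \<Longrightarrow> A \<in> sets borel \<Longrightarrow> B \<in> sets borel \<Longrightarrow> 0 < prob A \<Longrightarrow>
      (\<And>x y. x \<in> A \<Longrightarrow> dist x y \<le> \<delta> / 2 \<Longrightarrow> y \<in> B) \<Longrightarrow> c * \<delta> powr s \<le> prob B"
proof
  define s where "s = ln pmin / ln amax"
  define c where "c = pmin * (1/8) powr s"
  have lna: "ln amax < 0" and lnp: "ln pmin < 0" using amax_pos amax_less pmin_pos pmin_less by auto
  show "c > 0" unfolding c_def using pmin_pos by simp
  fix \<delta> :: real and A B
  assume \<delta>: "0 < \<delta>" "\<delta> \<le> 1" and AB: "A \<in> sets borel" "B \<in> sets borel" "0 < prob A"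
    and sub: "\<And>x y. x \<in> A \<Longrightarrow> dist x y \<le> \<delta> / 2 \<Longrightarrow> y \<in> B"
  define t where "t = ln (\<delta> / 8) / ln amax"
  define n where "n = nat \<lceil>t\<rceil>"
  have t: "t > 0" unfolding t_def using \<delta> lna by (intro divide_neg_neg) auto
  then have n: "t \<le> real n" "real n \<le> t + 1" "n \<ge> 1" unfolding n_def by linarith+
  have an: "amax ^ n \<le> \<delta> / 8"
  proof -
    have "amax ^ n = amax powr real n" using amax_pos by (simp add: powr_realpow)
    also have "\<dots> \<le> amax powr t" using n amax_pos amax_less by (intro powr_mono') auto
    also have "\<dots> = \<delta> / 8" unfolding t_def powr_def using lna amax_pos \<delta> by simp
    finally show ?thesis .
  qed
  have pn: "c * \<delta> powr s \<le> pmin ^ n"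
  proof -
    have "c * \<delta> powr s = pmin * (\<delta> / 8) powr s" unfolding c_def using \<delta> by (simp add: powr_divide)
    also have "(\<delta> / 8) powr s = pmin powr t" unfolding s_def t_def powr_def using \<delta> pmin_pos by simp
    also have "pmin * pmin powr t = pmin powr (t + 1)" using pmin_pos by (simp add: powr_add)
    also have "\<dots> \<le> pmin powr real n" using n pmin_pos pmin_less by (intro powr_mono') auto
    also have "\<dots> = pmin ^ n" using pmin_pos by (simp add: powr_realpow)
    finally show ?thesis .
  qed
  have "prob A = (\<Sum>w\<in>words I n. pr w * prob (word_map S w -` A))"
    using prob_cut[OF stopping_length[OF n(3)] AB(1)] unfolding cut_length_eq[OF n(3)] .
  then obtain w where w: "w \<in> words I n" "prob (word_map S w -` A) \<noteq> 0"
    using AB(3) by (metis (mono_tags, lifting) mult_zero_right order_less_irrefl sum.neutral)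
  have wI: "set w \<subseteq> I" "length w = n" using w by (auto simp: words_def)
  have "prob (word_map S w -` A \<inter> unit_square) \<noteq> 0"
    using prob_Int_unit_square[OF vimage_word_map_sets[OF wI(1) AB(1)]] w(2) by simp
  then have "word_map S w -` A \<inter> unit_square \<noteq> {}" by (metis measure_empty)
  then obtain z where z: "z \<in> unit_square" "word_map S w z \<in> A" by blast
  have "unit_square \<subseteq> word_map S w -` B"
  proof
    fix y assume y: "y \<in> unit_square"
    have "dist (word_map S w z) (word_map S w y) \<le> 2 * amax ^ n * dist z y"
      using word_map_contracts[OF wI(1), of z y] wI(2) by simp
    also have "\<dots> \<le> 2 * (\<delta> / 8) * 2"
      using an dist_unit_square[OF z(1) y] amax_pos \<delta> by (intro mult_mono) auto
    finally show "y \<in> word_map S w -` B" using sub[OF z(2)] by simp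
  qed
  then have "prob unit_square \<le> prob (word_map S w -` B)"
    using borel vimage_word_map_sets[OF wI(1) AB(2)] by (intro finite_measure_mono) auto
  then have full: "prob (word_map S w -` B) = 1" using prob_unit_square prob_le_1 by (metis order_antisym)
  have "pmin ^ n \<le> pr w" using pmin_power_le_pr[OF wI(1)] wI(2) by simp
  also have "pr w = pr w * prob (word_map S w -` B)" using full by simp
  also have "\<dots> \<le> (\<Sum>w\<in>words I n. pr w * prob (word_map S w -` B))"
  proof (rule member_le_sum[OF w(1)])
    show "finite (words I n)" using finite_I by simp
    fix v assume "v \<in> words I n - {w}"
    then have "0 < pr v" by (intro pr_pos) (auto simp: words_def)
    then show "0 \<le> pr v * prob (word_map S v -` B)" by simp
  qed
  also have "\<dots> = prob B"
    using prob_cut[OF stopping_length[OF n(3)] AB(2)] unfolding cut_length_eq[OF n(3)] by simp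
  finally show "c * \<delta> powr s \<le> prob B" using pn by simp
qed

section \<open>Partition sums of the projections\<close>

abbreviation "csum \<equiv> cell_sum \<mu> unit_square"

definition proj_sum :: "real \<Rightarrow> bool \<Rightarrow> real \<Rightarrow> real" where
  "proj_sum q j \<kappa> = csum q (\<lambda>z. \<lfloor>\<kappa> * cd j z\<rfloor>)"

definition grid :: "real \<Rightarrow> real \<times> real \<Rightarrow> int \<times> int" where
  "grid \<kappa> z = (\<lfloor>\<kappa> * cd False z\<rfloor>, \<lfloor>\<kappa> * cd True z\<rfloor>)"

lemma floor_cell_sets:
  fixes f :: "real \<times> real \<Rightarrow> real"
  assumes "f \<in> borel_measurable borel"
  shows "{z \<in> unit_square. \<lfloor>f z\<rfloor> = k} \<in> sets borel"
proof -
  have "{z. \<lfloor>f z\<rfloor> = k} = f -` {of_int k..<of_int k + 1} \<inter> space borel"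
    by (auto simp: floor_eq_iff)
  also have "\<dots> \<in> sets borel" by (rule measurable_sets[OF assms]) auto
  finally have "unit_square \<inter> {z. \<lfloor>f z\<rfloor> = k} \<in> sets borel" using unit_square_sets by blast
  moreover have "unit_square \<inter> {z. \<lfloor>f z\<rfloor> = k} = {z \<in> unit_square. \<lfloor>f z\<rfloor> = k}" by auto
  ultimately show ?thesis by simp
qed

lemma cd_word_map_measurable:
  "set w \<subseteq> I \<Longrightarrow> (\<lambda>z. \<kappa> * cd j (word_map S w z)) \<in> borel_measurable borel"
  by (intro borel_measurable_continuous_onI continuous_intros continuous_word_map)

lemma grid_cell_sets: "{z \<in> unit_square. grid \<kappa> z = k} \<in> sets borel"
proof -
  have "{z \<in> unit_square. grid \<kappa> z = k}
      = {z \<in> unit_square. \<lfloor>\<kappa> * cd False z\<rfloor> = fst k} \<inter> {z \<in> unit_square. \<lfloor>\<kappa> * cd True z\<rfloor> = snd k}"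
    by (auto simp: grid_def)
  also have "\<dots> \<in> sets borel" by (intro sets.Int floor_cell_sets) measurable
  finally show ?thesis .
qed

lemma abs_cd_diff_le_1: "x \<in> unit_square \<Longrightarrow> y \<in> unit_square \<Longrightarrow> \<bar>cd j x - cd j y\<bar> \<le> 1"
  unfolding mem_unit_square by (drule spec[of _ j])+ linarith

lemma finite_floor_affine: "finite ((\<lambda>z. \<lfloor>a * cd j z + b\<rfloor>) ` unit_square)"
proof (rule card_floor_image(1)[of _ _ "nat \<lceil>\<bar>a\<bar>\<rceil>"])
  fix x y assume "x \<in> unit_square" "y \<in> unit_square"
  then have "\<bar>a\<bar> * \<bar>cd j x - cd j y\<bar> \<le> \<bar>a\<bar> * 1" by (intro mult_left_mono abs_cd_diff_le_1) auto
  then have "\<bar>(a * cd j x + b) - (a * cd j y + b)\<bar> \<le> \<bar>a\<bar>"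
    by (simp add: abs_mult[symmetric] right_diff_distrib)
  then show "\<bar>(a * cd j x + b) - (a * cd j y + b)\<bar> \<le> real (nat \<lceil>\<bar>a\<bar>\<rceil>)" by linarith
qed

lemma finite_floor: "finite ((\<lambda>z. \<lfloor>\<kappa> * cd j z\<rfloor>) ` unit_square)"
  using finite_floor_affine[of \<kappa> j 0] by simp

lemma finite_grid: "finite (grid \<kappa> ` unit_square)"
  by (rule finite_subset[OF _ finite_cartesian_product[OF finite_floor[of \<kappa> False] finite_floor[of \<kappa> True]]])
    (auto simp: grid_def)

lemma affine_cell_sum_compare:
  assumes "\<bar>c\<bar> \<le> real L * \<bar>a\<bar>" "\<bar>a\<bar> \<le> real L * \<bar>c\<bar>" "q \<ge> 0"
  shows "csum q (\<lambda>z. \<lfloor>a * cd j z + b\<rfloor>)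
    \<le> real (L + 1) powr q * real (L + 1) * csum q (\<lambda>z. \<lfloor>c * cd j z + d\<rfloor>)"
proof (rule cell_sum_compare)
  have card: "card ((\<lambda>z. \<lfloor>c * cd j z + d\<rfloor>) ` {y \<in> unit_square. \<lfloor>a * cd j y + b\<rfloor> = k}) \<le> L + 1"
    if "\<bar>c\<bar> \<le> real L * \<bar>a\<bar>" for a b c d :: real and k
  proof (rule card_floor_image(2))
    fix x y assume "x \<in> {y \<in> unit_square. \<lfloor>a * cd j y + b\<rfloor> = k}" "y \<in> {y \<in> unit_square. \<lfloor>a * cd j y + b\<rfloor> = k}"
    then have "\<bar>(a * cd j x + b) - (a * cd j y + b)\<bar> < 1" by (intro abs_diff_less_if_floor_eq) auto
    then have d1: "\<bar>a\<bar> * \<bar>cd j x - cd j y\<bar> \<le> 1" by (simp add: abs_mult[symmetric] right_diff_distrib)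
    have "\<bar>(c * cd j x + d) - (c * cd j y + d)\<bar> = \<bar>c\<bar> * \<bar>cd j x - cd j y\<bar>"
      by (simp add: abs_mult[symmetric] right_diff_distrib)
    also have "\<dots> \<le> real L * \<bar>a\<bar> * \<bar>cd j x - cd j y\<bar>" using that by (intro mult_right_mono) auto
    also have "\<dots> \<le> real L * 1" unfolding mult.assoc using d1 by (intro mult_left_mono) auto
    finally show "\<bar>(c * cd j x + d) - (c * cd j y + d)\<bar> \<le> real L" by simp
  qed
  show "card ((\<lambda>z. \<lfloor>c * cd j z + d\<rfloor>) ` {y \<in> unit_square. \<lfloor>a * cd j y + b\<rfloor> = \<lfloor>a * cd j x + b\<rfloor>}) \<le> L + 1" for x
    by (rule card[OF assms(1)])
  show "card ((\<lambda>z. \<lfloor>a * cd j z + b\<rfloor>) ` {y \<in> unit_square. \<lfloor>c * cd j y + d\<rfloor> = \<lfloor>c * cd j x + d\<rfloor>}) \<le> L + 1" for x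
    by (rule card[OF assms(2)])
  show "{z \<in> unit_square. \<lfloor>c * cd j z + d\<rfloor> = k} \<in> events" for k
    unfolding borel by (rule floor_cell_sets) measurable
qed (use assms finite_floor_affine finite_measure_axioms in auto)

lemma proj_sum_affine:
  assumes "\<bar>a\<bar> \<le> real L * \<kappa>" "\<kappa> \<le> real L * \<bar>a\<bar>" "q \<ge> 0" "\<kappa> > 0"
  shows "csum q (\<lambda>z. \<lfloor>a * cd j z + b\<rfloor>) \<le> real (L + 1) powr q * real (L + 1) * proj_sum q j \<kappa>"
    and "proj_sum q j \<kappa> \<le> real (L + 1) powr q * real (L + 1) * csum q (\<lambda>z. \<lfloor>a * cd j z + b\<rfloor>)"
  using affine_cell_sum_compare[of \<kappa> L a q j b 0] affine_cell_sum_compare[of a L \<kappa> q j 0 b] assms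
  unfolding proj_sum_def by auto

lemma proj_sum_compare:
  assumes "\<kappa> \<le> real L * \<eta>" "\<eta> \<le> real L * \<kappa>" "q \<ge> 0" "\<kappa> > 0" "\<eta> > 0"
  shows "proj_sum q j \<kappa> \<le> real (L + 1) powr q * real (L + 1) * proj_sum q j \<eta>"
  using proj_sum_affine(1)[of \<kappa> L \<eta> q j 0] assms unfolding proj_sum_def by auto

lemma proj_sum_bounds:
  assumes "q \<ge> 0" "\<kappa> > 0"
  shows "proj_sum q j \<kappa> \<le> \<kappa> + 2" "1 \<le> (\<kappa> + 2) powr q * proj_sum q j \<kappa>" "proj_sum q j \<kappa> > 0"
proof -
  define C where "C = (\<lambda>z. \<lfloor>\<kappa> * cd j z\<rfloor>) ` unit_square"
  have "card C \<le> nat \<lceil>\<kappa>\<rceil> + 1" unfolding C_def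
  proof (rule card_floor_image(2))
    fix x y assume "x \<in> unit_square" "y \<in> unit_square"
    then have "\<kappa> * \<bar>cd j x - cd j y\<bar> \<le> \<kappa> * 1" using assms by (intro mult_left_mono abs_cd_diff_le_1) auto
    then have "\<bar>\<kappa> * cd j x - \<kappa> * cd j y\<bar> \<le> \<kappa>"
      using assms by (simp add: abs_mult right_diff_distrib[symmetric])
    then show "\<bar>\<kappa> * cd j x - \<kappa> * cd j y\<bar> \<le> real (nat \<lceil>\<kappa>\<rceil>)" by linarith
  qed
  then have card: "real (card C) \<le> \<kappa> + 2" using assms by linarith
  have meas: "{z \<in> unit_square. \<lfloor>\<kappa> * cd j z\<rfloor> = k} \<in> events" for k
    unfolding borel by (rule floor_cell_sets) measurable
  note b = cell_sum_bounds[OF finite_floor meas prob_unit_square assms(1), folded C_def proj_sum_def]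
  show "proj_sum q j \<kappa> \<le> \<kappa> + 2" using b(1) card by linarith
  have "1 \<le> real (card C) powr q * proj_sum q j \<kappa>" by (rule b(2))
  also have "\<dots> \<le> (\<kappa> + 2) powr q * proj_sum q j \<kappa>"
    using card assms by (intro mult_right_mono powr_mono2) (auto simp: proj_sum_def cell_sum_nonneg)
  finally show ge: "1 \<le> (\<kappa> + 2) powr q * proj_sum q j \<kappa>" .
  then show "proj_sum q j \<kappa> > 0"
    by (metis mult_le_0_iff not_le not_one_le_zero order_trans powr_ge_zero zero_less_one)
qed

lemma prob_cell_word:
  assumes w: "set w \<subseteq> I" and A: "{z \<in> unit_square. g z = k} \<in> sets borel"
  shows "prob (word_map S w -` {z \<in> unit_square. g z = k}) = prob {z \<in> unit_square. g (word_map S w z) = k}"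
proof -
  have "prob (word_map S w -` {z \<in> unit_square. g z = k})
      = prob (word_map S w -` {z \<in> unit_square. g z = k} \<inter> unit_square)"
    by (rule prob_Int_unit_square[OF vimage_word_map_sets[OF w A], symmetric])
  also have "word_map S w -` {z \<in> unit_square. g z = k} \<inter> unit_square = {z \<in> unit_square. g (word_map S w z) = k}"
    using word_map_unit_square[OF w] by auto
  finally show ?thesis .
qed

lemma prob_cell_cut:
  assumes "stopping I stop k N" "{z \<in> unit_square. g z = c} \<in> sets borel"
  shows "prob {z \<in> unit_square. g z = c}
    = (\<Sum>w\<in>cut I stop. pr w * prob {z \<in> unit_square. g (word_map S w z) = c})"
  unfolding prob_cut[OF assms]
  using assms(2) by (intro sum.cong refl arg_cong2[where f="(*)"] prob_cell_word) (auto simp: cut_def)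

lemma image_word_subset: "set w \<subseteq> I \<Longrightarrow> (\<lambda>z. g (word_map S w z)) ` unit_square \<subseteq> g ` unit_square"
  using word_map_unit_square by auto

lemma proj_sum_swap:
  assumes i: "i \<in> I" "sw i" and q: "q \<ge> 0"
  shows "\<exists>B>0. \<forall>j \<eta>. \<eta> > 0 \<longrightarrow> proj_sum q j \<eta> \<le> B * proj_sum q (\<not> j) \<eta>"
proof -
  define L where "L = nat \<lceil>1 / amin\<rceil>"
  have L: "1 / amin \<le> real L" unfolding L_def by linarith
  have L1: "1 \<le> real L" using L amin_less amin_pos by (smt (verit) less_divide_eq_1_pos)
  define B where "B = p i powr (-q) * (real (L + 1) powr q * real (L + 1))"
  have "proj_sum q j \<eta> \<le> B * proj_sum q (\<not> j) \<eta>" if \<eta>: "\<eta> > 0" for j \<eta>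
  proof -
    define g where "g z = \<lfloor>\<eta> * cd (\<not> j) z\<rfloor>" for z
    define h where "h z = g (S i z)" for z
    have h: "h = (\<lambda>z. \<lfloor>(\<eta> * u i (\<not> j)) * cd j z + \<eta> * e i (\<not> j)\<rfloor>)"
      using i unfolding h_def g_def by (auto simp: coords algebra_simps fun_eq_iff)
    have meas: "{z \<in> unit_square. g z = k} \<in> sets borel" for k
      unfolding g_def by (rule floor_cell_sets) measurable
    have sum_h: "csum q h = (\<Sum>k\<in>g ` unit_square. prob {z \<in> unit_square. h z = k} powr q)"
    proof (rule cell_sum_superset)
      show "finite (g ` unit_square)" unfolding g_def by (rule finite_floor)
      show "h ` unit_square \<subseteq> g ` unit_square" unfolding h_def using S_unit_square[OF i(1)] by auto
    qed
    have "p i * prob {z \<in> unit_square. h z = k} \<le> prob {z \<in> unit_square. g z = k}" for k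
    proof -
      have "p i * prob {z \<in> unit_square. h z = k} = p i * prob (S i -` {z \<in> unit_square. g z = k})"
        using prob_cell_word[of "[i]" g k] meas i by (simp add: h_def)
      also have "\<dots> \<le> (\<Sum>i\<in>I. p i * prob (S i -` {z \<in> unit_square. g z = k}))"
        using i finite_I p_bounds by (intro member_le_sum) (auto simp: less_imp_le)
      also have "\<dots> = prob {z \<in> unit_square. g z = k}" by (rule self_affine[OF meas, symmetric])
      finally show ?thesis .
    qed
    then have "(p i * prob {z \<in> unit_square. h z = k}) powr q \<le> prob {z \<in> unit_square. g z = k} powr q" for k
      using p_bounds[OF i(1)] q by (intro powr_mono2) auto
    then have le: "p i powr q * csum q h \<le> csum q g"
      unfolding sum_h unfolding cell_sum_def sum_distrib_left using p_bounds[OF i(1)]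
      by (intro sum_mono) (simp add: powr_mult)
    have "proj_sum q j \<eta> \<le> real (L + 1) powr q * real (L + 1) * csum q h"
      unfolding h
    proof (rule proj_sum_affine(2))
      have b: "amin \<le> \<bar>u i (\<not> j)\<bar>" "\<bar>u i (\<not> j)\<bar> \<le> 1" using amin_le u_bounds i by (auto simp: less_imp_le)
      have "\<eta> * \<bar>u i (\<not> j)\<bar> \<le> \<eta> * 1" using b \<eta> by (intro mult_left_mono) auto
      also have "\<dots> \<le> real L * \<eta>" using L1 \<eta> by simp
      finally show "\<bar>\<eta> * u i (\<not> j)\<bar> \<le> real L * \<eta>" using \<eta> by (simp add: abs_mult)
      have "1 \<le> real L * amin" using L amin_pos by (simp add: field_simps)
      also have "\<dots> \<le> real L * \<bar>u i (\<not> j)\<bar>" using b by (intro mult_left_mono) auto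
      finally show "\<eta> \<le> real L * \<bar>\<eta> * u i (\<not> j)\<bar>" using \<eta> by (simp add: abs_mult)
    qed (use q \<eta> in auto)
    also have "\<dots> = B * (p i powr q * csum q h)"
      using p_bounds[OF i(1)] unfolding B_def by (simp add: powr_minus)
    also have "\<dots> \<le> B * csum q g" using le unfolding B_def by (intro mult_left_mono) auto
    finally show ?thesis unfolding proj_sum_def g_def .
  qed
  moreover have "B > 0" unfolding B_def using p_bounds[OF i(1)] by simp
  ultimately show ?thesis by blast
qed

lemma swaps_imp_sw: "swaps w \<Longrightarrow> set w \<subseteq> I \<Longrightarrow> \<exists>i\<in>I. sw i"
  by (induction w) auto

lemma proj_sum_orient:
  assumes q: "q \<ge> 0"
  obtains B where "B \<ge> 1" "\<And>w j \<eta>. set w \<subseteq> I \<Longrightarrow> \<eta> > 0 \<Longrightarrow> proj_sum q (j \<noteq> swaps w) \<eta> \<le> B * proj_sum q j \<eta>"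
    "\<And>w j \<eta>. set w \<subseteq> I \<Longrightarrow> \<eta> > 0 \<Longrightarrow> proj_sum q j \<eta> \<le> B * proj_sum q (j \<noteq> swaps w) \<eta>"
proof -
  obtain B0 where B0: "B0 > 0" "\<And>j \<eta>. \<exists>i\<in>I. sw i \<Longrightarrow> \<eta> > 0 \<Longrightarrow> proj_sum q j \<eta> \<le> B0 * proj_sum q (\<not> j) \<eta>"
    using proj_sum_swap[OF _ _ q] by (metis zero_less_one)
  have le: "proj_sum q j \<eta> \<le> max 1 B0 * proj_sum q j' \<eta>"
    if "j = j' \<or> (\<exists>i\<in>I. sw i)" "\<eta> > 0" for j j' \<eta>
  proof (cases "j = j'")
    case True
    have "1 * proj_sum q j \<eta> \<le> max 1 B0 * proj_sum q j \<eta>"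
      by (intro mult_right_mono) (auto simp: proj_sum_def cell_sum_nonneg)
    then show ?thesis using True by simp
  next
    case False
    then have "j' = (\<not> j)" "\<exists>i\<in>I. sw i" using that by auto
    then have "proj_sum q j \<eta> \<le> B0 * proj_sum q j' \<eta>" using B0(2)[OF _ that(2)] by simp
    also have "\<dots> \<le> max 1 B0 * proj_sum q j' \<eta>"
      by (intro mult_right_mono) (auto simp: proj_sum_def cell_sum_nonneg)
    finally show ?thesis .
  qed
  show thesis
  proof (rule that[of "max 1 B0"])
    fix w j and \<eta> :: real assume w: "set w \<subseteq> I" and \<eta>: "\<eta> > 0"
    show "proj_sum q (j \<noteq> swaps w) \<eta> \<le> max 1 B0 * proj_sum q j \<eta>"
      using swaps_imp_sw[OF _ w] by (intro le \<eta>) auto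
    show "proj_sum q j \<eta> \<le> max 1 B0 * proj_sum q (j \<noteq> swaps w) \<eta>"
      using swaps_imp_sw[OF _ w] by (intro le \<eta>) auto
  qed simp
qed

section \<open>The spectra of the projections\<close>

text \<open>
  At level \<open>\<kappa>\<close> the measure is decomposed along \<open>side_cut j \<kappa>\<close>, the first words whose image has
  extension at most \<open>1 / \<kappa>\<close> in direction \<open>j\<close>.  Grouping these words by the cell of their origin
  shows that \<open>proj_sum q j (\<kappa> * \<eta>)\<close> is submultiplicative for \<open>q \<ge> 1\<close> (Jensen) and
  supermultiplicative for \<open>q \<le> 1\<close>, up to constants.
\<close>

definition side_stop :: "bool \<Rightarrow> real \<Rightarrow> 'i list \<Rightarrow> bool" where
  "side_stop j \<kappa> w \<longleftrightarrow> \<kappa> * side w j \<le> 1"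

abbreviation "side_cut j \<kappa> \<equiv> cut I (side_stop j \<kappa>)"

definition origin :: "bool \<Rightarrow> real \<Rightarrow> 'i list \<Rightarrow> int" where
  "origin j \<kappa> w = \<lfloor>\<kappa> * shift w j\<rfloor>"

definition group_mass :: "bool \<Rightarrow> real \<Rightarrow> int \<Rightarrow> real" where
  "group_mass j \<kappa> t = (\<Sum>w\<in>{w\<in>side_cut j \<kappa>. origin j \<kappa> w = t}. pr w)"

lemma ex_power_le:
  assumes "\<epsilon> > 0" shows "\<exists>n. amax ^ n \<le> \<epsilon>"
  using real_arch_pow_inv[OF assms amax_less] by (auto intro: less_imp_le)

lemma stopping_side:
  assumes "\<kappa> > 0"
  obtains N where "stopping I (side_stop j \<kappa>) 1 N"
proof -
  obtain N where N: "amax ^ N \<le> 1 / \<kappa>" using ex_power_le[of "1 / \<kappa>"] assms by auto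
  have "stopping I (side_stop j \<kappa>) 1 N"
  proof unfold_locales
    fix w assume w: "set w \<subseteq> I" "length w = N * 1"
    then have "side w j \<le> 1 / \<kappa>" using side_bounds[of w j] N by auto
    then show "side_stop j \<kappa> w" unfolding side_stop_def using assms by (simp add: field_simps)
  qed (auto simp: finite_I)
  then show thesis by (rule that)
qed

lemma side_cut_bounds:
  assumes "\<kappa> \<ge> 1" "w \<in> side_cut j \<kappa>"
  shows "set w \<subseteq> I" "\<kappa> * side w j \<le> 1" "amin \<le> \<kappa> * side w j"
proof -
  show wI: "set w \<subseteq> I" and "\<kappa> * side w j \<le> 1"
    using assms unfolding cut_def side_stop_def by auto
  show "amin \<le> \<kappa> * side w j"
  proof (cases w rule: rev_cases)
    case Nil
    then show ?thesis using assms amin_less by simp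
  next
    case (snoc v i)
    then have "\<not> side_stop j \<kappa> v" using assms(2) unfolding cut_def
      by (auto dest!: spec[of _ "length v"])
    then have v: "1 < \<kappa> * side v j" unfolding side_stop_def by simp
    have "side w j = side v j * side [i] (j \<noteq> swaps v)" unfolding snoc side_append ..
    moreover have "amin \<le> side [i] (j \<noteq> swaps v)"
      using amin_le wI unfolding snoc by (simp add: side_def)
    moreover have "1 * amin \<le> \<kappa> * side v j * side [i] (j \<noteq> swaps v)"
      using v calculation(2) amin_pos by (intro mult_mono) auto
    ultimately show ?thesis by (simp add: mult.assoc)
  qed
qed

lemma side_cut_cd:
  assumes "\<kappa> \<ge> 1" "w \<in> side_cut j \<kappa>" "z \<in> unit_square"
  shows "\<bar>\<kappa> * cd j (word_map S w z) - \<kappa> * shift w j\<bar> \<le> 1"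
proof -
  note b = side_cut_bounds[OF assms(1,2)]
  have "\<bar>\<kappa> * cd j (word_map S w z) - \<kappa> * shift w j\<bar> = (\<kappa> * side w j) * \<bar>cd (j \<noteq> swaps w) z\<bar>"
    unfolding word_coords[OF b(1)] side_def using assms(1) by (simp add: abs_mult right_diff_distrib[symmetric])
  also have "\<dots> \<le> 1 * 1"
    using b assms(1,3) side_pos[OF b(1), of j] unfolding mem_unit_square
    by (intro mult_mono) (auto dest: spec[of _ "j \<noteq> swaps w"])
  finally show ?thesis by simp
qed

lemma group_sum:
  assumes "finite (side_cut j \<kappa>)"
  shows "(\<Sum>w\<in>side_cut j \<kappa>. f w)
    = (\<Sum>t\<in>origin j \<kappa> ` side_cut j \<kappa>. \<Sum>w\<in>{w\<in>side_cut j \<kappa>. origin j \<kappa> w = t}. f w)"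
  using assms by (intro sum.group[symmetric]) auto

lemma group_mass_pos:
  assumes "finite (side_cut j \<kappa>)" "t \<in> origin j \<kappa> ` side_cut j \<kappa>"
  shows "group_mass j \<kappa> t > 0"
  unfolding group_mass_def
proof (rule sum_pos)
  show "finite {w\<in>side_cut j \<kappa>. origin j \<kappa> w = t}" using assms by auto
qed (use assms in \<open>auto intro!: pr_pos simp: cut_def\<close>)

definition floor_mass :: "bool \<Rightarrow> real \<Rightarrow> int \<Rightarrow> real" where
  "floor_mass j \<kappa> c = prob {z \<in> unit_square. \<lfloor>\<kappa> * cd j z\<rfloor> = c}"

definition word_mass :: "bool \<Rightarrow> real \<Rightarrow> 'i list \<Rightarrow> int \<Rightarrow> real" where
  "word_mass j \<kappa> w c = prob {z \<in> unit_square. \<lfloor>\<kappa> * cd j (word_map S w z)\<rfloor> = c}"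

abbreviation "floors j \<kappa> \<equiv> (\<lambda>z. \<lfloor>\<kappa> * cd j z\<rfloor>) ` unit_square"

lemma proj_sum_eq: "proj_sum q j \<kappa> = (\<Sum>c\<in>floors j \<kappa>. floor_mass j \<kappa> c powr q)"
  unfolding proj_sum_def cell_sum_def floor_mass_def ..

lemma floor_mass_eq:
  assumes "stopping I (side_stop j' \<kappa>') 1 N"
  shows "floor_mass j \<kappa> c = (\<Sum>w\<in>side_cut j' \<kappa>'. pr w * word_mass j \<kappa> w c)"
  unfolding floor_mass_def word_mass_def
  by (rule prob_cell_cut[OF assms]) (rule floor_cell_sets, measurable)

lemma word_mass_pos_imp: "word_mass j \<kappa> w c \<noteq> 0 \<Longrightarrow> \<exists>z\<in>unit_square. \<lfloor>\<kappa> * cd j (word_map S w z)\<rfloor> = c"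
  unfolding word_mass_def by (rule ccontr) (metis (mono_tags, lifting) empty_Collect_eq measure_empty)

lemma word_mass_nonneg [simp]: "word_mass j \<kappa> w c \<ge> 0" and floor_mass_nonneg [simp]: "floor_mass j \<kappa> c \<ge> 0"
  unfolding word_mass_def floor_mass_def by auto

lemma sum_word_mass:
  assumes w: "set w \<subseteq> I" and K: "finite K" "\<And>z. z \<in> unit_square \<Longrightarrow> \<lfloor>\<kappa> * cd j (word_map S w z)\<rfloor> \<in> K"
  shows "(\<Sum>c\<in>K. word_mass j \<kappa> w c) = 1"
proof -
  have "(\<Sum>c\<in>K. word_mass j \<kappa> w c) = prob (\<Union>c\<in>K. {z \<in> unit_square. \<lfloor>\<kappa> * cd j (word_map S w z)\<rfloor> = c})"
    unfolding word_mass_def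
  proof (rule finite_measure_finite_Union[symmetric])
    show "(\<lambda>c. {z \<in> unit_square. \<lfloor>\<kappa> * cd j (word_map S w z)\<rfloor> = c}) ` K \<subseteq> events"
      unfolding borel using floor_cell_sets[OF cd_word_map_measurable[OF w]] by auto
  qed (use K in \<open>auto simp: disjoint_family_on_def\<close>)
  also have "(\<Union>c\<in>K. {z \<in> unit_square. \<lfloor>\<kappa> * cd j (word_map S w z)\<rfloor> = c}) = unit_square"
    using K by auto
  finally show ?thesis using prob_unit_square by simp
qed

lemma pr_nonneg_cut [simp]: "w \<in> side_cut j \<kappa> \<Longrightarrow> pr w \<ge> 0"
  using pr_pos[of w] by (auto simp: cut_def)

lemma group_sum_le_proj_sum:
  assumes \<kappa>: "\<kappa> \<ge> 1" and q: "q \<ge> 0"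
  shows "(\<Sum>t\<in>origin j \<kappa> ` side_cut j \<kappa>. group_mass j \<kappa> t powr q) \<le> 3 powr q * 3 * proj_sum q j \<kappa>"
    and "proj_sum q j \<kappa> \<le> 3 powr q * 3 * (\<Sum>t\<in>origin j \<kappa> ` side_cut j \<kappa>. group_mass j \<kappa> t powr q)"
proof -
  obtain N where st: "stopping I (side_stop j \<kappa>) 1 N" using stopping_side[of \<kappa> j] \<kappa> by auto
  interpret stopping I "side_stop j \<kappa>" 1 N by fact
  let ?W = "side_cut j \<kappa>"
  let ?T = "origin j \<kappa> ` ?W"
  have near: "\<bar>\<lfloor>\<kappa> * cd j (word_map S w z)\<rfloor> - origin j \<kappa> w\<bar> \<le> 1" if "w \<in> ?W" "z \<in> unit_square" for w z
    using side_cut_cd[OF \<kappa> that] unfolding origin_def by linarith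
  show "(\<Sum>t\<in>?T. group_mass j \<kappa> t powr q) \<le> 3 powr q * 3 * proj_sum q j \<kappa>"
    unfolding proj_sum_eq
  proof (rule sum_powr_band)
    fix t assume t: "t \<in> ?T"
    let ?K = "{k \<in> floors j \<kappa>. \<bar>k - t\<bar> \<le> 1}"
    have finK: "finite ?K" using finite_floor[of \<kappa> j] by auto
    have "group_mass j \<kappa> t = (\<Sum>w\<in>{w\<in>?W. origin j \<kappa> w = t}. pr w * (\<Sum>c\<in>?K. word_mass j \<kappa> w c))"
      unfolding group_mass_def
    proof (rule sum.cong[OF refl])
      fix w assume w: "w \<in> {w\<in>?W. origin j \<kappa> w = t}"
      then have wI: "set w \<subseteq> I" by (auto simp: cut_def)
      have "(\<Sum>c\<in>?K. word_mass j \<kappa> w c) = 1"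
      proof (rule sum_word_mass[OF wI finK])
        fix z assume z: "z \<in> unit_square"
        then show "\<lfloor>\<kappa> * cd j (word_map S w z)\<rfloor> \<in> ?K"
          using near[of w z] w word_map_unit_square[OF wI z] by auto
      qed
      then show "pr w = pr w * (\<Sum>c\<in>?K. word_mass j \<kappa> w c)" by simp
    qed
    also have "\<dots> = (\<Sum>c\<in>?K. \<Sum>w\<in>{w\<in>?W. origin j \<kappa> w = t}. pr w * word_mass j \<kappa> w c)"
      unfolding sum_distrib_left by (rule sum.swap)
    also have "\<dots> \<le> (\<Sum>c\<in>?K. \<Sum>w\<in>?W. pr w * word_mass j \<kappa> w c)"
      using finite_cut by (intro sum_mono sum_mono2) auto
    also have "\<dots> = (\<Sum>c\<in>?K. floor_mass j \<kappa> c)" by (simp add: floor_mass_eq[OF st])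
    finally show "group_mass j \<kappa> t \<le> (\<Sum>c\<in>?K. floor_mass j \<kappa> c)" .
  qed (use finite_cut finite_floor group_mass_pos q in \<open>auto intro: less_imp_le\<close>)
  show "proj_sum q j \<kappa> \<le> 3 powr q * 3 * (\<Sum>t\<in>?T. group_mass j \<kappa> t powr q)"
    unfolding proj_sum_eq
  proof (rule sum_powr_band)
    fix c
    have "floor_mass j \<kappa> c = (\<Sum>t\<in>?T. \<Sum>w\<in>{w\<in>?W. origin j \<kappa> w = t}. pr w * word_mass j \<kappa> w c)"
      unfolding floor_mass_eq[OF st] by (rule group_sum[OF finite_cut])
    also have "\<dots> = (\<Sum>t\<in>{t\<in>?T. \<bar>t - c\<bar> \<le> 1}. \<Sum>w\<in>{w\<in>?W. origin j \<kappa> w = t}. pr w * word_mass j \<kappa> w c)"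
    proof (rule sum.mono_neutral_right)
      show "\<forall>t\<in>?T - {t\<in>?T. \<bar>t - c\<bar> \<le> 1}. (\<Sum>w\<in>{w\<in>?W. origin j \<kappa> w = t}. pr w * word_mass j \<kappa> w c) = 0"
      proof (intro ballI sum.neutral)
        fix t w assume tw: "t \<in> ?T - {t\<in>?T. \<bar>t - c\<bar> \<le> 1}" "w \<in> {w\<in>?W. origin j \<kappa> w = t}"
        then have far: "\<not> \<bar>t - c\<bar> \<le> 1" by auto
        have "word_mass j \<kappa> w c = 0"
        proof (rule ccontr)
          assume "word_mass j \<kappa> w c \<noteq> 0"
          then obtain z where "z \<in> unit_square" "\<lfloor>\<kappa> * cd j (word_map S w z)\<rfloor> = c"
            using word_mass_pos_imp by blast
          then show False using near[of w z] tw(2) far by auto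
        qed
        then show "pr w * word_mass j \<kappa> w c = 0" by simp
      qed
    qed (use finite_cut in auto)
    also have "\<dots> \<le> (\<Sum>t\<in>{t\<in>?T. \<bar>t - c\<bar> \<le> 1}. group_mass j \<kappa> t)"
      unfolding group_mass_def
    proof (intro sum_mono)
      fix t w assume "w \<in> {w\<in>?W. origin j \<kappa> w = t}"
      then show "pr w * word_mass j \<kappa> w c \<le> pr w"
        using mult_left_mono[of "word_mass j \<kappa> w c" 1 "pr w"] by (auto simp: word_mass_def)
    qed
    finally show "floor_mass j \<kappa> c \<le> (\<Sum>t\<in>{t\<in>?T. \<bar>t - c\<bar> \<le> 1}. group_mass j \<kappa> t)" .
  qed (use finite_cut finite_floor group_mass_pos q in \<open>auto intro: less_imp_le\<close>)
qed

lemma word_sum_compare: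
  assumes q: "q \<ge> 0"
  obtains C where "C \<ge> 1"
    "\<And>\<kappa> \<eta> w j. \<kappa> \<ge> 1 \<Longrightarrow> \<eta> \<ge> 1 \<Longrightarrow> w \<in> side_cut j \<kappa> \<Longrightarrow>
      (\<Sum>c\<in>floors j (\<kappa> * \<eta>). word_mass j (\<kappa> * \<eta>) w c powr q) \<le> C * proj_sum q j \<eta>"
    "\<And>\<kappa> \<eta> w j. \<kappa> \<ge> 1 \<Longrightarrow> \<eta> \<ge> 1 \<Longrightarrow> w \<in> side_cut j \<kappa> \<Longrightarrow>
      proj_sum q j \<eta> \<le> C * (\<Sum>c\<in>floors j (\<kappa> * \<eta>). word_mass j (\<kappa> * \<eta>) w c powr q)"
proof -
  obtain B where B: "B \<ge> 1" "\<And>w j \<eta>. set w \<subseteq> I \<Longrightarrow> \<eta> > 0 \<Longrightarrow> proj_sum q (j \<noteq> swaps w) \<eta> \<le> B * proj_sum q j \<eta>"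
    "\<And>w j \<eta>. set w \<subseteq> I \<Longrightarrow> \<eta> > 0 \<Longrightarrow> proj_sum q j \<eta> \<le> B * proj_sum q (j \<noteq> swaps w) \<eta>"
    using proj_sum_orient[OF q] by metis
  define L where "L = nat \<lceil>1 / amin\<rceil>"
  have L: "1 / amin \<le> real L" unfolding L_def by linarith
  have L1: "1 \<le> real L * amin" using L amin_pos by (simp add: field_simps)
  define K where "K = real (L + 1) powr q * real (L + 1)"
  have K: "K \<ge> 1" unfolding K_def using q by (intro mult_ge1_I ge_one_powr_ge_zero) auto
  have *: "(\<Sum>c\<in>floors j (\<kappa> * \<eta>). word_mass j (\<kappa> * \<eta>) w c powr q) \<le> K * proj_sum q (j \<noteq> swaps w) \<eta>"
    "proj_sum q (j \<noteq> swaps w) \<eta> \<le> K * (\<Sum>c\<in>floors j (\<kappa> * \<eta>). word_mass j (\<kappa> * \<eta>) w c powr q)"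
    if \<kappa>: "\<kappa> \<ge> 1" and \<eta>: "\<eta> \<ge> 1" and w: "w \<in> side_cut j \<kappa>" for \<kappa> \<eta> w j
  proof -
    note b = side_cut_bounds[OF \<kappa> w]
    have h: "(\<lambda>z. \<lfloor>\<kappa> * \<eta> * cd j (word_map S w z)\<rfloor>)
        = (\<lambda>z. \<lfloor>(\<kappa> * \<eta> * slope w j) * cd (j \<noteq> swaps w) z + \<kappa> * \<eta> * shift w j\<rfloor>)"
      by (simp add: word_coords[OF b(1)] algebra_simps)
    have eq: "(\<Sum>c\<in>floors j (\<kappa> * \<eta>). word_mass j (\<kappa> * \<eta>) w c powr q)
        = csum q (\<lambda>z. \<lfloor>\<kappa> * \<eta> * cd j (word_map S w z)\<rfloor>)"
      unfolding word_mass_def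
      by (rule cell_sum_superset[symmetric, OF finite_floor image_word_subset[OF b(1)]])
    have a: "\<bar>\<kappa> * \<eta> * slope w j\<bar> = \<eta> * (\<kappa> * side w j)"
      using \<kappa> \<eta> by (simp add: side_def abs_mult)
    have up: "\<bar>\<kappa> * \<eta> * slope w j\<bar> \<le> real L * \<eta>"
    proof -
      have "1 \<le> real L" using L1 mult_left_mono[of amin 1 "real L"] amin_less by auto
      moreover have "\<eta> * (\<kappa> * side w j) \<le> \<eta> * 1" using b \<eta> by (intro mult_left_mono) auto
      ultimately show ?thesis unfolding a using \<eta> mult_right_mono[of 1 "real L" \<eta>] by linarith
    qed
    have down: "\<eta> \<le> real L * \<bar>\<kappa> * \<eta> * slope w j\<bar>"
    proof -
      have "real L * amin \<le> real L * (\<kappa> * side w j)" using b by (intro mult_left_mono) auto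
      then have "1 * \<eta> \<le> real L * (\<kappa> * side w j) * \<eta>" using L1 \<eta> by (intro mult_right_mono) auto
      then show ?thesis unfolding a by (simp add: ac_simps)
    qed
    show "(\<Sum>c\<in>floors j (\<kappa> * \<eta>). word_mass j (\<kappa> * \<eta>) w c powr q) \<le> K * proj_sum q (j \<noteq> swaps w) \<eta>"
      "proj_sum q (j \<noteq> swaps w) \<eta> \<le> K * (\<Sum>c\<in>floors j (\<kappa> * \<eta>). word_mass j (\<kappa> * \<eta>) w c powr q)"
      unfolding eq h K_def using proj_sum_affine[OF up down q] \<eta> by auto
  qed
  show thesis
  proof (rule that[of "K * B"])
    show "1 \<le> K * B" using K B(1) by (intro mult_ge1_I) auto
    fix \<kappa> \<eta> w j assume \<kappa>: "\<kappa> \<ge> (1::real)" and \<eta>: "\<eta> \<ge> (1::real)" and w: "w \<in> side_cut j \<kappa>"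
    note b = side_cut_bounds(1)[OF \<kappa> w]
    have "K * proj_sum q (j \<noteq> swaps w) \<eta> \<le> K * (B * proj_sum q j \<eta>)"
      using K B(2)[OF b, of \<eta> j] \<eta> by (intro mult_left_mono) auto
    then show "(\<Sum>c\<in>floors j (\<kappa> * \<eta>). word_mass j (\<kappa> * \<eta>) w c powr q) \<le> K * B * proj_sum q j \<eta>"
      using *(1)[OF \<kappa> \<eta> w] by simp
    have "proj_sum q j \<eta> \<le> B * proj_sum q (j \<noteq> swaps w) \<eta>" using B(3)[OF b, of \<eta> j] \<eta> by auto
    also have "\<dots> \<le> B * (K * (\<Sum>c\<in>floors j (\<kappa> * \<eta>). word_mass j (\<kappa> * \<eta>) w c powr q))"
      using B(1) *(2)[OF \<kappa> \<eta> w] by (intro mult_left_mono) auto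
    finally show "proj_sum q j \<eta> \<le> K * B * (\<Sum>c\<in>floors j (\<kappa> * \<eta>). word_mass j (\<kappa> * \<eta>) w c powr q)"
      by (simp add: ac_simps)
  qed
qed

definition group_word_mass :: "bool \<Rightarrow> real \<Rightarrow> real \<Rightarrow> int \<Rightarrow> int \<Rightarrow> real" where
  "group_word_mass j \<kappa> \<eta> c t = (\<Sum>w\<in>{w\<in>side_cut j \<kappa>. origin j \<kappa> w = t}. pr w * word_mass j (\<kappa> * \<eta>) w c)"

lemma group_word_mass_nonneg [simp]: "group_word_mass j \<kappa> \<eta> c t \<ge> 0"
  unfolding group_word_mass_def by (intro sum_nonneg) auto

lemma floor_mass_groups:
  assumes \<kappa>: "\<kappa> \<ge> 1" and \<eta>: "\<eta> \<ge> 1"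
  obtains T where "T \<subseteq> origin j \<kappa> ` side_cut j \<kappa>" "finite T" "card T \<le> 5"
    "floor_mass j (\<kappa> * \<eta>) c = (\<Sum>t\<in>T. group_word_mass j \<kappa> \<eta> c t)"
    "\<And>t. t \<in> origin j \<kappa> ` side_cut j \<kappa> - T \<Longrightarrow> group_word_mass j \<kappa> \<eta> c t = 0"
proof -
  obtain N where st: "stopping I (side_stop j \<kappa>) 1 N" using stopping_side[of \<kappa> j] \<kappa> by auto
  interpret stopping I "side_stop j \<kappa>" 1 N by fact
  let ?T = "origin j \<kappa> ` side_cut j \<kappa>"
  define b where "b = \<lfloor>of_int c / \<eta>\<rfloor>"
  define T where "T = ?T \<inter> {b - 2..b + 2}"
  have zero: "group_word_mass j \<kappa> \<eta> c t = 0" if t: "t \<in> ?T - T" for t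
    unfolding group_word_mass_def
  proof (rule sum.neutral, rule ballI)
    fix w assume w: "w \<in> {w\<in>side_cut j \<kappa>. origin j \<kappa> w = t}"
    have "word_mass j (\<kappa> * \<eta>) w c = 0"
    proof (rule ccontr)
      assume "word_mass j (\<kappa> * \<eta>) w c \<noteq> 0"
      then obtain z where z: "z \<in> unit_square" "\<lfloor>\<kappa> * \<eta> * cd j (word_map S w z)\<rfloor> = c"
        using word_mass_pos_imp by blast
      define y where "y = \<kappa> * cd j (word_map S w z)"
      have "of_int c \<le> \<eta> * y" "\<eta> * y < of_int c + 1"
        using z(2) unfolding y_def by (auto simp: floor_eq_iff ac_simps)
      then have "of_int c / \<eta> \<le> y" "y < of_int c / \<eta> + 1"
        using \<eta> by (auto simp: field_simps)
      moreover have "\<bar>y - \<kappa> * shift w j\<bar> \<le> 1" unfolding y_def using side_cut_cd[OF \<kappa> _ z(1)] w by auto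
      ultimately have "\<bar>\<lfloor>\<kappa> * shift w j\<rfloor> - b\<bar> \<le> 2" unfolding b_def by linarith
      then show False using t w unfolding T_def origin_def by auto
    qed
    then show "pr w * word_mass j (\<kappa> * \<eta>) w c = 0" by simp
  qed
  have "floor_mass j (\<kappa> * \<eta>) c = (\<Sum>t\<in>?T. group_word_mass j \<kappa> \<eta> c t)"
    unfolding floor_mass_eq[OF st] group_word_mass_def by (rule group_sum[OF finite_cut])
  also have "\<dots> = (\<Sum>t\<in>T. group_word_mass j \<kappa> \<eta> c t)"
    using finite_cut zero by (intro sum.mono_neutral_right) (auto simp: T_def)
  finally have eq: "floor_mass j (\<kappa> * \<eta>) c = (\<Sum>t\<in>T. group_word_mass j \<kappa> \<eta> c t)" .
  have "card T \<le> card {b - 2..b + 2}" unfolding T_def by (intro card_mono) auto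
  then have "card T \<le> 5" by simp
  with eq zero show thesis using finite_cut by (intro that[of T]) (auto simp: T_def)
qed

lemma proj_sum_submult:
  assumes q: "q \<ge> 1"
  obtains C where "C > 0" "\<And>\<kappa> \<eta> j. \<kappa> \<ge> 1 \<Longrightarrow> \<eta> \<ge> 1 \<Longrightarrow> proj_sum q j (\<kappa> * \<eta>) \<le> C * proj_sum q j \<kappa> * proj_sum q j \<eta>"
proof -
  have q0: "q \<ge> 0" using q by simp
  obtain C where C: "C \<ge> 1" "\<And>\<kappa> \<eta> w j. \<kappa> \<ge> 1 \<Longrightarrow> \<eta> \<ge> 1 \<Longrightarrow> w \<in> side_cut j \<kappa> \<Longrightarrow>
      (\<Sum>c\<in>floors j (\<kappa> * \<eta>). word_mass j (\<kappa> * \<eta>) w c powr q) \<le> C * proj_sum q j \<eta>"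
    using word_sum_compare[OF q0] by metis
  have "proj_sum q j (\<kappa> * \<eta>) \<le> (5 powr q * C * (3 powr q * 3)) * proj_sum q j \<kappa> * proj_sum q j \<eta>"
    if \<kappa>: "\<kappa> \<ge> 1" and \<eta>: "\<eta> \<ge> 1" for \<kappa> \<eta> j
  proof -
    obtain N where st: "stopping I (side_stop j \<kappa>) 1 N" using stopping_side[of \<kappa> j] \<kappa> by auto
    interpret stopping I "side_stop j \<kappa>" 1 N by fact
    let ?T = "origin j \<kappa> ` side_cut j \<kappa>"
    let ?G = "\<lambda>t. {w\<in>side_cut j \<kappa>. origin j \<kappa> w = t}"
    have "floor_mass j (\<kappa> * \<eta>) c powr q
        \<le> 5 powr q * (\<Sum>t\<in>?T. group_mass j \<kappa> t powr (q - 1) * (\<Sum>w\<in>?G t. pr w * word_mass j (\<kappa> * \<eta>) w c powr q))" for c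
    proof -
      obtain T where T: "T \<subseteq> ?T" "finite T" "card T \<le> 5"
        "floor_mass j (\<kappa> * \<eta>) c = (\<Sum>t\<in>T. group_word_mass j \<kappa> \<eta> c t)"
        using floor_mass_groups[OF \<kappa> \<eta>] by metis
      have "floor_mass j (\<kappa> * \<eta>) c powr q \<le> real (card T) powr q * (\<Sum>t\<in>T. group_word_mass j \<kappa> \<eta> c t powr q)"
        unfolding T(4) using T q by (intro powr_sum_le) auto
      also have "\<dots> \<le> 5 powr q * (\<Sum>t\<in>?T. group_word_mass j \<kappa> \<eta> c t powr q)"
        using T q finite_cut by (intro mult_mono powr_mono2 sum_mono2 sum_nonneg) auto
      also have "\<dots> \<le> 5 powr q * (\<Sum>t\<in>?T. group_mass j \<kappa> t powr (q - 1) * (\<Sum>w\<in>?G t. pr w * word_mass j (\<kappa> * \<eta>) w c powr q))"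
        unfolding group_word_mass_def group_mass_def using finite_cut q
        by (intro mult_left_mono sum_mono powr_weighted_sum_le) auto
      finally show ?thesis .
    qed
    then have "proj_sum q j (\<kappa> * \<eta>) \<le> (\<Sum>c\<in>floors j (\<kappa> * \<eta>).
        5 powr q * (\<Sum>t\<in>?T. group_mass j \<kappa> t powr (q - 1) * (\<Sum>w\<in>?G t. pr w * word_mass j (\<kappa> * \<eta>) w c powr q)))"
      unfolding proj_sum_eq by (intro sum_mono)
    also have "\<dots> = 5 powr q * (\<Sum>t\<in>?T. group_mass j \<kappa> t powr (q - 1) *
        (\<Sum>w\<in>?G t. pr w * (\<Sum>c\<in>floors j (\<kappa> * \<eta>). word_mass j (\<kappa> * \<eta>) w c powr q)))"
      unfolding sum_distrib_left[symmetric]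
      by (subst sum.swap, simp add: sum_distrib_left[symmetric], subst sum.swap, simp add: sum_distrib_left[symmetric])
    also have "\<dots> \<le> 5 powr q * (\<Sum>t\<in>?T. group_mass j \<kappa> t powr (q - 1) * (\<Sum>w\<in>?G t. pr w * (C * proj_sum q j \<eta>)))"
      by (intro mult_left_mono sum_mono C(2)[OF \<kappa> \<eta>]) auto
    also have "\<dots> = 5 powr q * (C * proj_sum q j \<eta> * (\<Sum>t\<in>?T. group_mass j \<kappa> t powr (q - 1) * group_mass j \<kappa> t))"
      unfolding group_mass_def by (simp add: sum_distrib_left sum_distrib_right ac_simps)
    also have "(\<Sum>t\<in>?T. group_mass j \<kappa> t powr (q - 1) * group_mass j \<kappa> t) = (\<Sum>t\<in>?T. group_mass j \<kappa> t powr q)"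
      using group_mass_pos[OF finite_cut] by (intro sum.cong refl) (simp add: powr_minus_1_mult)
    also have "5 powr q * (C * proj_sum q j \<eta> * \<dots>) \<le> 5 powr q * (C * proj_sum q j \<eta> * (3 powr q * 3 * proj_sum q j \<kappa>))"
      using C(1) group_sum_le_proj_sum(1)[OF \<kappa> q0]
      by (intro mult_left_mono mult_nonneg_nonneg) (auto simp: proj_sum_def cell_sum_nonneg)
    finally show ?thesis by (simp add: ac_simps)
  qed
  then show thesis using C(1) by (intro that[of "5 powr q * C * (3 powr q * 3)"]) auto
qed

lemma proj_sum_supermult:
  assumes q: "0 \<le> q" "q \<le> 1"
  obtains C where "C > 0" "\<And>\<kappa> \<eta> j. \<kappa> \<ge> 1 \<Longrightarrow> \<eta> \<ge> 1 \<Longrightarrow> proj_sum q j \<kappa> * proj_sum q j \<eta> \<le> C * proj_sum q j (\<kappa> * \<eta>)"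
proof -
  obtain C where C: "C \<ge> 1" "\<And>\<kappa> \<eta> w j. \<kappa> \<ge> 1 \<Longrightarrow> \<eta> \<ge> 1 \<Longrightarrow> w \<in> side_cut j \<kappa> \<Longrightarrow>
      proj_sum q j \<eta> \<le> C * (\<Sum>c\<in>floors j (\<kappa> * \<eta>). word_mass j (\<kappa> * \<eta>) w c powr q)"
    using word_sum_compare[OF q(1)] by metis
  have "proj_sum q j \<kappa> * proj_sum q j \<eta> \<le> (3 powr q * 3 * (C * 5)) * proj_sum q j (\<kappa> * \<eta>)"
    if \<kappa>: "\<kappa> \<ge> 1" and \<eta>: "\<eta> \<ge> 1" for \<kappa> \<eta> j
  proof -
    obtain N where st: "stopping I (side_stop j \<kappa>) 1 N" using stopping_side[of \<kappa> j] \<kappa> by auto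
    interpret stopping I "side_stop j \<kappa>" 1 N by fact
    let ?T = "origin j \<kappa> ` side_cut j \<kappa>"
    let ?G = "\<lambda>t. {w\<in>side_cut j \<kappa>. origin j \<kappa> w = t}"
    have cell: "(\<Sum>t\<in>?T. group_mass j \<kappa> t powr (q - 1) * (\<Sum>w\<in>?G t. pr w * word_mass j (\<kappa> * \<eta>) w c powr q))
        \<le> 5 * floor_mass j (\<kappa> * \<eta>) c powr q" for c
    proof -
      obtain T where T: "T \<subseteq> ?T" "finite T" "card T \<le> 5"
        "floor_mass j (\<kappa> * \<eta>) c = (\<Sum>t\<in>T. group_word_mass j \<kappa> \<eta> c t)"
        "\<And>t. t \<in> ?T - T \<Longrightarrow> group_word_mass j \<kappa> \<eta> c t = 0"
        using floor_mass_groups[OF \<kappa> \<eta>] by metis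
      have "(\<Sum>t\<in>?T. group_mass j \<kappa> t powr (q - 1) * (\<Sum>w\<in>?G t. pr w * word_mass j (\<kappa> * \<eta>) w c powr q))
          \<le> (\<Sum>t\<in>?T. group_word_mass j \<kappa> \<eta> c t powr q)"
        unfolding group_word_mass_def group_mass_def using finite_cut q
        by (intro sum_mono powr_weighted_sum_ge) auto
      also have "\<dots> = (\<Sum>t\<in>T. group_word_mass j \<kappa> \<eta> c t powr q)"
        using T finite_cut by (intro sum.mono_neutral_right) auto
      also have "\<dots> \<le> real (card T) * floor_mass j (\<kappa> * \<eta>) c powr q"
        unfolding T(4) using T q by (intro sum_powr_le_card) auto
      also have "\<dots> \<le> 5 * floor_mass j (\<kappa> * \<eta>) c powr q" using T(3) by (intro mult_right_mono) auto
      finally show ?thesis .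
    qed
    have "proj_sum q j \<kappa> * proj_sum q j \<eta> \<le> 3 powr q * 3 * (\<Sum>t\<in>?T. group_mass j \<kappa> t powr q) * proj_sum q j \<eta>"
      using group_sum_le_proj_sum(2)[OF \<kappa> q(1)] by (intro mult_right_mono) (auto simp: proj_sum_def cell_sum_nonneg)
    also have "(\<Sum>t\<in>?T. group_mass j \<kappa> t powr q) = (\<Sum>t\<in>?T. group_mass j \<kappa> t powr (q - 1) * group_mass j \<kappa> t)"
      using group_mass_pos[OF finite_cut] by (intro sum.cong refl) (simp add: powr_minus_1_mult)
    also have "3 powr q * 3 * \<dots> * proj_sum q j \<eta>
        = 3 powr q * 3 * (\<Sum>t\<in>?T. group_mass j \<kappa> t powr (q - 1) * (\<Sum>w\<in>?G t. pr w * proj_sum q j \<eta>))"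
      unfolding group_mass_def by (simp add: sum_distrib_left sum_distrib_right ac_simps)
    also have "\<dots> \<le> 3 powr q * 3 * (\<Sum>t\<in>?T. group_mass j \<kappa> t powr (q - 1) *
        (\<Sum>w\<in>?G t. pr w * (C * (\<Sum>c\<in>floors j (\<kappa> * \<eta>). word_mass j (\<kappa> * \<eta>) w c powr q))))"
      by (intro mult_left_mono sum_mono C(2)[OF \<kappa> \<eta>]) auto
    also have "\<dots> = 3 powr q * 3 * (C * (\<Sum>c\<in>floors j (\<kappa> * \<eta>). \<Sum>t\<in>?T. group_mass j \<kappa> t powr (q - 1) *
        (\<Sum>w\<in>?G t. pr w * word_mass j (\<kappa> * \<eta>) w c powr q)))"
    proof -
      have "(\<Sum>c\<in>floors j (\<kappa> * \<eta>). \<Sum>t\<in>?T. group_mass j \<kappa> t powr (q - 1) *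
          (\<Sum>w\<in>?G t. pr w * word_mass j (\<kappa> * \<eta>) w c powr q))
        = (\<Sum>t\<in>?T. group_mass j \<kappa> t powr (q - 1) *
          (\<Sum>w\<in>?G t. pr w * (\<Sum>c\<in>floors j (\<kappa> * \<eta>). word_mass j (\<kappa> * \<eta>) w c powr q)))"
        by (subst sum.swap, simp add: sum_distrib_left[symmetric], subst sum.swap, simp add: sum_distrib_left[symmetric])
      then show ?thesis by (simp add: sum_distrib_left ac_simps)
    qed
    also have "\<dots> \<le> 3 powr q * 3 * (C * (\<Sum>c\<in>floors j (\<kappa> * \<eta>). 5 * floor_mass j (\<kappa> * \<eta>) c powr q))"
      using C(1) by (intro mult_left_mono sum_mono cell) auto
    also have "\<dots> = (3 powr q * 3 * (C * 5)) * proj_sum q j (\<kappa> * \<eta>)"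
      unfolding proj_sum_eq sum_distrib_left[symmetric] by simp
    finally show ?thesis .
  qed
  then show thesis using C(1) by (intro that[of "3 powr q * 3 * (C * 5)"]) auto
qed

lemma proj_sum_dyadic_limit:
  assumes q: "q \<ge> 0"
  shows "\<exists>L. (\<lambda>n. ln (proj_sum q j (2 ^ n)) / real n) \<longlonglongrightarrow> L"
proof -
  define a where "a n = proj_sum q j (2 ^ n)" for n
  have a: "a n > 0" "ln (a n) \<le> real n * ln 2 + ln 3" "- (q * (real n * ln 2 + ln 3)) \<le> ln (a n)" for n
  proof -
    show pos: "a n > 0" unfolding a_def using proj_sum_bounds(3)[OF q] by simp
    have le: "(2::real) ^ n + 2 \<le> 2 ^ n * 3" using one_le_power[of "2::real" n] by simp
    have ln3: "ln (2 ^ n * 3) = real n * ln 2 + ln (3::real)" by (simp add: ln_mult ln_realpow)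
    have "a n \<le> 2 ^ n * 3"
      unfolding a_def by (rule order_trans[OF proj_sum_bounds(1)[OF q] le]) simp
    then have "ln (a n) \<le> ln (2 ^ n * 3)" using pos by (subst ln_le_cancel_iff) auto
    then show "ln (a n) \<le> real n * ln 2 + ln 3" unfolding ln3 .
    have "1 \<le> (2 ^ n + 2) powr q * a n" unfolding a_def using proj_sum_bounds(2)[OF q, of "2 ^ n" j] by simp
    also have "\<dots> \<le> (2 ^ n * 3) powr q * a n"
      using le q pos by (intro mult_right_mono powr_mono2) auto
    finally have "ln 1 \<le> ln ((2 ^ n * 3) powr q * a n)" using pos by (subst ln_le_cancel_iff) auto
    also have "\<dots> = q * (real n * ln 2 + ln 3) + ln (a n)"
      using pos by (simp add: ln_mult ln_powr ln3[symmetric])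
    finally show "- (q * (real n * ln 2 + ln 3)) \<le> ln (a n)" by simp
  qed
  have n1: "real n * ln 2 + ln 3 \<le> real n * (ln 2 + ln (3::real))" if "n \<ge> 1" for n
    using that mult_right_mono[of 1 "real n" "ln 3"] by (simp add: distrib_left)
  show ?thesis
  proof (cases "q \<ge> 1")
    case True
    obtain C where C: "C > 0"
      "\<And>\<kappa> \<eta> j. \<kappa> \<ge> 1 \<Longrightarrow> \<eta> \<ge> 1 \<Longrightarrow> proj_sum q j (\<kappa> * \<eta>) \<le> C * proj_sum q j \<kappa> * proj_sum q j \<eta>"
      using proj_sum_submult[OF True] by metis
    have "\<exists>L. (\<lambda>n. (ln (a n) + ln C) / real n) \<longlonglongrightarrow> L"
    proof (rule fekete_subadditive[of "\<lambda>n. ln (a n) + ln C" "- (q * (ln 2 + ln 3) + \<bar>ln C\<bar>)"])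
      fix m n :: nat
      have "a (m + n) \<le> C * a m * a n" unfolding a_def power_add by (intro C(2)) auto
      then have "ln (a (m + n)) \<le> ln (C * a m * a n)" using a(1) C(1) by (subst ln_le_cancel_iff) auto
      then show "ln (a (m + n)) + ln C \<le> ln (a m) + ln C + (ln (a n) + ln C)"
        using a(1)[of m] a(1)[of n] C(1) by (simp add: ln_mult)
    next
      fix n :: nat assume n: "n \<ge> 1"
      have "q * (real n * ln 2 + ln 3) \<le> q * (real n * (ln 2 + ln 3))" using n1[OF n] q by (intro mult_left_mono) auto
      moreover have "\<bar>ln C\<bar> \<le> real n * \<bar>ln C\<bar>" using n mult_right_mono[of 1 "real n" "\<bar>ln C\<bar>"] by simp
      ultimately show "- (q * (ln 2 + ln 3) + \<bar>ln C\<bar>) * real n \<le> ln (a n) + ln C"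
        using a(3)[of n] by (simp add: algebra_simps)
    qed blast
    then obtain L where L: "(\<lambda>n. (ln (a n) + ln C) / real n) \<longlonglongrightarrow> L" by blast
    have "(\<lambda>n. (ln (a n) + ln C) / real n - ln C / real n) \<longlonglongrightarrow> L - 0"
      by (intro tendsto_diff L lim_const_over_n)
    then show ?thesis unfolding a_def[symmetric] by (auto simp: diff_divide_distrib[symmetric])
  next
    case False
    obtain C where C: "C > 0"
      "\<And>\<kappa> \<eta> j. \<kappa> \<ge> 1 \<Longrightarrow> \<eta> \<ge> 1 \<Longrightarrow> proj_sum q j \<kappa> * proj_sum q j \<eta> \<le> C * proj_sum q j (\<kappa> * \<eta>)"
      using proj_sum_supermult[OF q] False by (metis linear)
    have "\<exists>L. (\<lambda>n. (ln C - ln (a n)) / real n) \<longlonglongrightarrow> L"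
    proof (rule fekete_subadditive[of "\<lambda>n. ln C - ln (a n)" "- (ln 2 + ln 3 + \<bar>ln C\<bar>)"])
      fix m n :: nat
      have "a m * a n \<le> C * a (m + n)" unfolding a_def power_add by (intro C(2)) auto
      then have "ln (a m * a n) \<le> ln (C * a (m + n))" using a(1) C(1) by (subst ln_le_cancel_iff) auto
      then show "ln C - ln (a (m + n)) \<le> ln C - ln (a m) + (ln C - ln (a n))"
        using a(1)[of m] a(1)[of n] a(1)[of "m + n"] C(1) by (simp add: ln_mult)
    next
      fix n :: nat assume n: "n \<ge> 1"
      have "\<bar>ln C\<bar> \<le> real n * \<bar>ln C\<bar>" using n mult_right_mono[of 1 "real n" "\<bar>ln C\<bar>"] by simp
      moreover have "- (ln 2 + ln 3 + \<bar>ln C\<bar>) * real n = - (real n * (ln 2 + ln 3)) - real n * \<bar>ln C\<bar>"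
        by (simp add: algebra_simps)
      ultimately show "- (ln 2 + ln 3 + \<bar>ln C\<bar>) * real n \<le> ln C - ln (a n)"
        using a(2)[of n] n1[OF n] abs_ge_minus_self[of "ln C"] by linarith
    qed blast
    then obtain L where L: "(\<lambda>n. (ln C - ln (a n)) / real n) \<longlonglongrightarrow> L" by blast
    have "(\<lambda>n. ln C / real n - (ln C - ln (a n)) / real n) \<longlonglongrightarrow> 0 - L"
      by (intro tendsto_diff L lim_const_over_n)
    then show ?thesis unfolding a_def[symmetric] by (auto simp: diff_divide_distrib[symmetric])
  qed
qed

definition tau :: "real \<Rightarrow> bool \<Rightarrow> real" where
  "tau q j = (THE L. (\<lambda>n. ln (proj_sum q j (2 ^ n)) / real n) \<longlonglongrightarrow> L) / ln 2"

lemma proj_sum_tau: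
  assumes q: "q \<ge> 0" and \<epsilon>: "\<epsilon> > 0" and \<kappa>0: "\<kappa>0 > 0"
  shows "\<exists>C>0. \<forall>\<kappa>\<ge>\<kappa>0. proj_sum q j \<kappa> \<le> C * \<kappa> powr (tau q j + \<epsilon>) \<and> \<kappa> powr (tau q j - \<epsilon>) \<le> C * proj_sum q j \<kappa>"
proof -
  define a where "a n = proj_sum q j (2 ^ n)" for n
  have apos: "a n > 0" for n unfolding a_def using proj_sum_bounds(3)[OF q] by simp
  obtain L where L: "(\<lambda>n. ln (a n) / real n) \<longlonglongrightarrow> L"
    using proj_sum_dyadic_limit[OF q] unfolding a_def by blast
  have tau: "L = tau q j * ln 2"
    unfolding tau_def a_def[symmetric] using L by (subst the_equality[where a = L]) (auto intro: LIMSEQ_unique)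
  define \<epsilon>' where "\<epsilon>' = \<epsilon> * ln 2"
  obtain K where K: "K \<ge> 0" "\<And>n. \<bar>ln (a n) - L * real n\<bar> \<le> \<epsilon>' * real n + K"
    using ex_bound_if_tendsto[OF L, of \<epsilon>'] \<epsilon> unfolding \<epsilon>'_def by auto
  have up: "a n \<le> exp K * (2 ^ n) powr (tau q j + \<epsilon>)" for n
  proof -
    have "ln (a n) \<le> (tau q j + \<epsilon>) * (real n * ln 2) + K"
      using K(2)[of n] unfolding tau \<epsilon>'_def by (simp add: algebra_simps)
    then have "exp (ln (a n)) \<le> exp ((tau q j + \<epsilon>) * (real n * ln 2) + K)" by simp
    then show ?thesis using apos by (simp add: exp_add powr_def ln_realpow mult.commute)
  qed
  have down: "(2 ^ n) powr (tau q j - \<epsilon>) \<le> exp K * a n" for n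
  proof -
    have "(tau q j - \<epsilon>) * (real n * ln 2) \<le> K + ln (a n)"
      using K(2)[of n] unfolding tau \<epsilon>'_def by (simp add: algebra_simps)
    then have "exp ((tau q j - \<epsilon>) * (real n * ln 2)) \<le> exp (K + ln (a n))" by simp
    then show ?thesis using apos by (simp add: exp_add powr_def ln_realpow)
  qed
  define M where "M = nat \<lceil>max 2 (1 / \<kappa>0)\<rceil>"
  have M: "2 \<le> real M" "1 / \<kappa>0 \<le> real M" unfolding M_def by linarith+
  define B where "B = real (M + 1) powr q * real (M + 1)"
  define D where "D = max (real M powr \<bar>tau q j + \<epsilon>\<bar>) (real M powr \<bar>tau q j - \<epsilon>\<bar>)"
  have B: "B > 0" and D: "D > 0" unfolding B_def D_def using M by (auto simp: less_max_iff_disj)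
  have "proj_sum q j \<kappa> \<le> B * exp K * D * \<kappa> powr (tau q j + \<epsilon>) \<and> \<kappa> powr (tau q j - \<epsilon>) \<le> B * exp K * D * proj_sum q j \<kappa>"
    if \<kappa>: "\<kappa> \<ge> \<kappa>0" for \<kappa>
  proof -
    have kpos: "\<kappa> > 0" using \<kappa> \<kappa>0 by simp
    define n where "n = nat \<lfloor>log 2 (max 1 \<kappa>)\<rfloor>"
    have l: "log 2 (max 1 \<kappa>) \<ge> 0" by (simp add: zero_le_log_cancel_iff)
    have n: "real n \<le> log 2 (max 1 \<kappa>)" "log 2 (max 1 \<kappa>) < real n + 1"
      unfolding n_def using l by linarith+
    have "2 powr real n \<le> max 1 \<kappa>" "max 1 \<kappa> < 2 powr (real n + 1)"
      using n by (auto simp: le_log_iff log_less_iff)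
    then have pn: "2 ^ n \<le> max 1 \<kappa>" "max 1 \<kappa> \<le> 2 * 2 ^ n" by (auto simp: powr_realpow powr_add)
    have c1: "\<kappa> \<le> real M * 2 ^ n"
    proof -
      have "2 * 2 ^ n \<le> real M * 2 ^ n" using M by (intro mult_right_mono) auto
      then show ?thesis using pn by linarith
    qed
    have c2: "2 ^ n \<le> real M * \<kappa>"
    proof -
      have "1 = 1 / \<kappa>0 * \<kappa>0" using \<kappa>0 by simp
      also have "\<dots> \<le> real M * \<kappa>" using M \<kappa> \<kappa>0 by (intro mult_mono) auto
      finally have "1 \<le> real M * \<kappa>" .
      moreover have "1 * \<kappa> \<le> real M * \<kappa>" using M kpos by (intro mult_right_mono) auto
      ultimately show ?thesis using pn(1) by linarith
    qed
    have "proj_sum q j \<kappa> \<le> B * a n"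
      unfolding B_def a_def using c1 c2 kpos q by (intro proj_sum_compare) auto
    also have "\<dots> \<le> B * (exp K * (real M powr \<bar>tau q j + \<epsilon>\<bar> * \<kappa> powr (tau q j + \<epsilon>)))"
      using B kpos c1 c2 powr_comparable[of "2 ^ n" \<kappa> "real M" "tau q j + \<epsilon>"]
      by (intro mult_left_mono order_trans[OF up]) auto
    also have "\<dots> \<le> B * (exp K * (D * \<kappa> powr (tau q j + \<epsilon>)))"
      using B unfolding D_def by (intro mult_left_mono mult_right_mono) auto
    finally have 1: "proj_sum q j \<kappa> \<le> B * exp K * D * \<kappa> powr (tau q j + \<epsilon>)" by (simp add: mult.assoc)
    have "\<kappa> powr (tau q j - \<epsilon>) \<le> real M powr \<bar>tau q j - \<epsilon>\<bar> * (2 ^ n) powr (tau q j - \<epsilon>)"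
      using kpos c1 c2 by (intro powr_comparable) auto
    also have "\<dots> \<le> D * (exp K * a n)"
      using D down unfolding D_def by (intro mult_mono) auto
    also have "\<dots> \<le> D * (exp K * (B * proj_sum q j \<kappa>))"
      using D c1 c2 kpos q unfolding a_def B_def by (intro mult_left_mono proj_sum_compare) auto
    finally show ?thesis using 1 by (simp add: ac_simps)
  qed
  moreover have "B * exp K * D > 0" using B D by simp
  ultimately show ?thesis by blast
qed

lemma proj_sum_tau_uniform:
  assumes "q \<ge> 0" "\<epsilon> > 0" "\<kappa>0 > 0"
  obtains C where "C > 0" "\<And>j \<kappa>. \<kappa> \<ge> \<kappa>0 \<Longrightarrow> proj_sum q j \<kappa> \<le> C * \<kappa> powr (tau q j + \<epsilon>)"
    "\<And>j \<kappa>. \<kappa> \<ge> \<kappa>0 \<Longrightarrow> \<kappa> powr (tau q j - \<epsilon>) \<le> C * proj_sum q j \<kappa>"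
proof -
  obtain C where C: "\<And>j. C j > 0" "\<And>j \<kappa>. \<kappa> \<ge> \<kappa>0 \<Longrightarrow> proj_sum q j \<kappa> \<le> C j * \<kappa> powr (tau q j + \<epsilon>)"
    "\<And>j \<kappa>. \<kappa> \<ge> \<kappa>0 \<Longrightarrow> \<kappa> powr (tau q j - \<epsilon>) \<le> C j * proj_sum q j \<kappa>"
    using proj_sum_tau[OF assms] by metis
  have le: "C j \<le> C False + C True" for j using C(1)[of False] C(1)[of True] by (cases j) auto
  show thesis
  proof (rule that[of "C False + C True"])
    fix j \<kappa> assume \<kappa>: "\<kappa> \<ge> \<kappa>0"
    show "proj_sum q j \<kappa> \<le> (C False + C True) * \<kappa> powr (tau q j + \<epsilon>)"
      by (rule order_trans[OF C(2)[OF \<kappa>] mult_right_mono[OF le]]) simp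
    show "\<kappa> powr (tau q j - \<epsilon>) \<le> (C False + C True) * proj_sum q j \<kappa>"
      by (rule order_trans[OF C(3)[OF \<kappa>] mult_right_mono[OF le]]) (simp add: proj_sum_def cell_sum_nonneg)
  qed (use C(1)[of False] C(1)[of True] in simp)
qed

lemma tau_swap:
  assumes q: "q \<ge> 0" and sw: "i \<in> I" "sw i"
  shows "tau q j = tau q (\<not> j)"
proof -
  have le: "tau q j \<le> tau q (\<not> j) + \<epsilon>" if \<epsilon>: "\<epsilon> > 0" for \<epsilon> j
  proof (rule ccontr)
    assume "\<not> tau q j \<le> tau q (\<not> j) + \<epsilon>"
    then have gt: "tau q (\<not> j) + \<epsilon> / 4 - (tau q j - \<epsilon> / 4) < 0" using \<epsilon> by simp
    obtain B where B: "B > 0" "\<And>\<eta>. \<eta> > 0 \<Longrightarrow> proj_sum q j \<eta> \<le> B * proj_sum q (\<not> j) \<eta>"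
      using proj_sum_swap[OF sw q] by metis
    obtain C where C: "C > 0" "\<And>\<kappa>. \<kappa> \<ge> 1 \<Longrightarrow> \<kappa> powr (tau q j - \<epsilon> / 4) \<le> C * proj_sum q j \<kappa>"
      using proj_sum_tau[OF q, of "\<epsilon>/4" 1 j] \<epsilon> by auto
    obtain C' where C': "C' > 0" "\<And>\<kappa>. \<kappa> \<ge> 1 \<Longrightarrow> proj_sum q (\<not> j) \<kappa> \<le> C' * \<kappa> powr (tau q (\<not> j) + \<epsilon> / 4)"
      using proj_sum_tau[OF q, of "\<epsilon>/4" 1 "\<not> j"] \<epsilon> by auto
    have bound: "1 \<le> C * B * C' * \<kappa> powr (tau q (\<not> j) + \<epsilon> / 4 - (tau q j - \<epsilon> / 4))" if \<kappa>: "\<kappa> \<ge> 1" for \<kappa>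
    proof -
      have "\<kappa> powr (tau q j - \<epsilon> / 4) \<le> C * (B * (C' * \<kappa> powr (tau q (\<not> j) + \<epsilon> / 4)))"
        using C(1) B(1) C'(2)[OF \<kappa>] B(2)[of \<kappa>] \<kappa>
        by (intro order_trans[OF C(2)[OF \<kappa>]] mult_left_mono order_trans[OF B(2)]) auto
      then have "\<kappa> powr (tau q j - \<epsilon> / 4) / \<kappa> powr (tau q j - \<epsilon> / 4)
          \<le> C * (B * (C' * \<kappa> powr (tau q (\<not> j) + \<epsilon> / 4))) / \<kappa> powr (tau q j - \<epsilon> / 4)"
        by (rule divide_right_mono) simp
      then show ?thesis using \<kappa> unfolding powr_diff[of \<kappa> "tau q (\<not> j) + \<epsilon> / 4"] by (simp add: mult.assoc)
    qed
    have "((\<lambda>\<kappa>. C * B * C' * \<kappa> powr (tau q (\<not> j) + \<epsilon> / 4 - (tau q j - \<epsilon> / 4))) \<longlongrightarrow> C * B * C' * 0) at_top"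
      by (intro tendsto_mult tendsto_const tendsto_neg_powr[OF gt] filterlim_ident)
    moreover have "\<forall>\<^sub>F \<kappa> in at_top. 1 \<le> C * B * C' * \<kappa> powr (tau q (\<not> j) + \<epsilon> / 4 - (tau q j - \<epsilon> / 4))"
      using eventually_ge_at_top[of "1::real"] by eventually_elim (rule bound)
    ultimately have "1 \<le> C * B * C' * 0" by (rule tendsto_lowerbound) simp
    then show False by simp
  qed
  have "tau q j \<le> tau q (\<not> j)" for j by (rule field_le_epsilon) (rule le)
  from this[of j] this[of "\<not> j"] show ?thesis by simp
qed

section \<open>Meshes for the measure and its projections\<close>

definition proj :: "bool \<Rightarrow> real measure" where "proj j = distr \<mu> borel (cd j)"

lemma cd_measurable: "cd j \<in> \<mu> \<rightarrow>\<^sub>M borel"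
  using borel_measurable_cd borel by (metis measurable_cong_sets)

lemma measure_proj: "A \<in> sets borel \<Longrightarrow> measure (proj j) A = prob (cd j -` A)"
  unfolding proj_def using measure_distr[OF cd_measurable] borel sets_eq_imp_space_eq[OF borel] by simp

lemma cd_unit_square: "cd j ` unit_square = {0..1}"
proof
  show "cd j ` unit_square \<subseteq> {0..1}" unfolding mem_unit_square by (auto simp: mem_unit_square)
  show "{0..1} \<subseteq> cd j ` unit_square"
  proof
    fix x :: real assume "x \<in> {0..1}"
    then have "(x, x) \<in> unit_square" "cd j (x, x) = x" by (auto simp: mem_unit_square cd_def)
    then show "x \<in> cd j ` unit_square" by (metis imageI)
  qed
qed

lemma vimage_cd_sets: "A \<in> sets borel \<Longrightarrow> cd j -` A \<in> sets borel"
  using measurable_sets[OF borel_measurable_cd, of A] by simp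

lemma proj_cell_sum: "cell_sum (proj j) {0..1} q (\<lambda>x. \<lfloor>\<kappa> * x\<rfloor>) = proj_sum q j \<kappa>"
proof -
  have img: "(\<lambda>x. \<lfloor>\<kappa> * x\<rfloor>) ` {0..1} = floors j \<kappa>"
    unfolding cd_unit_square[of j, symmetric] by (simp add: image_image)
  have "measure (proj j) {x \<in> {0..1}. \<lfloor>\<kappa> * x\<rfloor> = c} = floor_mass j \<kappa> c" for c
  proof -
    have sets: "{x \<in> {0..1}. \<lfloor>\<kappa> * x\<rfloor> = c} \<in> sets borel" by measurable
    have "measure (proj j) {x \<in> {0..1}. \<lfloor>\<kappa> * x\<rfloor> = c} = prob (cd j -` {x \<in> {0..1}. \<lfloor>\<kappa> * x\<rfloor> = c} \<inter> unit_square)"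
      unfolding measure_proj[OF sets] by (rule prob_Int_unit_square[symmetric]) (rule vimage_cd_sets[OF sets])
    also have "cd j -` {x \<in> {0..1}. \<lfloor>\<kappa> * x\<rfloor> = c} \<inter> unit_square = {z \<in> unit_square. \<lfloor>\<kappa> * cd j z\<rfloor> = c}"
      using cd_unit_square[of j] by auto
    finally show ?thesis unfolding floor_mass_def .
  qed
  then show ?thesis unfolding cell_sum_def img proj_sum_eq by simp
qed

lemma proj_mesh:
  assumes "\<delta> > 0" shows "mesh (proj j) {0..1} (\<lambda>x. \<lfloor>(1 / \<delta>) * x\<rfloor>) 5 \<delta>"
proof (intro mesh.intro mesh_axioms.intro)
  show "prob_space (proj j)" unfolding proj_def by (rule prob_space_distr[OF cd_measurable])
  show "sets (proj j) = sets borel" unfolding proj_def by simp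
  show "measure (proj j) {0..1} = 1"
  proof -
    have "measure (proj j) {0..1} = prob (cd j -` {0..1} \<inter> unit_square)"
      by (subst measure_proj) (auto intro!: prob_Int_unit_square[symmetric] vimage_cd_sets)
    also have "cd j -` {0..1} \<inter> unit_square = unit_square" using cd_unit_square[of j] by auto
    finally show ?thesis using prob_unit_square by simp
  qed
  show "finite ((\<lambda>x. \<lfloor>(1 / \<delta>) * x\<rfloor>) ` {0..1})"
    using finite_floor[of "1 / \<delta>" j] unfolding cd_unit_square[of j, symmetric] image_image .
  show "{x \<in> {0..1}. \<lfloor>(1 / \<delta>) * x\<rfloor> = k} \<in> sets borel" for k by measurable
  show "dist x y \<le> \<delta>" if "\<lfloor>(1 / \<delta>) * x\<rfloor> = \<lfloor>(1 / \<delta>) * y\<rfloor>" for x y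
  proof -
    have "\<bar>(1 / \<delta>) * x - (1 / \<delta>) * y\<bar> < 1" using that by (rule abs_diff_less_if_floor_eq)
    then have "1 / \<delta> * \<bar>x - y\<bar> < 1" using assms by (subst (asm) abs_scaled_diff) auto
    then show ?thesis using assms by (simp add: dist_real_def)
  qed
  show "card ((\<lambda>x. \<lfloor>(1 / \<delta>) * x\<rfloor>) ` ({0..1} \<inter> cball x (2 * \<delta>))) \<le> 5" for x
  proof -
    have "card ((\<lambda>x. \<lfloor>(1 / \<delta>) * x\<rfloor>) ` ({0..1} \<inter> cball x (2 * \<delta>))) \<le> 4 + 1"
    proof (rule card_floor_image(2))
      fix y z assume "y \<in> {0..1} \<inter> cball x (2 * \<delta>)" "z \<in> {0..1} \<inter> cball x (2 * \<delta>)"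
      then have "\<bar>y - z\<bar> \<le> 4 * \<delta>" by (auto simp: dist_real_def)
      then have "1 / \<delta> * \<bar>y - z\<bar> \<le> 4" using assms by (simp add: field_simps)
      then show "\<bar>(1 / \<delta>) * y - (1 / \<delta>) * z\<bar> \<le> real 4" using assms by (subst abs_scaled_diff) auto
    qed
    then show ?thesis by simp
  qed
qed (use assms in auto)

lemma grid_mesh:
  assumes "\<delta> > 0" shows "mesh \<mu> unit_square (grid (2 / \<delta>)) 81 \<delta>"
proof (intro mesh.intro mesh_axioms.intro)
  show "dist x y \<le> \<delta>" if "grid (2 / \<delta>) x = grid (2 / \<delta>) y" for x y
  proof -
    have "\<bar>cd j (x - y)\<bar> \<le> \<delta> / 2" for j
    proof -
      have "\<lfloor>(2 / \<delta>) * cd j x\<rfloor> = \<lfloor>(2 / \<delta>) * cd j y\<rfloor>" using that unfolding grid_def by (cases j) auto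
      then have "\<bar>(2 / \<delta>) * cd j x - (2 / \<delta>) * cd j y\<bar> < 1" by (rule abs_diff_less_if_floor_eq)
      then have "2 / \<delta> * \<bar>cd j (x - y)\<bar> < 1"
        using assms by (subst (asm) abs_scaled_diff) (auto simp: cd_diff)
      then show ?thesis using assms by (simp add: field_simps)
    qed
    from this[of False] this[of True] norm_le_cd[of "x - y"] show ?thesis unfolding dist_norm by linarith
  qed
  show "card (grid (2 / \<delta>) ` (unit_square \<inter> cball x (2 * \<delta>))) \<le> 81" for x
  proof -
    let ?X = "unit_square \<inter> cball x (2 * \<delta>)"
    let ?f = "\<lambda>j. (\<lambda>z. \<lfloor>2 / \<delta> * cd j z\<rfloor>) ` ?X"
    have f: "finite (?f j) \<and> card (?f j) \<le> 8 + 1" for j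
    proof -
      have "\<bar>2 / \<delta> * cd j y - 2 / \<delta> * cd j z\<bar> \<le> real 8" if "y \<in> ?X" "z \<in> ?X" for y z
      proof -
        have "\<bar>cd j (y - z)\<bar> \<le> dist y z" unfolding dist_norm by (rule abs_cd_le_norm)
        also have "\<dots> \<le> dist x y + dist x z" by (rule dist_triangle3)
        also have "\<dots> \<le> 4 * \<delta>" using that by auto
        finally have "2 / \<delta> * \<bar>cd j (y - z)\<bar> \<le> 8" using assms by (simp add: field_simps)
        then show ?thesis using assms by (subst abs_scaled_diff) (auto simp: cd_diff)
      qed
      then show ?thesis using card_floor_image[of ?X "\<lambda>z. 2 / \<delta> * cd j z" 8] by blast
    qed
    have "card (grid (2 / \<delta>) ` ?X) \<le> card (?f False \<times> ?f True)"
      using f[of False] f[of True] by (intro card_mono) (auto simp: grid_def)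
    also have "\<dots> \<le> 9 * 9" unfolding card_cartesian_product using f[of False] f[of True] by (intro mult_mono) auto
    finally show ?thesis by simp
  qed
qed (use assms prob_space_axioms borel closed_unit_square prob_unit_square finite_grid grid_cell_sets in auto)

lemma grid_comparable:
  assumes q: "q \<ge> 0"
  shows "comparable (packing_sum \<mu> q) (\<lambda>\<delta>. ennreal (csum q (grid (2 / \<delta>))))"
    and "q \<le> 1 \<Longrightarrow> comparable (covering_sum \<mu> q) (\<lambda>\<delta>. ennreal (csum q (grid (2 / \<delta>))))"
    and "comparable (Lq_integral \<mu> q) (\<lambda>\<delta>. ennreal (csum q (grid (2 / \<delta>))))"
proof -
  obtain c s where c: "c > 0" and bound: "\<And>\<delta> A B. 0 < \<delta> \<Longrightarrow> \<delta> \<le> 1 \<Longrightarrow> A \<in> sets borel \<Longrightarrow> B \<in> sets borel \<Longrightarrow> 0 < prob A \<Longrightarrow>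
      (\<And>x y. x \<in> A \<Longrightarrow> dist x y \<le> \<delta> / 2 \<Longrightarrow> y \<in> B) \<Longrightarrow> c * \<delta> powr s \<le> prob B"
    using mass_lower_bound by blast
  have mass: "c * \<delta> powr s \<le> prob (cball x \<delta>)" if "0 < \<delta>" "\<delta> \<le> 1" "x \<in> measure_support \<mu>" for \<delta> x
  proof (rule bound[of \<delta> "ball x (\<delta> / 2)"])
    show "0 < prob (ball x (\<delta> / 2))"
      using that by (intro measure_support_ball_pos prob_space_axioms borel) auto
    show "z \<in> cball x \<delta>" if "y \<in> ball x (\<delta> / 2)" "dist y z \<le> \<delta> / 2" for y z
      using that dist_triangle[of x z y] by auto
  qed (use that in auto)
  show "comparable (packing_sum \<mu> q) (\<lambda>\<delta>. ennreal (csum q (grid (2 / \<delta>))))"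
    "q \<le> 1 \<Longrightarrow> comparable (covering_sum \<mu> q) (\<lambda>\<delta>. ennreal (csum q (grid (2 / \<delta>))))"
    "comparable (Lq_integral \<mu> q) (\<lambda>\<delta>. ennreal (csum q (grid (2 / \<delta>))))"
    by (rule mesh_family_comparable[OF grid_mesh q c mass]; assumption)+
qed

lemma Lq_spectrum_proj:
  assumes q: "q \<ge> 0"
  shows "Lq_spectrum (proj j) q = tau q j"
proof -
  obtain c s where c: "c > 0" and bound: "\<And>\<delta> A B. 0 < \<delta> \<Longrightarrow> \<delta> \<le> 1 \<Longrightarrow> A \<in> sets borel \<Longrightarrow> B \<in> sets borel \<Longrightarrow> 0 < prob A \<Longrightarrow>
      (\<And>x y. x \<in> A \<Longrightarrow> dist x y \<le> \<delta> / 2 \<Longrightarrow> y \<in> B) \<Longrightarrow> c * \<delta> powr s \<le> prob B"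
    using mass_lower_bound by blast
  have mass: "c * \<delta> powr s \<le> measure (proj j) (cball x \<delta>)"
    if \<delta>: "0 < \<delta>" "\<delta> \<le> 1" "x \<in> measure_support (proj j)" for \<delta> x
  proof -
    have "c * \<delta> powr s \<le> prob (cd j -` cball x \<delta>)"
    proof (rule bound[of \<delta> "cd j -` ball x (\<delta> / 2)"])
      have "0 < measure (proj j) (ball x (\<delta> / 2))"
        using \<delta> by (intro measure_support_ball_pos) (auto simp: proj_def intro: prob_space_distr[OF cd_measurable])
      then show "0 < prob (cd j -` ball x (\<delta> / 2))" by (simp add: measure_proj)
      show "z \<in> cd j -` cball x \<delta>" if "y \<in> cd j -` ball x (\<delta> / 2)" "dist y z \<le> \<delta> / 2" for y z
      proof -
        have "\<bar>x - cd j y\<bar> < \<delta> / 2" using that(1) by (simp add: dist_real_def)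
        moreover have "\<bar>cd j y - cd j z\<bar> \<le> dist y z"
          using abs_cd_le_norm[of j "y - z"] unfolding cd_diff dist_norm .
        ultimately have "\<bar>x - cd j z\<bar> \<le> \<delta>" using that(2) by linarith
        then show ?thesis by (simp add: dist_real_def)
      qed
    qed (use \<delta> vimage_cd_sets in auto)
    then show ?thesis by (simp add: measure_proj)
  qed
  have "comparable (Lq_integral (proj j) q) (\<lambda>\<delta>. ennreal (proj_sum q j (1 / \<delta>)))"
    using mesh_family_comparable(3)[OF proj_mesh q c mass] unfolding proj_cell_sum .
  moreover have "comparable (\<lambda>\<delta>. ennreal (proj_sum q j (1 / \<delta>))) (\<lambda>\<delta>. ennreal (\<delta> powr (- tau q j)))"
    unfolding comparable_def
  proof (intro conjI dominated_const)
    fix \<epsilon> :: real assume \<epsilon>: "\<epsilon> > 0"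
    obtain C where C: "C > 0" "\<And>\<kappa>. \<kappa> \<ge> 1 \<Longrightarrow> proj_sum q j \<kappa> \<le> C * \<kappa> powr (tau q j + \<epsilon>)"
      "\<And>\<kappa>. \<kappa> \<ge> 1 \<Longrightarrow> \<kappa> powr (tau q j - \<epsilon>) \<le> C * proj_sum q j \<kappa>"
      using proj_sum_tau[OF q \<epsilon>, of 1 j] by auto
    have "\<forall>\<^sub>F \<delta> in at_right 0. ennreal (proj_sum q j (1 / \<delta>)) \<le> ennreal (C * \<delta> powr - \<epsilon>) * ennreal (\<delta> powr - tau q j)"
      using eventually_at_right_0_less[of 1, OF zero_less_one]
    proof eventually_elim
      case (elim \<delta>)
      have "proj_sum q j (1 / \<delta>) \<le> C * (1 / \<delta>) powr (tau q j + \<epsilon>)" using elim by (intro C(2)) simp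
      also have "(1 / \<delta>) powr (tau q j + \<epsilon>) = \<delta> powr - \<epsilon> * \<delta> powr - tau q j"
        using elim by (simp add: powr_divide powr_add powr_minus_divide)
      finally show ?case
        by (subst ennreal_mult''[symmetric]) (auto intro!: ennreal_leI simp: mult.assoc)
    qed
    then show "\<exists>C. \<forall>\<^sub>F \<delta> in at_right 0. ennreal (proj_sum q j (1 / \<delta>)) \<le> ennreal (C * \<delta> powr - \<epsilon>) * ennreal (\<delta> powr - tau q j)"
      by blast
    have "\<forall>\<^sub>F \<delta> in at_right 0. ennreal (\<delta> powr - tau q j) \<le> ennreal (C * \<delta> powr - \<epsilon>) * ennreal (proj_sum q j (1 / \<delta>))"
      using eventually_at_right_0_less[of 1, OF zero_less_one]
    proof eventually_elim
      case (elim \<delta>)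
      have "\<delta> powr - tau q j = \<delta> powr - \<epsilon> * (1 / \<delta>) powr (tau q j - \<epsilon>)"
        using elim by (simp add: powr_divide powr_diff powr_minus_divide)
      also have "\<dots> \<le> \<delta> powr - \<epsilon> * (C * proj_sum q j (1 / \<delta>))"
        using elim by (intro mult_left_mono C(3)) auto
      finally show ?case
        using proj_sum_bounds(3)[OF q, of "1 / \<delta>" j] elim
        by (subst ennreal_mult''[symmetric]) (auto intro!: ennreal_leI simp: ac_simps)
    qed
    then show "\<exists>C. \<forall>\<^sub>F \<delta> in at_right 0. ennreal (\<delta> powr - tau q j) \<le> ennreal (C * \<delta> powr - \<epsilon>) * ennreal (proj_sum q j (1 / \<delta>))"
      by blast
  qed
  ultimately have "comparable (Lq_integral (proj j) q) (\<lambda>\<delta>. ennreal (\<delta> powr (- tau q j)))"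
    by (rule comparable_trans)
  then have "lower_Lq (proj j) q = ereal (tau q j)" "upper_Lq (proj j) q = ereal (tau q j)"
    unfolding lower_Lq_def upper_Lq_def using scaling_cong scaling_powr by auto
  then show ?thesis unfolding Lq_spectrum_def by auto
qed

section \<open>The modified singular value function\<close>

definition longer :: "'i list \<Rightarrow> bool" where
  "longer w \<longleftrightarrow> side w False < side w True"

definition tauw :: "real \<Rightarrow> 'i list \<Rightarrow> real" where
  "tauw q w = tau q (longer w \<noteq> swaps w)"

lemma side_longer: "side w (longer w) = long w" "side w (\<not> longer w) = short w"
  by (cases "side w False < side w True"; simp add: longer_def long_def short_def)+

lemma
  assumes w: "set w \<subseteq> I"
  shows base_length_word: "base_length (word_map S w) = side w False"
    and height_length_word: "height_length (word_map S w) = side w True"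
proof -
  have "Sup (cd j ` word_map S w ` unit_square) - Inf (cd j ` word_map S w ` unit_square) = side w j" for j
  proof -
    have "cd j ` word_map S w ` unit_square = (\<lambda>x. slope w j * x + shift w j) ` {0..1}"
      unfolding cd_unit_square[of "j \<noteq> swaps w", symmetric] image_image
      by (intro image_cong refl) (simp only: word_coords[OF w])
    then show ?thesis unfolding image_affinity_atLeastAtMost side_def by auto
  qed
  from this[of False] this[of True]
  show "base_length (word_map S w) = side w False" "height_length (word_map S w) = side w True"
    unfolding base_length_def height_length_def cd_simps[abs_def, symmetric]
    by (simp_all add: cd_def[abs_def])
qed

lemma horizontal_word:
  assumes w: "set w \<subseteq> I"
  shows "horizontal_to_horizontal (word_map S w) \<longleftrightarrow> \<not> swaps w"
proof
  have nz: "slope w j \<noteq> 0" for j using side_pos[OF w, of j] by (auto simp: side_def)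
  show "horizontal_to_horizontal (word_map S w)" if "\<not> swaps w"
    unfolding horizontal_to_horizontal_def
  proof
    fix y
    have f: "word_map S w (x, y) = (slope w False * x + shift w False, slope w True * y + shift w True)" for x
      using word_coords[OF w, of False "(x, y)"] word_coords[OF w, of True "(x, y)"] that
      by (intro prod_eqI) auto
    have "word_map S w ` (UNIV \<times> {y}) = UNIV \<times> {slope w True * y + shift w True}"
    proof
      show "UNIV \<times> {slope w True * y + shift w True} \<subseteq> word_map S w ` (UNIV \<times> {y})"
      proof
        fix v assume "v \<in> (UNIV :: real set) \<times> {slope w True * y + shift w True}"
        then have "v = word_map S w ((fst v - shift w False) / slope w False, y)"
          unfolding f using nz by (auto intro: prod_eqI)
        then show "v \<in> word_map S w ` (UNIV \<times> {y})" by blast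
      qed
    qed (auto simp: f)
    then show "\<exists>y'. word_map S w ` (UNIV \<times> {y}) = UNIV \<times> {y'}" by blast
  qed
  show "\<not> swaps w" if h: "horizontal_to_horizontal (word_map S w)"
  proof
    assume sw: "swaps w"
    obtain y' where y': "word_map S w ` (UNIV \<times> {0}) = UNIV \<times> {y'}"
      using h unfolding horizontal_to_horizontal_def by blast
    have "snd (word_map S w (x, 0)) = y'" for x :: real
    proof -
      have "word_map S w (x, 0) \<in> word_map S w ` (UNIV \<times> {0})" by auto
      then show ?thesis unfolding y' by auto
    qed
    moreover have "snd (word_map S w (x, 0)) = slope w True * x + shift w True" for x
      using word_coords[OF w, of True "(x, 0)"] sw by simp
    ultimately have "slope w True * 1 + shift w True = slope w True * 0 + shift w True" by metis
    then show False using nz by simp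
  qed
qed

lemma singular_values_word:
  assumes w: "set w \<subseteq> I"
  shows "singular_values (linear_part (word_map S w)) = {side w False, side w True}"
proof -
  define A where "A = linear_part (word_map S w)"
  have A: "cd j (A v) = slope w j * cd (j \<noteq> swaps w) v" for j v
    unfolding A_def linear_part_def cd_diff word_coords[OF w] by simp
  define B where "B v = (slope w (False \<noteq> swaps w) * cd (False \<noteq> swaps w) v,
      slope w (True \<noteq> swaps w) * cd (True \<noteq> swaps w) v)" for v
  have B: "cd j (B v) = slope w (j \<noteq> swaps w) * cd (j \<noteq> swaps w) v" for j v
    unfolding B_def by (cases j) auto
  have inner_cd: "x \<bullet> y = cd False x * cd False y + cd True x * cd True y" for x y
    by (simp add: inner_prod_def)
  have adj: "adjoint A = B"
    unfolding adjoint_def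
  proof (rule some_equality)
    show *: "\<forall>x y. A x \<bullet> y = x \<bullet> B y"
      unfolding inner_cd A B by (cases "swaps w") (auto simp: algebra_simps)
    show "C = B" if "\<forall>x y. A x \<bullet> y = x \<bullet> C y" for C
    proof
      fix y
      have "x \<bullet> C y = x \<bullet> B y" for x using that * by metis
      then have "x \<bullet> (C y - B y) = 0" for x by (simp only: inner_diff_right diff_self)
      from this[of "C y - B y"] show "C y = B y" by simp
    qed
  qed
  have AA: "cd j (adjoint A (A v)) = (side w (j \<noteq> swaps w))\<^sup>2 * cd j v" for j v
    unfolding adj B A side_def by (cases j; cases "swaps w") (auto simp: power2_eq_square)
  define r where "r j = side w (j \<noteq> swaps w)" for j
  have sv: "s \<in> singular_values A \<longleftrightarrow> s \<ge> 0 \<and> (\<exists>v j. cd j v \<noteq> 0 \<and>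
      (\<forall>j. ((r j)\<^sup>2 - s\<^sup>2) * cd j v = 0))" for s
  proof -
    have ne: "v \<noteq> 0 \<longleftrightarrow> (\<exists>j. cd j v \<noteq> 0)" for v using coords_eqI[of v 0] by auto
    have ev: "adjoint A (A v) = s\<^sup>2 *\<^sub>R v \<longleftrightarrow> (\<forall>j. ((r j)\<^sup>2 - s\<^sup>2) * cd j v = 0)" for v
    proof -
      have eq: "adjoint A (A v) = s\<^sup>2 *\<^sub>R v \<longleftrightarrow> (\<forall>j. cd j (adjoint A (A v)) = cd j (s\<^sup>2 *\<^sub>R v))"
        using coords_eqI by metis
      have sc: "cd j (s\<^sup>2 *\<^sub>R v) = s\<^sup>2 * cd j v" for j by (cases j) auto
      have aa: "cd j (adjoint A (A v)) = (r j)\<^sup>2 * cd j v" for j unfolding r_def by (rule AA)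
      have "(\<forall>j. cd j (adjoint A (A v)) = cd j (s\<^sup>2 *\<^sub>R v)) \<longleftrightarrow> (\<forall>j. ((r j)\<^sup>2 - s\<^sup>2) * cd j v = 0)"
        unfolding aa sc left_diff_distrib right_minus_eq ..
      then show ?thesis unfolding eq .
    qed
    show ?thesis unfolding singular_values_def mem_Collect_eq ne ev by (simp only: ex_simps(1))
  qed
  have "singular_values A = range (side w)"
  proof
    show "singular_values A \<subseteq> range (side w)"
    proof
      fix s assume "s \<in> singular_values A"
      then have "s \<ge> 0" and ex: "\<exists>v j. cd j v \<noteq> 0 \<and> (\<forall>j. ((r j)\<^sup>2 - s\<^sup>2) * cd j v = 0)"
        by (simp_all only: sv)
      obtain v j where vj: "cd j v \<noteq> 0 \<and> (\<forall>j. ((r j)\<^sup>2 - s\<^sup>2) * cd j v = 0)"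
        using ex by (elim exE) (rule that)
      then have "((r j)\<^sup>2 - s\<^sup>2) * cd j v = 0" by (elim conjE allE)
      then have "(r j)\<^sup>2 = s\<^sup>2" using conjunct1[OF vj] by simp
      then have "r j = s"
        by (rule power2_eq_imp_eq) (use \<open>s \<ge> 0\<close> in \<open>auto simp: r_def side_def\<close>)
      then show "s \<in> range (side w)" unfolding r_def by (rule range_eqI[OF sym])
    qed
    show "range (side w) \<subseteq> singular_values A"
    proof
      fix s assume "s \<in> range (side w)"
      then obtain j where j: "s = side w j" by blast
      define v :: "real \<times> real" where "v = (if j = swaps w then (1, 0) else (0, 1))"
      have "cd (j \<noteq> swaps w) v \<noteq> 0" unfolding v_def by (cases j; cases "swaps w") auto
      moreover have "((r j')\<^sup>2 - s\<^sup>2) * cd j' v = 0" for j'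
        unfolding v_def j r_def by (cases j; cases j'; cases "swaps w") auto
      moreover have "s \<ge> 0" unfolding j side_def by simp
      ultimately show "s \<in> singular_values A"
        unfolding sv by (intro conjI exI[of _ v] exI[of _ "j \<noteq> swaps w"] allI)
    qed
  qed
  then show ?thesis unfolding A_def by (auto simp: UNIV_bool)
qed

lemma alpha1_word: "set w \<subseteq> I \<Longrightarrow> alpha1 (word_map S w) = long w"
  and alpha2_word: "set w \<subseteq> I \<Longrightarrow> alpha2 (word_map S w) = short w"
  unfolding alpha1_def alpha2_def by (simp_all add: singular_values_word long_def short_def)

definition psiw :: "real \<Rightarrow> real \<Rightarrow> 'i list \<Rightarrow> real" where
  "psiw s q w = pr w powr q * long w powr tauw q w * short w powr (s - tauw q w)"

lemma psi_word:
  assumes w: "set w \<subseteq> I" and q: "q \<ge> 0"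
  shows "psi S p \<mu> s q w = psiw s q w"
proof -
  have "cd False = fst" "cd True = snd" by (auto simp: fun_eq_iff)
  then have L: "Lq_spectrum (distr \<mu> borel fst) q = tau q False" "Lq_spectrum (distr \<mu> borel snd) q = tau q True"
    using Lq_spectrum_proj[OF q, of False] Lq_spectrum_proj[OF q, of True] unfolding proj_def by auto
  have "tau_word \<mu> (word_map S w) q = tauw q w"
    unfolding tau_word_def L base_length_word[OF w] height_length_word[OF w] horizontal_word[OF w]
      tauw_def longer_def by (auto simp: Let_def)
  then show ?thesis
    by (simp add: psi_def psiw_def pr_def alpha1_word[OF w] alpha2_word[OF w] Let_def)
qed

lemma psiw_pos: "set w \<subseteq> I \<Longrightarrow> psiw s q w > 0"
  unfolding psiw_def using pr_pos[of w] long_pos[of w] short_pos[of w] by auto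

lemma psiw_pos_words: "w \<in> words I k \<Longrightarrow> psiw s q w > 0"
  by (rule psiw_pos) (auto simp: words_def)

lemma psiw_shift: "set w \<subseteq> I \<Longrightarrow> psiw (s + t) q w = psiw s q w * short w powr t"
  unfolding psiw_def using short_pos[of w] by (simp add: powr_add[symmetric] algebra_simps)

text \<open>
  \<open>side_fun s q j\<close> is multiplicative (with \<open>j\<close> transported along the word), and \<open>psiw\<close> is the
  larger or the smaller of its two versions, depending on the sign of \<open>\<tau>\<^sub>1(q) + \<tau>\<^sub>2(q) - s\<close>.
\<close>

definition side_fun :: "real \<Rightarrow> real \<Rightarrow> bool \<Rightarrow> 'i list \<Rightarrow> real" where
  "side_fun s q j w = pr w powr q * side w j powr tau q (j \<noteq> swaps w) * side w (\<not> j) powr (s - tau q (j \<noteq> swaps w))"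

lemma side_fun_nonneg: "side_fun s q j w \<ge> 0"
  unfolding side_fun_def by simp

lemma psiw_eq_side_fun: "psiw s q w = side_fun s q (longer w) w"
  unfolding psiw_def side_fun_def side_longer tauw_def ..

lemma side_fun_append:
  assumes w: "set w \<subseteq> I" "set v \<subseteq> I" and q: "q \<ge> 0"
  shows "side_fun s q j (w @ v) = side_fun s q j w * side_fun s q (j \<noteq> swaps w) v"
proof -
  have "tau q (j \<noteq> swaps w) = tau q (j \<noteq> swaps (w @ v))"
  proof (cases "swaps v")
    case True
    then obtain i where "i \<in> I" "sw i" using swaps_imp_sw[OF _ w(2)] by blast
    then have "tau q j' = tau q (\<not> j')" for j' by (rule tau_swap[OF q])
    then show ?thesis unfolding swaps_append by (cases j; cases "swaps w"; cases "swaps v") (auto; metis)+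
  qed (simp add: swaps_append)
  moreover have "((j \<noteq> swaps w) \<noteq> swaps v) = (j \<noteq> swaps (w @ v))" "(\<not> j) \<noteq> swaps w \<longleftrightarrow> (\<not> (j \<noteq> swaps w))"
    unfolding swaps_append by auto
  ultimately show ?thesis
    unfolding side_fun_def side_append pr_append
    using side_pos[OF w(1)] side_pos[OF w(2)] pr_pos[OF w(1)] pr_pos[OF w(2)]
    by (simp add: powr_mult less_imp_le)
qed

lemma side_fun_eq:
  assumes w: "set w \<subseteq> I"
  shows "side_fun s q (\<not> longer w) w = psiw s q w * (short w / long w) powr (tau q False + tau q True - s)"
proof -
  define t where "t = tauw q w"
  define t' where "t' = tau q (\<not> (longer w \<noteq> swaps w))"
  have tt: "tau q False + tau q True = t + t'" unfolding t_def t'_def tauw_def by (cases "longer w \<noteq> swaps w") auto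
  have n: "tau q ((\<not> longer w) \<noteq> swaps w) = t'" unfolding t'_def by (rule arg_cong) auto
  show ?thesis
    unfolding side_fun_def psiw_def tt n t_def[symmetric] not_not side_longer
    using short_pos[OF w] long_pos[OF w] by (simp add: powr_divide powr_diff powr_add field_simps)
qed

lemma side_fun_le_psiw:
  assumes w: "set w \<subseteq> I" and s: "s \<le> tau q False + tau q True"
  shows "side_fun s q j w \<le> psiw s q w"
proof (cases "j = longer w")
  case True
  then show ?thesis by (simp add: psiw_eq_side_fun)
next
  case False
  then have j: "j = (\<not> longer w)" by auto
  have "short w / long w \<le> 1" using short_le_side[of w True] side_le_long[of w True] long_pos[OF w] by simp
  then have "(short w / long w) powr (tau q False + tau q True - s) \<le> 1"
    using s short_pos[OF w] long_pos[OF w] by (intro powr_le1) auto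
  then show ?thesis unfolding j side_fun_eq[OF w] using psiw_pos[OF w, of s q] by simp
qed

lemma side_fun_ge_psiw:
  assumes w: "set w \<subseteq> I" and s: "s \<ge> tau q False + tau q True"
  shows "side_fun s q j w \<ge> psiw s q w"
proof (cases "j = longer w")
  case True
  then show ?thesis by (simp add: psiw_eq_side_fun)
next
  case False
  then have j: "j = (\<not> longer w)" by auto
  have "short w / long w \<le> 1" using short_le_side[of w True] side_le_long[of w True] long_pos[OF w] by simp
  then have "1 \<le> (short w / long w) powr (tau q False + tau q True - s)"
    using s short_pos[OF w] long_pos[OF w] powr_mono'[of "tau q False + tau q True - s" 0 "short w / long w"] by simp
  then show ?thesis unfolding j side_fun_eq[OF w] using psiw_pos[OF w, of s q] by simp
qed

lemma psiw_submult:
  assumes w: "set w \<subseteq> I" "set v \<subseteq> I" and q: "q \<ge> 0" and s: "s \<le> tau q False + tau q True"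
  shows "psiw s q (w @ v) \<le> psiw s q w * psiw s q v"
  unfolding psiw_eq_side_fun[of s q "w @ v"] side_fun_append[OF w q]
  using side_fun_le_psiw[OF w(1) s] side_fun_le_psiw[OF w(2) s] psiw_pos[OF w(1), of s q]
  by (intro mult_mono) (auto simp: side_fun_nonneg)

lemma psiw_supermult:
  assumes w: "set w \<subseteq> I" "set v \<subseteq> I" and q: "q \<ge> 0" and s: "s \<ge> tau q False + tau q True"
  shows "psiw s q w * psiw s q v \<le> psiw s q (w @ v)"
  unfolding psiw_eq_side_fun[of s q "w @ v"] side_fun_append[OF w q]
  using side_fun_ge_psiw[OF w(1) s] side_fun_ge_psiw[OF w(2) s] psiw_pos[OF w(2), of s q]
  by (intro mult_mono) (auto simp: side_fun_nonneg less_imp_le)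

section \<open>Pressure\<close>

definition Psi :: "real \<Rightarrow> real \<Rightarrow> nat \<Rightarrow> real" where
  "Psi s q k = (\<Sum>w\<in>words I k. psiw s q w)"

lemma Psi_sum_eq: "q \<ge> 0 \<Longrightarrow> Psi_sum I S p \<mu> s q k = Psi s q k"
  unfolding Psi_sum_def Psi_def words_def by (intro sum.cong refl psi_word) auto

lemma words_ne: "words I k \<noteq> {}"
proof -
  obtain i where "i \<in> I" using I_ne by blast
  then have "replicate k i \<in> words I k" by (auto simp: words_def)
  then show ?thesis by blast
qed

lemma Psi_pos: "Psi s q k > 0"
  unfolding Psi_def
proof (rule sum_pos)
  show "finite (words I k)" using finite_I by simp
qed (use words_ne psiw_pos in \<open>auto simp: words_def\<close>)

lemma Psi_submult:
  assumes q: "q \<ge> 0" and s: "s \<le> tau q False + tau q True"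
  shows "Psi s q (m + n) \<le> Psi s q m * Psi s q n"
  unfolding Psi_def sum_words_add sum_product
  by (intro sum_mono psiw_submult q s) (auto simp: words_def)

lemma Psi_supermult:
  assumes q: "q \<ge> 0" and s: "s \<ge> tau q False + tau q True"
  shows "Psi s q m * Psi s q n \<le> Psi s q (m + n)"
  unfolding Psi_def sum_words_add sum_product
  by (intro sum_mono psiw_supermult q s) (auto simp: words_def)

lemma ln_Psi_bound: "\<exists>c. \<forall>k. \<bar>ln (Psi s q k)\<bar> \<le> c * real k"
proof -
  define X where "X = \<bar>s\<bar> + \<bar>tau q False\<bar> + \<bar>tau q True\<bar>"
  define M where "M = \<bar>q\<bar> * \<bar>ln pmin\<bar> + 2 * X * \<bar>ln amin\<bar>"
  have pw: "\<bar>ln (psiw s q w)\<bar> \<le> M * real k" if w: "w \<in> words I k" for w k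
  proof -
    have wI: "set w \<subseteq> I" "length w = k" using w by (auto simp: words_def)
    have pr1: "pr w \<le> 1"
      unfolding pr_def using wI(1) p_bounds
      by (induction w arbitrary: k) (auto intro!: mult_le_one simp: less_imp_le pr_pos[unfolded pr_def])
    have "\<bar>ln (pr w)\<bar> \<le> real k * \<bar>ln pmin\<bar>"
      using pmin_power_le_pr[OF wI(1)] wI(2) pmin_pos pr1 by (intro abs_ln_le_power) auto
    then have 1: "\<bar>q * ln (pr w)\<bar> \<le> \<bar>q\<bar> * (real k * \<bar>ln pmin\<bar>)" by (simp add: abs_mult mult_left_mono)
    have side: "\<bar>ln (side w j)\<bar> \<le> real k * \<bar>ln amin\<bar>" for j
      using side_bounds[OF wI(1), of j] wI(2) amin_pos side_le_1[OF wI(1), of j] by (intro abs_ln_le_power) auto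
    have t: "\<bar>tauw q w\<bar> \<le> X" "\<bar>s - tauw q w\<bar> \<le> X"
      unfolding tauw_def X_def by (cases "longer w \<noteq> swaps w"; simp)+
    have 2: "\<bar>tauw q w * ln (long w)\<bar> \<le> X * (real k * \<bar>ln amin\<bar>)"
      "\<bar>(s - tauw q w) * ln (short w)\<bar> \<le> X * (real k * \<bar>ln amin\<bar>)"
      unfolding abs_mult using t side[of "longer w"] side[of "\<not> longer w"] unfolding side_longer
      by (auto intro!: mult_mono simp: X_def)
    have "ln (psiw s q w) = q * ln (pr w) + tauw q w * ln (long w) + (s - tauw q w) * ln (short w)"
      unfolding psiw_def using pr_pos[OF wI(1)] long_pos[OF wI(1)] short_pos[OF wI(1)]
      by (simp add: ln_mult ln_powr)
    then have "\<bar>ln (psiw s q w)\<bar> \<le> \<bar>q\<bar> * (real k * \<bar>ln pmin\<bar>) + X * (real k * \<bar>ln amin\<bar>) + X * (real k * \<bar>ln amin\<bar>)"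
      using 1 2 by linarith
    also have "\<dots> = M * real k" unfolding M_def by (simp add: algebra_simps)
    finally show ?thesis .
  qed
  have "\<bar>ln (Psi s q k)\<bar> \<le> (M + ln (real (card I))) * real k" for k
  proof -
    obtain w where w: "w \<in> words I k" using words_ne by blast
    have "psiw s q w \<le> Psi s q k"
      unfolding Psi_def using w finite_I by (intro member_le_sum) (auto intro: less_imp_le psiw_pos_words)
    then have "ln (psiw s q w) \<le> ln (Psi s q k)"
      using psiw_pos[of w s q] w Psi_pos by (subst ln_le_cancel_iff) (auto simp: words_def)
    then have low: "- (M * real k) \<le> ln (Psi s q k)" using pw[OF w] by linarith
    have "psiw s q v \<le> exp (M * real k)" if v: "v \<in> words I k" for v
    proof -
      have "psiw s q v = exp (ln (psiw s q v))" using psiw_pos[of v s q] v by (simp add: words_def)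
      also have "\<dots> \<le> exp (M * real k)" using pw[OF v] by simp
      finally show ?thesis .
    qed
    then have "Psi s q k \<le> real (card (words I k)) * exp (M * real k)"
      unfolding Psi_def by (rule sum_bounded_above)
    also have "card (words I k) = card I ^ k" unfolding words_def by (rule card_lists_length_eq[OF finite_I])
    finally have "ln (Psi s q k) \<le> ln (real (card I ^ k) * exp (M * real k))"
      using Psi_pos card_I by (subst ln_le_cancel_iff) auto
    also have "\<dots> = (M + ln (real (card I))) * real k"
      using card_I by (simp add: ln_mult ln_realpow algebra_simps)
    finally have up: "ln (Psi s q k) \<le> (M + ln (real (card I))) * real k" .
    have "0 \<le> ln (real (card I)) * real k" using card_I by simp
    then show ?thesis using low up by (simp add: distrib_right abs_le_iff)
  qed
  then show ?thesis by blast
qed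

definition log_pressure :: "real \<Rightarrow> real \<Rightarrow> real" where
  "log_pressure s q = lim (\<lambda>k. ln (Psi s q k) / real k)"

lemma
  assumes q: "q \<ge> 0"
  shows log_pressure: "(\<lambda>k. ln (Psi s q k) / real k) \<longlonglongrightarrow> log_pressure s q"
    and log_pressure_le: "s \<le> tau q False + tau q True \<Longrightarrow> k \<ge> 1 \<Longrightarrow> log_pressure s q * real k \<le> ln (Psi s q k)"
proof -
  obtain c where c: "\<And>k. \<bar>ln (Psi s q k)\<bar> \<le> c * real k" using ln_Psi_bound by blast
  have "\<exists>L. (\<lambda>k. ln (Psi s q k) / real k) \<longlonglongrightarrow> L \<and>
      (s \<le> tau q False + tau q True \<longrightarrow> (\<forall>k\<ge>1. L * real k \<le> ln (Psi s q k)))"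
  proof (cases "s \<le> tau q False + tau q True")
    case True
    obtain L where "(\<lambda>k. ln (Psi s q k) / real k) \<longlonglongrightarrow> L" "\<And>k. k \<ge> 1 \<Longrightarrow> L * real k \<le> ln (Psi s q k)"
    proof (rule fekete_subadditive[of "\<lambda>k. ln (Psi s q k)" "- c"])
      fix m n :: nat
      have "ln (Psi s q (m + n)) \<le> ln (Psi s q m * Psi s q n)"
        using Psi_submult[OF q True] Psi_pos by (subst ln_le_cancel_iff) auto
      then show "ln (Psi s q (m + n)) \<le> ln (Psi s q m) + ln (Psi s q n)"
        using Psi_pos[of s q m] Psi_pos[of s q n] by (simp add: ln_mult)
      show "- c * real n \<le> ln (Psi s q n)" using c[of n] by auto
    qed blast
    then show ?thesis by blast
  next
    case False
    obtain L where "(\<lambda>k. - ln (Psi s q k) / real k) \<longlonglongrightarrow> L"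
    proof (rule fekete_subadditive[of "\<lambda>k. - ln (Psi s q k)" "- c"])
      fix m n :: nat
      have "ln (Psi s q m * Psi s q n) \<le> ln (Psi s q (m + n))"
        using Psi_supermult[OF q, of s m n] False Psi_pos by (subst ln_le_cancel_iff) auto
      then show "- ln (Psi s q (m + n)) \<le> - ln (Psi s q m) + - ln (Psi s q n)"
        using Psi_pos[of s q m] Psi_pos[of s q n] by (simp add: ln_mult)
      show "- c * real n \<le> - ln (Psi s q n)" using c[of n] by auto
    qed blast
    from tendsto_minus[OF this] show ?thesis using False by auto
  qed
  then obtain L where L: "(\<lambda>k. ln (Psi s q k) / real k) \<longlonglongrightarrow> L"
    "s \<le> tau q False + tau q True \<Longrightarrow> k \<ge> 1 \<Longrightarrow> L * real k \<le> ln (Psi s q k)" for k by blast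
  have "log_pressure s q = L" unfolding log_pressure_def by (rule limI[OF L(1)])
  then show "(\<lambda>k. ln (Psi s q k) / real k) \<longlonglongrightarrow> log_pressure s q"
    "s \<le> tau q False + tau q True \<Longrightarrow> k \<ge> 1 \<Longrightarrow> log_pressure s q * real k \<le> ln (Psi s q k)" using L by auto
qed

lemma log_pressure_shift:
  assumes q: "q \<ge> 0" and t: "t \<ge> 0"
  shows "log_pressure s q + t * ln amin \<le> log_pressure (s + t) q"
    and "log_pressure (s + t) q \<le> log_pressure s q + t * ln amax"
proof -
  have b: "Psi s q k * amin powr (t * real k) \<le> Psi (s + t) q k" "Psi (s + t) q k \<le> Psi s q k * amax powr (t * real k)" for k
  proof -
    have "short w powr t \<le> amax powr (t * real k) \<and> amin powr (t * real k) \<le> short w powr t"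
      if "w \<in> words I k" for w
    proof -
      have w: "set w \<subseteq> I" "length w = k" using that by (auto simp: words_def)
      have "amin ^ k \<le> short w" using side_bounds[OF w(1)] short_cases[of w] w(2) by metis
      moreover have "short w \<le> amax ^ k" using short_le[OF w(1)] w(2) by simp
      moreover have "amax powr (t * real k) = (amax ^ k) powr t" "amin powr (t * real k) = (amin ^ k) powr t"
        using amax_pos amin_pos by (auto simp: powr_realpow[symmetric] powr_powr mult.commute)
      ultimately show ?thesis using t amin_pos short_pos[OF w(1)] by (auto intro!: powr_mono2)
    qed
    then show "Psi s q k * amin powr (t * real k) \<le> Psi (s + t) q k" "Psi (s + t) q k \<le> Psi s q k * amax powr (t * real k)"
      unfolding Psi_def sum_distrib_right
      by (auto intro!: sum_mono mult_left_mono simp: words_def psiw_shift psiw_pos less_imp_le)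
  qed
  have lnb: "(ln (Psi s q k)) / real k + t * ln amin \<le> ln (Psi (s + t) q k) / real k"
    "ln (Psi (s + t) q k) / real k \<le> ln (Psi s q k) / real k + t * ln amax" if "k \<ge> 1" for k
  proof -
    have "ln (Psi s q k * amin powr (t * real k)) \<le> ln (Psi (s + t) q k)"
      using b(1)[of k] Psi_pos amin_pos by (subst ln_le_cancel_iff) auto
    then have "ln (Psi s q k) + t * real k * ln amin \<le> ln (Psi (s + t) q k)"
      using Psi_pos[of s q k] amin_pos by (simp add: ln_mult ln_powr)
    then show "(ln (Psi s q k)) / real k + t * ln amin \<le> ln (Psi (s + t) q k) / real k"
      using that divide_right_mono[of "ln (Psi s q k) + t * real k * ln amin" _ "real k"]
      by (simp add: add_divide_distrib)
    have "ln (Psi (s + t) q k) \<le> ln (Psi s q k * amax powr (t * real k))"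
      using b(2)[of k] Psi_pos amax_pos by (subst ln_le_cancel_iff) auto
    then have "ln (Psi (s + t) q k) \<le> ln (Psi s q k) + t * real k * ln amax"
      using Psi_pos[of s q k] amax_pos by (simp add: ln_mult ln_powr)
    then show "ln (Psi (s + t) q k) / real k \<le> ln (Psi s q k) / real k + t * ln amax"
      using that divide_right_mono[of _ "ln (Psi s q k) + t * real k * ln amax" "real k"]
      by (simp add: add_divide_distrib)
  qed
  show "log_pressure s q + t * ln amin \<le> log_pressure (s + t) q"
    by (rule LIMSEQ_le[OF tendsto_add[OF log_pressure[OF q] tendsto_const] log_pressure[OF q]]) (use lnb in blast)
  show "log_pressure (s + t) q \<le> log_pressure s q + t * ln amax"
    by (rule LIMSEQ_le[OF log_pressure[OF q] tendsto_add[OF log_pressure[OF q] tendsto_const]]) (use lnb in blast)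
qed

lemma log_pressure_strict_anti:
  assumes q: "q \<ge> 0" and "s < s'" shows "log_pressure s' q < log_pressure s q"
proof -
  have "(s' - s) * ln amax < 0" using assms(2) amax_pos amax_less by (intro mult_pos_neg) auto
  then show ?thesis using log_pressure_shift(2)[OF q, of "s' - s" s] assms(2) by simp
qed

lemma log_pressure_zero:
  assumes q: "q \<ge> 0" shows "\<exists>s. log_pressure s q = 0"
proof -
  have lna: "ln amax < 0" using amax_pos amax_less by simp
  define h where "h = \<bar>log_pressure 0 q\<bar> / (- ln amax)"
  have h: "h \<ge> 0" "h * ln amax = - \<bar>log_pressure 0 q\<bar>" unfolding h_def using lna by (auto simp: field_simps)
  have hi: "log_pressure h q \<le> 0"
    using log_pressure_shift(2)[OF q h(1), of 0] abs_ge_self[of "log_pressure 0 q"] unfolding h(2) by simp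
  have lo: "log_pressure (-h) q \<ge> 0"
    using log_pressure_shift(2)[OF q h(1), of "-h"] abs_ge_minus_self[of "log_pressure 0 q"] unfolding h(2) by simp
  have cont: "continuous_on {-h..h} (\<lambda>s. log_pressure s q)"
  proof (rule continuous_on_subset[OF lipschitz_on_continuous_on])
    show "(- ln amin)-lipschitz_on UNIV (\<lambda>s. log_pressure s q)"
    proof (rule lipschitz_onI)
      have *: "\<bar>log_pressure x q - log_pressure y q\<bar> \<le> - ln amin * (y - x)" if "x \<le> y" for x y
      proof -
        have "(y - x) * ln amax \<le> 0" using that lna by (intro mult_nonneg_nonpos) auto
        then show ?thesis using log_pressure_shift[OF q, of "y - x" x] that by (simp add: algebra_simps)
      qed
      fix x y
      show "dist (log_pressure x q) (log_pressure y q) \<le> - ln amin * dist x y"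
        using *[of x y] *[of y x] by (cases "x \<le> y") (auto simp: dist_real_def abs_minus_commute)
    qed (use amin_pos amin_less in auto)
  qed auto
  show ?thesis using IVT2'[of "\<lambda>s. log_pressure s q" h 0 "-h"] hi lo h(1) cont by auto
qed

lemma pressure_eq: assumes q: "q \<ge> 0" shows "pressure I S p \<mu> s q = exp (log_pressure s q)"
  unfolding pressure_def
proof (rule limI)
  have "(\<lambda>k. exp (ln (Psi s q k) / real k)) \<longlonglongrightarrow> exp (log_pressure s q)"
    by (intro tendsto_exp log_pressure q)
  moreover have "Psi_sum I S p \<mu> s q k powr (1 / real k) = exp (ln (Psi s q k) / real k)" for k
    using Psi_pos[of s q k] by (simp add: Psi_sum_eq[OF q] powr_def)
  ultimately show "(\<lambda>k. Psi_sum I S p \<mu> s q k powr (1 / real k)) \<longlonglongrightarrow> exp (log_pressure s q)" by simp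
qed

lemma log_pressure_moment_scaling:
  assumes q: "q \<ge> 0" shows "log_pressure (moment_scaling I S p \<mu> q) q = 0"
proof -
  obtain s0 where s0: "log_pressure s0 q = 0" using log_pressure_zero[OF q] by blast
  have "moment_scaling I S p \<mu> q = s0"
    unfolding moment_scaling_def pressure_eq[OF q]
  proof (rule the_equality)
    fix s assume "exp (log_pressure s q) = 1"
    then have "log_pressure s q = 0" by simp
    then show "s = s0" using log_pressure_strict_anti[OF q, of s s0] log_pressure_strict_anti[OF q, of s0 s] s0
      by (cases s s0 rule: linorder_cases) auto
  qed (simp add: s0)
  then show ?thesis using s0 by simp
qed

lemma log_pressure_sign:
  assumes q: "q \<ge> 0"
  shows "s > moment_scaling I S p \<mu> q \<Longrightarrow> log_pressure s q < 0"
    and "s < moment_scaling I S p \<mu> q \<Longrightarrow> log_pressure s q > 0"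
  using log_pressure_strict_anti[OF q] log_pressure_moment_scaling[OF q] by metis+

lemma sum_psiw_bounded:
  assumes q: "q \<ge> 0" and neg: "log_pressure s q < 0"
  shows "\<exists>C>0. \<forall>W. finite W \<longrightarrow> (\<forall>w\<in>W. set w \<subseteq> I) \<longrightarrow> (\<Sum>w\<in>W. psiw s q w) \<le> C"
proof -
  define l where "l = log_pressure s q"
  obtain K where K: "K \<ge> 0" "\<And>k. \<bar>ln (Psi s q k) - l * real k\<bar> \<le> (- l / 2) * real k + K"
    using ex_bound_if_tendsto[OF log_pressure[OF q], of "- l / 2" s] neg unfolding l_def by auto
  define r where "r = exp (l / 2)"
  have r: "0 < r" "r < 1" unfolding r_def using neg unfolding l_def by auto
  have P: "Psi s q k \<le> exp K * r ^ k" for k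
  proof -
    have "ln (Psi s q k) \<le> K + real k * (l / 2)" using K(2)[of k] by (simp add: algebra_simps)
    then have "exp (ln (Psi s q k)) \<le> exp (K + real k * (l / 2))" by simp
    then show ?thesis using Psi_pos[of s q k] unfolding r_def exp_add exp_of_nat_mult by simp
  qed
  have "(\<Sum>w\<in>W. psiw s q w) \<le> exp K * (1 / (1 - r))" if W: "finite W" "\<forall>w\<in>W. set w \<subseteq> I" for W
  proof -
    define N where "N = Suc (Max (insert 0 (length ` W)))"
    have len: "length w < N" if "w \<in> W" for w
      unfolding N_def using that W by (auto simp: less_Suc_eq_le intro!: Max_ge)
    have "W \<subseteq> (\<Union>k<N. words I k)" using W len by (auto simp: words_def)
    then have "(\<Sum>w\<in>W. psiw s q w) \<le> (\<Sum>w\<in>(\<Union>k<N. words I k). psiw s q w)"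
      using finite_I by (intro sum_mono2) (auto intro: less_imp_le psiw_pos_words)
    also have "\<dots> = (\<Sum>k<N. Psi s q k)"
      unfolding Psi_def
    proof (rule sum.UNION_disjoint)
      show "\<forall>k\<in>{..<N}. finite (words I k)" using finite_I by simp
    qed (auto simp: words_def)
    also have "\<dots> \<le> (\<Sum>k<N. exp K * r ^ k)" by (intro sum_mono P)
    also have "\<dots> = exp K * (\<Sum>k<N. r ^ k)" by (simp add: sum_distrib_left)
    also have "\<dots> \<le> exp K * (\<Sum>k. r ^ k)"
      using r by (intro mult_left_mono sum_le_suminf summable_geometric) auto
    also have "(\<Sum>k. r ^ k) = 1 / (1 - r)" using r by (intro suminf_geometric) auto
    finally show ?thesis .
  qed
  moreover have "exp K * (1 / (1 - r)) > 0" using r by simp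
  ultimately show ?thesis by blast
qed

lemma sum_psiw_cut_ge_1:
  assumes q: "q \<ge> 0" and pos: "log_pressure s q > 0"
  shows "\<exists>k\<ge>1. \<forall>stop N. stopping I stop k N \<longrightarrow> 1 \<le> (\<Sum>w\<in>cut I stop. psiw s q w)"
proof (cases "s \<le> tau q False + tau q True")
  case True
  have "1 \<le> (\<Sum>w\<in>cut I stop. psiw s q w)" if st: "stopping I stop 1 N" for stop N
  proof (rule ccontr)
    assume less: "\<not> 1 \<le> (\<Sum>w\<in>cut I stop. psiw s q w)"
    interpret stopping I stop 1 N by fact
    have nonempty: "length w \<ge> 1" if "w \<in> cut I stop" for w
    proof (rule ccontr)
      assume "\<not> length w \<ge> 1"
      then have "[] \<in> cut I stop" using that by (cases w) auto
      moreover have "w = []" if "w \<in> cut I stop" for w using cut_incomparable[OF \<open>[] \<in> cut I stop\<close> that] by auto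
      ultimately have "cut I stop = {[]}" by auto
      then show False using less by (simp add: psiw_def short_def long_def)
    qed
    have rec: "Psi s q n \<le> (\<Sum>w\<in>cut I stop. psiw s q w * Psi s q (n - length w))" if n: "n \<ge> N" for n
    proof -
      define F where "F w = (\<Sum>v\<in>words I (n - length w). psiw s q (w @ v))" for w
      have "F [] \<le> (\<Sum>w\<in>cut I stop. F w)"
      proof (rule sum_cut_ge)
        fix w assume w: "set w \<subseteq> I" "length w < N * 1"
        then have l: "n - length w = 1 + (n - length w - 1)" using n by auto
        have "F w = (\<Sum>i\<in>I. \<Sum>v\<in>words I (n - length w - 1). psiw s q (w @ [i] @ v))"
          unfolding F_def by (subst l, subst sum_words_add, subst sum_words_1) simp
        also have "\<dots> = (\<Sum>v\<in>words I 1. F (w @ v))" unfolding sum_words_1 F_def by simp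
        finally show "F w \<le> (\<Sum>v\<in>words I 1. F (w @ v))" by simp
      qed
      also have "\<dots> \<le> (\<Sum>w\<in>cut I stop. psiw s q w * Psi s q (n - length w))"
        unfolding F_def Psi_def sum_distrib_left
        by (intro sum_mono psiw_submult[OF _ _ q True]) (auto simp: cut_def words_def)
      finally show ?thesis by (simp add: F_def Psi_def)
    qed
    define K where "K = (\<Sum>n\<le>N. Psi s q n)"
    have bounded: "Psi s q n \<le> K" for n
    proof (induction n rule: less_induct)
      case (less n)
      show ?case
      proof (cases "n < N")
        case True
        then show ?thesis unfolding K_def using Psi_pos by (intro member_le_sum) (auto simp: less_imp_le)
      next
        case False
        show ?thesis
        proof (cases "n = 0")
          case True
          then show ?thesis unfolding K_def using Psi_pos by (intro member_le_sum) (auto simp: less_imp_le)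
        next
          case n0: False
          have K0: "K \<ge> 0" unfolding K_def using Psi_pos by (intro sum_nonneg) (auto simp: less_imp_le)
          have "Psi s q n \<le> (\<Sum>w\<in>cut I stop. psiw s q w * Psi s q (n - length w))"
            using False by (intro rec) auto
          also have "\<dots> \<le> (\<Sum>w\<in>cut I stop. psiw s q w * K)"
          proof (intro sum_mono mult_left_mono)
            fix w assume w: "w \<in> cut I stop"
            then show "Psi s q (n - length w) \<le> K" using nonempty[OF w] n0 by (intro less) auto
            show "0 \<le> psiw s q w" using w psiw_pos[of w s q] by (auto simp: cut_def)
          qed
          also have "\<dots> = (\<Sum>w\<in>cut I stop. psiw s q w) * K" by (simp add: sum_distrib_right)
          also have "\<dots> \<le> 1 * K" using \<open>\<not> 1 \<le> _\<close> K0 by (intro mult_right_mono) auto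
          finally show ?thesis by simp
        qed
      qed
    qed
    have "log_pressure s q * real n \<le> \<bar>ln K\<bar>" if "n \<ge> 1" for n
    proof -
      have "log_pressure s q * real n \<le> ln (Psi s q n)" by (rule log_pressure_le[OF q True that])
      also have "\<dots> \<le> ln K" using bounded[of n] Psi_pos[of s q n] by (subst ln_le_cancel_iff) auto
      finally show ?thesis by simp
    qed
    note bound = this
    obtain n :: nat where "\<bar>ln K\<bar> / log_pressure s q < real n" using reals_Archimedean2 by blast
    then have "\<bar>ln K\<bar> < log_pressure s q * real (n + 1)" using pos by (simp add: field_simps)
    with bound[of "n + 1"] show False by simp
  qed
  then show ?thesis by blast
next
  case False
  then have s: "s \<ge> tau q False + tau q True" by simp
  have "\<forall>\<^sub>F k in sequentially. 0 < ln (Psi s q k) / real k"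
    using order_tendstoD(1)[OF log_pressure[OF q] pos] .
  from eventually_happens[OF eventually_conj[OF this eventually_ge_at_top[of 1]]]
  obtain k where k: "k \<ge> 1" "0 < ln (Psi s q k) / real k" by auto
  then have "ln (Psi s q k) > 0" by (simp add: zero_less_divide_iff)
  then have Psi1: "Psi s q k \<ge> 1" using Psi_pos[of s q k] by (simp add: ln_gt_zero_iff less_imp_le)
  have "1 \<le> (\<Sum>w\<in>cut I stop. psiw s q w)" if "stopping I stop k N" for stop N
  proof -
    interpret stopping I stop k N by fact
    have "psiw s q [] \<le> (\<Sum>w\<in>cut I stop. psiw s q w)"
    proof (rule sum_cut_ge)
      fix u assume u: "set u \<subseteq> I"
      have "psiw s q u * 1 \<le> psiw s q u * Psi s q k"
        using Psi1 psiw_pos[OF u, of s q] by (intro mult_left_mono) auto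
      also have "\<dots> \<le> (\<Sum>v\<in>words I k. psiw s q (u @ v))"
        unfolding Psi_def sum_distrib_left using u
        by (intro sum_mono psiw_supermult[OF _ _ q s]) (auto simp: words_def)
      finally show "psiw s q u \<le> (\<Sum>v\<in>words I k. psiw s q (u @ v))" by simp
    qed
    then show ?thesis by (simp add: psiw_def short_def long_def)
  qed
  then show ?thesis using k(1) by blast
qed

section \<open>Partition sums in the plane\<close>

definition short_stop :: "nat \<Rightarrow> real \<Rightarrow> 'i list \<Rightarrow> bool" where
  "short_stop k \<kappa> w \<longleftrightarrow> k dvd length w \<and> \<kappa> * short w \<le> 2"

abbreviation "short_cut k \<kappa> \<equiv> cut I (short_stop k \<kappa>)"

abbreviation "word_grid \<kappa> w \<equiv> (\<lambda>z. grid \<kappa> (word_map S w z))"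

lemma stopping_short:
  assumes "\<kappa> > 0" "k \<ge> 1"
  obtains N where "stopping I (short_stop k \<kappa>) k N"
proof -
  obtain N where N: "amax ^ N \<le> 2 / \<kappa>" using ex_power_le[of "2 / \<kappa>"] assms by auto
  have "stopping I (short_stop k \<kappa>) k N"
  proof unfold_locales
    fix w assume w: "set w \<subseteq> I" "length w = N * k"
    have "short w \<le> amax ^ (N * k)" using short_le[OF w(1)] w(2) by simp
    also have "\<dots> \<le> amax ^ N" using amax_pos amax_less assms by (intro power_decreasing) auto
    finally have "short w \<le> 2 / \<kappa>" using N by simp
    then show "short_stop k \<kappa> w" unfolding short_stop_def using assms w by (simp add: field_simps)
  qed (use assms in \<open>auto simp: finite_I short_stop_def\<close>)
  then show thesis by (rule that)
qed

lemma short_cut_bounds: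
  assumes "\<kappa> \<ge> 2" "k \<ge> 1" "w \<in> short_cut k \<kappa>"
  shows "set w \<subseteq> I" "\<kappa> * short w \<le> 2" "2 * amin ^ k \<le> \<kappa> * short w"
proof -
  show wI: "set w \<subseteq> I" and "\<kappa> * short w \<le> 2"
    using assms unfolding cut_def short_stop_def by auto
  show "2 * amin ^ k \<le> \<kappa> * short w"
  proof (cases "w = []")
    case True
    have "2 * amin ^ k \<le> 2 * 1" using amin_pos amin_less by (intro mult_left_mono power_le_one) auto
    then show ?thesis using True assms(1) by (simp add: short_def)
  next
    case False
    have dvd: "k dvd length w" using assms unfolding cut_def short_stop_def by auto
    then have len: "k \<le> length w" using False by (intro dvd_imp_le) auto
    define v where "v = take (length w - k) w"
    define x where "x = drop (length w - k) w"
    have wvx: "w = v @ x" "length x = k" "length v = length w - k" unfolding v_def x_def using len by auto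
    have "\<not> short_stop k \<kappa> v"
      using assms(2,3) len False unfolding cut_def v_def by (auto dest!: spec[of _ "length w - k"])
    then have "2 < \<kappa> * short v" unfolding short_stop_def using dvd wvx(3) len by auto
    then have "2 * amin ^ k \<le> \<kappa> * short v * amin ^ k" using amin_pos by (intro mult_right_mono) auto
    also have "\<dots> \<le> \<kappa> * short w"
      using short_append_ge[of v x] wI wvx assms(1) unfolding wvx(1) mult.assoc by (intro mult_left_mono) auto
    finally show ?thesis .
  qed
qed

lemma word_grid_compare:
  assumes w: "set w \<subseteq> I" and short: "\<kappa> * short w \<le> 2" and \<kappa>: "\<kappa> > 0" and q: "q \<ge> 0"
  shows "csum q (word_grid \<kappa> w) \<le> 6 powr q * 6 * proj_sum q (longer w \<noteq> swaps w) (\<kappa> * long w)"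
    and "proj_sum q (longer w \<noteq> swaps w) (\<kappa> * long w) \<le> 6 powr q * 6 * csum q (word_grid \<kappa> w)"
proof -
  define J where "J = longer w"
  define \<sigma> where "\<sigma> = (J \<noteq> swaps w)"
  define h where "h = (\<lambda>z. \<lfloor>\<kappa> * long w * cd \<sigma> z\<rfloor>)"
  define g where "g = word_grid \<kappa> w"
  have dif: "\<bar>\<kappa> * cd j (word_map S w x) - \<kappa> * cd j (word_map S w y)\<bar> = \<kappa> * side w j * \<bar>cd (j \<noteq> swaps w) x - cd (j \<noteq> swaps w) y\<bar>" for j x y
  proof -
    have "\<bar>cd j (word_map S w x) - cd j (word_map S w y)\<bar> = side w j * \<bar>cd (j \<noteq> swaps w) x - cd (j \<noteq> swaps w) y\<bar>"
      unfolding word_coords[OF w] side_def by (simp add: abs_mult flip: right_diff_distrib)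
    then show ?thesis using \<kappa> by (simp add: abs_scaled_diff mult.assoc)
  qed
  have hd: "\<bar>\<kappa> * long w * cd \<sigma> x - \<kappa> * long w * cd \<sigma> y\<bar> = \<bar>\<kappa> * cd J (word_map S w x) - \<kappa> * cd J (word_map S w y)\<bar>" for x y
    unfolding dif unfolding J_def side_longer \<sigma>_def using \<kappa> long_pos[OF w] by (intro abs_scaled_diff) simp
  have sd: "\<bar>\<kappa> * cd (\<not> J) (word_map S w x) - \<kappa> * cd (\<not> J) (word_map S w y)\<bar> \<le> 2"
    if "x \<in> unit_square" "y \<in> unit_square" for x y
  proof -
    have "\<kappa> * short w * \<bar>cd ((\<not> J) \<noteq> swaps w) x - cd ((\<not> J) \<noteq> swaps w) y\<bar> \<le> 2 * 1"
      using short abs_cd_diff_le_1[OF that] by (intro mult_mono) auto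
    then show ?thesis unfolding dif unfolding J_def side_longer by simp
  qed
  have g_cases: "g z = (if J then (\<lfloor>\<kappa> * cd (\<not> J) (word_map S w z)\<rfloor>, \<lfloor>\<kappa> * cd J (word_map S w z)\<rfloor>)
      else (\<lfloor>\<kappa> * cd J (word_map S w z)\<rfloor>, \<lfloor>\<kappa> * cd (\<not> J) (word_map S w z)\<rfloor>))" for z
    unfolding g_def grid_def by (cases J) auto
  have fin: "finite (g ` unit_square)" "finite (h ` unit_square)"
    unfolding g_def h_def
    using finite_subset[OF image_word_subset[OF w] finite_grid] finite_floor by auto
  have meas_h: "{z \<in> unit_square. h z = k} \<in> events" for k
    unfolding borel h_def by (rule floor_cell_sets) measurable
  have meas_g: "{z \<in> unit_square. g z = k} \<in> events" for k
  proof -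
    have "{z \<in> unit_square. g z = k} = unit_square \<inter> word_map S w -` {z \<in> unit_square. grid \<kappa> z = k}"
      unfolding g_def using word_map_unit_square[OF w] by auto
    then show ?thesis unfolding borel
      using vimage_word_map_sets[OF w grid_cell_sets] unit_square_sets by auto
  qed
  have c1: "card (g ` {y \<in> unit_square. h y = h x}) \<le> 6" for x
  proof -
    let ?X = "{y \<in> unit_square. h y = h x}"
    let ?F = "\<lambda>j. (\<lambda>z. \<lfloor>\<kappa> * cd j (word_map S w z)\<rfloor>) ` ?X"
    have J: "finite (?F J)" "card (?F J) \<le> 1 + 1"
    proof -
      have "\<bar>\<kappa> * cd J (word_map S w y) - \<kappa> * cd J (word_map S w z)\<bar> \<le> 1" if "y \<in> ?X" "z \<in> ?X" for y z
      proof -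
        have "\<lfloor>\<kappa> * long w * cd \<sigma> y\<rfloor> = \<lfloor>\<kappa> * long w * cd \<sigma> z\<rfloor>" using that unfolding h_def by auto
        from abs_diff_less_if_floor_eq[OF this] show ?thesis unfolding hd by simp
      qed
      then show "finite (?F J)" "card (?F J) \<le> 1 + 1"
        using card_floor_image[of ?X "\<lambda>z. \<kappa> * cd J (word_map S w z)" 1] by auto
    qed
    have nJ: "finite (?F (\<not> J))" "card (?F (\<not> J)) \<le> 2 + 1"
      using card_floor_image[of ?X "\<lambda>z. \<kappa> * cd (\<not> J) (word_map S w z)" 2] sd by auto
    have "card (g ` ?X) \<le> card ((\<lambda>(a, b). if J then (b, a) else (a, b)) ` (?F J \<times> ?F (\<not> J)))"
      using J nJ by (intro card_mono) (auto simp: g_cases)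
    also have "\<dots> \<le> card (?F J \<times> ?F (\<not> J))" using J nJ by (intro card_image_le) auto
    also have "\<dots> \<le> 2 * 3" unfolding card_cartesian_product using J nJ by (intro mult_mono) auto
    finally show ?thesis by simp
  qed
  have c2: "card (h ` {y \<in> unit_square. g y = g x}) \<le> 6" for x
  proof -
    have "card (h ` {y \<in> unit_square. g y = g x}) \<le> 1 + 1"
      unfolding h_def
    proof (rule card_floor_image(2))
      fix y z assume "y \<in> {y \<in> unit_square. g y = g x}" "z \<in> {y \<in> unit_square. g y = g x}"
      then have "g y = g z" by auto
      then have "\<lfloor>\<kappa> * cd J (word_map S w y)\<rfloor> = \<lfloor>\<kappa> * cd J (word_map S w z)\<rfloor>"
        unfolding g_cases by (cases J) auto
      from abs_diff_less_if_floor_eq[OF this]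
      show "\<bar>\<kappa> * long w * cd \<sigma> y - \<kappa> * long w * cd \<sigma> z\<bar> \<le> real 1" unfolding hd by simp
    qed
    then show ?thesis by simp
  qed
  have ph: "proj_sum q (longer w \<noteq> swaps w) (\<kappa> * long w) = csum q h"
    unfolding proj_sum_def h_def \<sigma>_def J_def ..
  show "csum q (word_grid \<kappa> w) \<le> 6 powr q * 6 * proj_sum q (longer w \<noteq> swaps w) (\<kappa> * long w)"
    unfolding ph g_def[symmetric]
    using cell_sum_compare[OF finite_measure_axioms fin(1) fin(2) meas_h c2 c1 q] by simp
  show "proj_sum q (longer w \<noteq> swaps w) (\<kappa> * long w) \<le> 6 powr q * 6 * csum q (word_grid \<kappa> w)"
    unfolding ph g_def[symmetric]
    using cell_sum_compare[OF finite_measure_axioms fin(2) fin(1) meas_g c1 c2 q] by simp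
qed

definition cut_sum :: "real \<Rightarrow> nat \<Rightarrow> real \<Rightarrow> real" where
  "cut_sum q k \<kappa> = (\<Sum>w\<in>short_cut k \<kappa>. pr w powr q * csum q (word_grid \<kappa> w))"

lemma inverse_short_powr:
  assumes "\<kappa> \<ge> 2" "k \<ge> 1" "w \<in> short_cut k \<kappa>" "\<bar>x\<bar> \<le> X"
  shows "(1 / \<kappa>) powr x \<le> (2 / amin ^ k) powr X * short w powr x"
    and "short w powr x \<le> (2 / amin ^ k) powr X * (1 / \<kappa>) powr x"
proof -
  note b = short_cut_bounds[OF assms(1-3)]
  define L where "L = 2 / amin ^ k"
  have ak: "0 < amin ^ k" "amin ^ k \<le> 1" using amin_pos amin_less by (auto intro: power_le_one)
  have L: "L \<ge> 2" unfolding L_def using ak by (simp add: field_simps)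
  have sp: "short w > 0" by (rule short_pos[OF b(1)])
  have 1: "1 / \<kappa> \<le> L * short w"
  proof -
    have "1 / \<kappa> \<le> short w / (2 * amin ^ k)" using b(3) assms(1) ak by (simp add: field_simps)
    also have "\<dots> \<le> L * short w" unfolding L_def using ak sp by (simp add: field_simps)
    finally show ?thesis .
  qed
  have "short w \<le> 2 * (1 / \<kappa>)" using b(2) assms(1) by (simp add: field_simps)
  also have "\<dots> \<le> L * (1 / \<kappa>)" using L assms(1) by (intro mult_right_mono) auto
  finally have 2: "short w \<le> L * (1 / \<kappa>)" .
  have LX: "L powr \<bar>x\<bar> \<le> L powr X" using L assms(4) by (intro powr_mono) auto
  have "(1 / \<kappa>) powr x \<le> L powr \<bar>x\<bar> * short w powr x" "short w powr x \<le> L powr \<bar>x\<bar> * (1 / \<kappa>) powr x"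
    using 1 2 sp assms(1) by (auto intro!: powr_comparable)
  then show "(1 / \<kappa>) powr x \<le> (2 / amin ^ k) powr X * short w powr x"
    "short w powr x \<le> (2 / amin ^ k) powr X * (1 / \<kappa>) powr x"
    unfolding L_def[symmetric] using mult_right_mono[OF LX, of "short w powr x"] mult_right_mono[OF LX, of "(1 / \<kappa>) powr x"]
    by (auto intro: order_trans)
qed

lemma abs_diff_tauw: "\<bar>s - tauw q w\<bar> \<le> \<bar>s\<bar> + \<bar>tau q False\<bar> + \<bar>tau q True\<bar>"
  unfolding tauw_def by (cases "longer w \<noteq> swaps w"; simp)

lemma cut_sum_upper:
  assumes q: "q \<ge> 0" and s: "s > moment_scaling I S p \<mu> q" and k: "k \<ge> 1"
  shows "\<exists>C>0. \<forall>\<kappa>\<ge>2. cut_sum q k \<kappa> \<le> C * \<kappa> powr s"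
proof -
  define \<epsilon> where "\<epsilon> = (s - moment_scaling I S p \<mu> q) / 2"
  define s' where "s' = s - \<epsilon>"
  have \<epsilon>: "\<epsilon> > 0" and s': "s' > moment_scaling I S p \<mu> q" unfolding s'_def \<epsilon>_def using s by (auto simp: field_simps)
  obtain C1 where C1: "C1 > 0" "\<And>W. finite W \<Longrightarrow> \<forall>w\<in>W. set w \<subseteq> I \<Longrightarrow> (\<Sum>w\<in>W. psiw s' q w) \<le> C1"
    using sum_psiw_bounded[OF q log_pressure_sign(1)[OF q s']] by blast
  define \<kappa>0 where "\<kappa>0 = 2 * amin ^ k"
  have \<kappa>0: "\<kappa>0 > 0" unfolding \<kappa>0_def using amin_pos by simp
  obtain C2 where C2: "C2 > 0" "\<And>j \<kappa>. \<kappa> \<ge> \<kappa>0 \<Longrightarrow> proj_sum q j \<kappa> \<le> C2 * \<kappa> powr (tau q j + \<epsilon>)"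
    using proj_sum_tau_uniform[OF q \<epsilon> \<kappa>0] by metis
  define X where "X = \<bar>s'\<bar> + \<bar>tau q False\<bar> + \<bar>tau q True\<bar>"
  define L where "L = (2 / amin ^ k) powr X"
  define D where "D = 6 powr q * 6 * C2 * L"
  have L: "L > 0" unfolding L_def using amin_pos by simp
  have D: "D > 0" unfolding D_def using C2 L by simp
  have "cut_sum q k \<kappa> \<le> D * C1 * \<kappa> powr s" if \<kappa>: "\<kappa> \<ge> 2" for \<kappa>
  proof -
    have \<kappa>pos: "\<kappa> > 0" using \<kappa> by simp
    obtain N where "stopping I (short_stop k \<kappa>) k N" using stopping_short[OF \<kappa>pos k] .
    then interpret stopping I "short_stop k \<kappa>" k N .
    have "pr w powr q * csum q (word_grid \<kappa> w) \<le> D * \<kappa> powr s * psiw s' q w" if w: "w \<in> short_cut k \<kappa>" for w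
    proof -
      note b = short_cut_bounds[OF \<kappa> k w]
      have lp: "long w > 0" by (rule long_pos[OF b(1)])
      have ge: "\<kappa> * long w \<ge> \<kappa>0"
      proof -
        have "\<kappa> * short w \<le> \<kappa> * long w"
          using short_le_side[of w True] side_le_long[of w True] \<kappa>pos by (intro mult_left_mono) auto
        then show ?thesis using b(3) unfolding \<kappa>0_def by simp
      qed
      have "csum q (word_grid \<kappa> w) \<le> 6 powr q * 6 * proj_sum q (longer w \<noteq> swaps w) (\<kappa> * long w)"
        by (rule word_grid_compare(1)[OF b(1,2) \<kappa>pos q])
      also have "\<dots> \<le> 6 powr q * 6 * (C2 * (\<kappa> * long w) powr (tauw q w + \<epsilon>))"
        unfolding tauw_def by (intro mult_left_mono C2(2) ge) auto
      also have "(\<kappa> * long w) powr (tauw q w + \<epsilon>) = \<kappa> powr s * (1 / \<kappa>) powr (s' - tauw q w) * (long w powr tauw q w * long w powr \<epsilon>)"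
        using \<kappa>pos lp unfolding s'_def by (simp add: powr_mult powr_add powr_divide powr_diff field_simps)
      also have "\<dots> \<le> \<kappa> powr s * (L * short w powr (s' - tauw q w)) * (long w powr tauw q w * 1)"
      proof (intro mult_mono)
        show "(1 / \<kappa>) powr (s' - tauw q w) \<le> L * short w powr (s' - tauw q w)"
          unfolding L_def X_def by (rule inverse_short_powr(1)[OF \<kappa> k w abs_diff_tauw])
        show "long w powr \<epsilon> \<le> 1" using long_le_1[OF b(1)] lp \<epsilon> by (intro powr_le1) auto
      qed (use L in auto)
      finally have "csum q (word_grid \<kappa> w) \<le> D * \<kappa> powr s * (long w powr tauw q w * short w powr (s' - tauw q w))"
        using C2(1) unfolding D_def by (simp add: ac_simps)
      then have "pr w powr q * csum q (word_grid \<kappa> w)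
          \<le> pr w powr q * (D * \<kappa> powr s * (long w powr tauw q w * short w powr (s' - tauw q w)))"
        by (intro mult_left_mono) auto
      then show ?thesis unfolding psiw_def by (simp add: ac_simps)
    qed
    then have "cut_sum q k \<kappa> \<le> (\<Sum>w\<in>short_cut k \<kappa>. D * \<kappa> powr s * psiw s' q w)"
      unfolding cut_sum_def by (rule sum_mono)
    also have "\<dots> = D * \<kappa> powr s * (\<Sum>w\<in>short_cut k \<kappa>. psiw s' q w)" by (simp add: sum_distrib_left)
    also have "\<dots> \<le> D * \<kappa> powr s * C1"
      using D finite_cut by (intro mult_left_mono C1(2)) (auto simp: cut_def)
    finally show ?thesis by (simp add: ac_simps)
  qed
  moreover have "D * C1 > 0" using D C1 by simp
  ultimately show ?thesis by blast
qed

lemma cut_sum_lower: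
  assumes q: "q \<ge> 0" and s: "s < moment_scaling I S p \<mu> q"
  shows "\<exists>k\<ge>1. \<exists>C>0. \<forall>\<kappa>\<ge>2. \<kappa> powr s \<le> C * cut_sum q k \<kappa>"
proof -
  define \<epsilon> where "\<epsilon> = (moment_scaling I S p \<mu> q - s) / 2"
  define s' where "s' = s + \<epsilon>"
  have \<epsilon>: "\<epsilon> > 0" and s': "s' < moment_scaling I S p \<mu> q" unfolding s'_def \<epsilon>_def using s by (auto simp: field_simps)
  obtain k where k: "k \<ge> 1" and cut1: "\<And>stop N. stopping I stop k N \<Longrightarrow> 1 \<le> (\<Sum>w\<in>cut I stop. psiw s' q w)"
    using sum_psiw_cut_ge_1[OF q log_pressure_sign(2)[OF q s']] by blast
  define \<kappa>0 where "\<kappa>0 = 2 * amin ^ k"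
  have \<kappa>0: "\<kappa>0 > 0" unfolding \<kappa>0_def using amin_pos by simp
  obtain C2 where C2: "C2 > 0" "\<And>j \<kappa>. \<kappa> \<ge> \<kappa>0 \<Longrightarrow> \<kappa> powr (tau q j - \<epsilon>) \<le> C2 * proj_sum q j \<kappa>"
    using proj_sum_tau_uniform[OF q \<epsilon> \<kappa>0] by metis
  define X where "X = \<bar>s'\<bar> + \<bar>tau q False\<bar> + \<bar>tau q True\<bar>"
  define L where "L = (2 / amin ^ k) powr X"
  define D where "D = 6 powr q * 6 * C2 * L"
  have L: "L > 0" unfolding L_def using amin_pos by simp
  have D: "D > 0" unfolding D_def using C2 L by simp
  have "\<kappa> powr s \<le> D * cut_sum q k \<kappa>" if \<kappa>: "\<kappa> \<ge> 2" for \<kappa>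
  proof -
    have \<kappa>pos: "\<kappa> > 0" using \<kappa> by simp
    obtain N where st: "stopping I (short_stop k \<kappa>) k N" using stopping_short[OF \<kappa>pos k] .
    have bound: "\<kappa> powr s * psiw s' q w \<le> D * (pr w powr q * csum q (word_grid \<kappa> w))" if w: "w \<in> short_cut k \<kappa>" for w
    proof -
      note b = short_cut_bounds[OF \<kappa> k w]
      have lp: "long w > 0" by (rule long_pos[OF b(1)])
      have ge: "\<kappa> * long w \<ge> \<kappa>0"
      proof -
        have "\<kappa> * short w \<le> \<kappa> * long w"
          using short_le_side[of w True] side_le_long[of w True] \<kappa>pos by (intro mult_left_mono) auto
        then show ?thesis using b(3) unfolding \<kappa>0_def by simp
      qed
      have long1: "1 \<le> long w powr - \<epsilon>"
        using long_le_1[OF b(1)] lp \<epsilon> powr_mono'[of "- \<epsilon>" 0 "long w"] by simp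
      have "\<kappa> powr s * (long w powr tauw q w * 1 * short w powr (s' - tauw q w))
          \<le> \<kappa> powr s * (long w powr tauw q w * long w powr - \<epsilon> * (L * (1 / \<kappa>) powr (s' - tauw q w)))"
        unfolding L_def X_def
        using long1 inverse_short_powr(2)[OF \<kappa> k w abs_diff_tauw]
        by (intro mult_left_mono mult_mono) auto
      also have "\<dots> = L * (\<kappa> * long w) powr (tauw q w - \<epsilon>)"
        using \<kappa>pos lp unfolding s'_def
        by (simp add: powr_mult powr_add powr_divide powr_diff powr_minus field_simps)
      also have "\<dots> \<le> L * (C2 * proj_sum q (longer w \<noteq> swaps w) (\<kappa> * long w))"
        using L unfolding tauw_def by (intro mult_left_mono C2(2) ge) auto
      also have "\<dots> \<le> L * (C2 * (6 powr q * 6 * csum q (word_grid \<kappa> w)))"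
        using L C2(1) by (intro mult_left_mono word_grid_compare(2)[OF b(1,2) \<kappa>pos q]) auto
      finally have "\<kappa> powr s * (long w powr tauw q w * short w powr (s' - tauw q w)) \<le> D * csum q (word_grid \<kappa> w)"
        unfolding D_def by (simp add: ac_simps)
      then have "pr w powr q * (\<kappa> powr s * (long w powr tauw q w * short w powr (s' - tauw q w)))
          \<le> pr w powr q * (D * csum q (word_grid \<kappa> w))"
        by (intro mult_left_mono) auto
      then show ?thesis unfolding psiw_def by (simp add: ac_simps)
    qed
    have "\<kappa> powr s * 1 \<le> \<kappa> powr s * (\<Sum>w\<in>short_cut k \<kappa>. psiw s' q w)"
      by (intro mult_left_mono cut1[OF st]) auto
    also have "\<dots> \<le> (\<Sum>w\<in>short_cut k \<kappa>. D * (pr w powr q * csum q (word_grid \<kappa> w)))"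
      unfolding sum_distrib_left by (intro sum_mono bound)
    finally show ?thesis unfolding cut_sum_def by (simp add: sum_distrib_left)
  qed
  with k D show ?thesis by blast
qed

lemma grid_mass_cut:
  assumes "stopping I stop k N"
  shows "prob {z \<in> unit_square. grid \<kappa> z = c} = (\<Sum>w\<in>cut I stop. pr w * prob {z \<in> unit_square. word_grid \<kappa> w z = c})"
  by (rule prob_cell_cut[OF assms grid_cell_sets])

lemma cut_sum_swap:
  assumes k: "k \<ge> 1" and \<kappa>: "\<kappa> > 0"
  shows "cut_sum q k \<kappa> = (\<Sum>c\<in>grid \<kappa> ` unit_square. \<Sum>w\<in>short_cut k \<kappa>.
    (pr w * prob {z \<in> unit_square. word_grid \<kappa> w z = c}) powr q)"
proof -
  have eq: "csum q (word_grid \<kappa> w) = (\<Sum>c\<in>grid \<kappa> ` unit_square. prob {z \<in> unit_square. word_grid \<kappa> w z = c} powr q)"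
    if "w \<in> short_cut k \<kappa>" for w
    using that by (intro cell_sum_superset finite_grid image_word_subset) (auto simp: cut_def)
  have "cut_sum q k \<kappa> = (\<Sum>w\<in>short_cut k \<kappa>. \<Sum>c\<in>grid \<kappa> ` unit_square.
      (pr w * prob {z \<in> unit_square. word_grid \<kappa> w z = c}) powr q)"
    unfolding cut_sum_def
  proof (intro sum.cong refl)
    fix w assume w: "w \<in> short_cut k \<kappa>"
    have "pr w \<ge> 0" using pr_pos[of w] w by (auto simp: cut_def)
    then show "pr w powr q * csum q (word_grid \<kappa> w)
        = (\<Sum>c\<in>grid \<kappa> ` unit_square. (pr w * prob {z \<in> unit_square. word_grid \<kappa> w z = c}) powr q)"
      unfolding eq[OF w] sum_distrib_left by (simp add: powr_mult)
  qed
  then show ?thesis by (simp add: sum.swap[of _ "short_cut k \<kappa>"])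
qed

lemma pr_prob_nonneg: "w \<in> cut I stop \<Longrightarrow> 0 \<le> pr w * prob A"
  using pr_pos[of w] by (auto simp: cut_def)

lemma grid_le_cut_sum:
  assumes q: "0 \<le> q" "q \<le> 1" and k: "k \<ge> 1" and \<kappa>: "\<kappa> > 0"
  shows "csum q (grid \<kappa>) \<le> cut_sum q k \<kappa>"
proof -
  obtain N where st: "stopping I (short_stop k \<kappa>) k N" using stopping_short[OF \<kappa> k] .
  show ?thesis
    unfolding cut_sum_swap[OF k \<kappa>] unfolding cell_sum_def grid_mass_cut[OF st]
    using stopping.finite_cut[OF st] pr_prob_nonneg q by (intro sum_mono powr_sum_le_sum_powr) auto
qed

lemma cut_sum_le_grid:
  assumes q: "q \<ge> 1" and k: "k \<ge> 1" and \<kappa>: "\<kappa> > 0"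
  shows "cut_sum q k \<kappa> \<le> csum q (grid \<kappa>)"
proof -
  obtain N where st: "stopping I (short_stop k \<kappa>) k N" using stopping_short[OF \<kappa> k] .
  show ?thesis
    unfolding cut_sum_swap[OF k \<kappa>] unfolding cell_sum_def grid_mass_cut[OF st]
    using stopping.finite_cut[OF st] pr_prob_nonneg q by (intro sum_mono sum_powr_le_powr_sum) auto
qed

section \<open>The rectangular open set condition\<close>

lemma word_images_disjoint:
  assumes R: "\<And>i. i \<in> I \<Longrightarrow> S i ` R \<subseteq> R" "disjoint_family_on (\<lambda>i. S i ` R) I"
    and "set w \<subseteq> I" "set w' \<subseteq> I" "x \<in> R" "x' \<in> R" "word_map S w x = word_map S w' x'"
  shows "(\<exists>v. w' = w @ v) \<or> (\<exists>v. w = w' @ v)"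
  using assms(3-)
proof (induction w arbitrary: w')
  case (Cons i w)
  show ?case
  proof (cases w')
    case (Cons i' v')
    have y: "word_map S w x \<in> R" "word_map S v' x' \<in> R"
      using Cons.prems R(1) unfolding Cons by (auto intro: word_map_invariant)
    have eq: "S i (word_map S w x) = S i' (word_map S v' x')" using Cons.prems(5) unfolding Cons by simp
    have "i = i'"
    proof (rule ccontr)
      assume "i \<noteq> i'"
      then have "S i ` R \<inter> S i' ` R = {}"
        using R(2) Cons.prems(1,2) unfolding Cons disjoint_family_on_def by auto
      then show False using y eq by (metis IntI empty_iff imageI)
    qed
    moreover have "inj (S i)" using inj_word_map[of "[i]"] Cons.prems(1) by simp
    ultimately have "word_map S w x = word_map S v' x'" using eq by (auto dest: injD)
    then show ?thesis using Cons.IH[of v'] Cons.prems \<open>i = i'\<close> unfolding Cons by auto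
  qed simp
qed simp

lemma ROSC_bounded_overlap:
  assumes "ROSC I S" and k: "k \<ge> 1"
  shows "\<exists>M. \<forall>\<kappa>\<ge>2. \<forall>c. card {w \<in> short_cut k \<kappa>. prob {z \<in> unit_square. word_grid \<kappa> w z = c} \<noteq> 0} \<le> M"
proof -
  obtain a b c d where abcd: "a < b" "c < d"
    and inv: "\<And>i. i \<in> I \<Longrightarrow> S i ` ({a<..<b} \<times> {c<..<d}) \<subseteq> {a<..<b} \<times> {c<..<d}"
    and dis: "disjoint_family_on (\<lambda>i. S i ` ({a<..<b} \<times> {c<..<d})) I"
    using assms(1) unfolding ROSC_def by (elim exE conjE) (rule that; simp)
  define lo where "lo j = (if j then c else a)" for j
  define hi where "hi j = (if j then d else b)" for j
  define R where "R = {z. \<forall>j. lo j < cd j z \<and> cd j z < hi j}"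
  define K where "K = {a..b} \<times> {c..d}"
  have R: "R = {a<..<b} \<times> {c<..<d}" unfolding R_def lo_def hi_def by (auto simp: all_bool_eq)
  have K: "z \<in> K \<longleftrightarrow> (\<forall>j. lo j \<le> cd j z \<and> cd j z \<le> hi j)" for z
    unfolding K_def lo_def hi_def by (cases z) (auto simp: all_bool_eq)
  have closR: "closure R = K" unfolding R K_def using abcd by (simp add: closure_Times)
  have invR: "S i ` R \<subseteq> R" if "i \<in> I" for i using inv[OF that] unfolding R .
  have disR: "disjoint_family_on (\<lambda>i. S i ` R) I" using dis unfolding R .
  have "prob K = 1"
  proof (rule prob_compact_invariant)
    show "compact K" "K \<noteq> {}" unfolding K_def using abcd by (auto intro: compact_Times)
    fix i assume i: "i \<in> I"
    have "continuous_on (closure R) (S i)"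
      using continuous_word_map[of "[i]"] i by (auto intro: continuous_on_subset)
    then have "S i ` closure R \<subseteq> closure R"
      by (rule image_closure_subset) (use invR[OF i] closure_subset in auto)
    then show "S i ` K \<subseteq> K" unfolding closR .
  qed
  then have AE_K: "AE z in \<mu>. z \<in> K"
    unfolding K_def using borel by (intro AE_prob_1) (auto intro: borel_closed closed_Times)
  define \<rho> where "\<rho> = min (b - a) (d - c)"
  have \<rho>: "\<rho> > 0" "\<rho> \<le> hi j - lo j" for j unfolding \<rho>_def lo_def hi_def using abcd by auto
  define \<theta> where "\<theta> = min 1 (2 * amin ^ k * \<rho> / 3)"
  have \<theta>: "\<theta> > 0" "\<theta> \<le> 1" "3 * \<theta> \<le> 2 * amin ^ k * \<rho>" unfolding \<theta>_def using amin_pos \<rho> by auto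
  define Q where "Q m = {\<lfloor>(real_of_int m - 1) / \<theta>\<rfloor>..\<lfloor>(real_of_int m - 1) / \<theta>\<rfloor> + \<lceil>3 / \<theta>\<rceil> + 1}" for m :: int
  define M where "M = nat (\<lceil>3 / \<theta>\<rceil> + 2) * nat (\<lceil>3 / \<theta>\<rceil> + 2)"
  have "card {w \<in> short_cut k \<kappa>. prob {z \<in> unit_square. word_grid \<kappa> w z = m} \<noteq> 0} \<le> M"
    if \<kappa>: "\<kappa> \<ge> 2" for \<kappa> m
  proof -
    have \<kappa>pos: "\<kappa> > 0" using \<kappa> by simp
    obtain N where "stopping I (short_stop k \<kappa>) k N" using stopping_short[OF \<kappa>pos k] .
    then interpret stopping I "short_stop k \<kappa>" k N .
    let ?W = "{w \<in> short_cut k \<kappa>. prob {z \<in> unit_square. word_grid \<kappa> w z = m} \<noteq> 0}"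
    define mm where "mm j = (if j then snd m else fst m)" for j
    define lattice where "lattice w n x \<longleftrightarrow>
      x \<in> R \<and> (\<forall>j. \<kappa> * cd j (word_map S w x) = real_of_int (n j) * \<theta> \<and> n j \<in> Q (mm j))" for w n x
    have "\<exists>n x. lattice w n x" if w: "w \<in> ?W" for w
    proof -
      have wc: "w \<in> short_cut k \<kappa>" using w by auto
      note bd = short_cut_bounds[OF \<kappa> k wc]
      have "\<exists>z\<in>K. word_grid \<kappa> w z = m"
      proof (rule ccontr)
        assume no: "\<not> (\<exists>z\<in>K. word_grid \<kappa> w z = m)"
        have "prob {z \<in> unit_square. word_grid \<kappa> w z = m} = prob {}"
        proof (rule finite_measure_eq_AE)
          show "AE z in \<mu>. z \<in> {z \<in> unit_square. word_grid \<kappa> w z = m} \<longleftrightarrow> z \<in> {}"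
            using AE_K by eventually_elim (use no in auto)
          have "{z \<in> unit_square. word_grid \<kappa> w z = m} = unit_square \<inter> word_map S w -` {z \<in> unit_square. grid \<kappa> z = m}"
            using word_map_unit_square[OF bd(1)] by auto
          then show "{z \<in> unit_square. word_grid \<kappa> w z = m} \<in> events"
            unfolding borel using vimage_word_map_sets[OF bd(1) grid_cell_sets] unit_square_sets by auto
        qed simp
        then show False using w by simp
      qed
      then obtain z where z: "z \<in> K" "word_grid \<kappa> w z = m" by blast
      have "\<exists>t n. lo (j \<noteq> swaps w) < t \<and> t < hi (j \<noteq> swaps w) \<and>
          \<kappa> * (slope w j * t + shift w j) = real_of_int n * \<theta> \<and> n \<in> Q (mm j)" for j
      proof -
        define y where "y = \<kappa> * slope w j * cd (j \<noteq> swaps w) z + \<kappa> * shift w j"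
        have yeq: "y = \<kappa> * cd j (word_map S w z)"
          unfolding y_def word_coords[OF bd(1)] by (simp add: algebra_simps)
        have "2 * amin ^ k * \<rho> \<le> \<kappa> * short w * \<rho>" using bd(3) \<rho>(1) by (intro mult_right_mono) auto
        with \<theta>(3) have "3 * \<theta> \<le> \<kappa> * short w * \<rho>" by linarith
        also have "\<dots> \<le> \<kappa> * side w j * (hi (j \<noteq> swaps w) - lo (j \<noteq> swaps w))"
          using \<rho> short_le_side[of w j] short_pos[OF bd(1)] \<kappa>pos by (intro mult_mono) auto
        also have "\<kappa> * side w j = \<bar>\<kappa> * slope w j\<bar>" unfolding side_def using \<kappa>pos by (simp add: abs_mult)
        finally have len: "3 * \<theta> \<le> \<bar>\<kappa> * slope w j\<bar> * (hi (j \<noteq> swaps w) - lo (j \<noteq> swaps w))" .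
        have nz: "\<kappa> * slope w j \<noteq> 0" using side_pos[OF bd(1), of j] \<kappa>pos unfolding side_def by auto
        have zK: "lo (j \<noteq> swaps w) \<le> cd (j \<noteq> swaps w) z" "cd (j \<noteq> swaps w) z \<le> hi (j \<noteq> swaps w)"
          using z(1) unfolding K by blast+
        obtain t n where tn: "lo (j \<noteq> swaps w) < t" "t < hi (j \<noteq> swaps w)"
          "\<kappa> * slope w j * t + \<kappa> * shift w j = real_of_int n * \<theta>" "\<bar>real_of_int n * \<theta> - y\<bar> \<le> \<theta>"
          using ex_lattice_point[OF nz \<theta>(1) zK len, of "\<kappa> * shift w j"] unfolding y_def by blast
        have "\<lfloor>y\<rfloor> = mm j" using z(2) unfolding yeq grid_def mm_def by (cases j) auto
        then have "mm j \<le> y" "y < mm j + 1" by linarith+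
        then have "real_of_int (mm j) - 1 \<le> real_of_int n * \<theta>" "real_of_int n * \<theta> \<le> (real_of_int (mm j) - 1) + 3"
          using tn(4) \<theta>(2) by linarith+
        then have "(real_of_int (mm j) - 1) / \<theta> \<le> real_of_int n" "real_of_int n \<le> (real_of_int (mm j) - 1) / \<theta> + 3 / \<theta>"
          using \<theta>(1) by (auto simp: field_simps)
        then have "n \<in> Q (mm j)" unfolding Q_def by (simp, linarith)
        then show ?thesis using tn by (intro exI[of _ t] exI[of _ n]) (auto simp: algebra_simps)
      qed
      then obtain t n where tn: "\<And>j. lo (j \<noteq> swaps w) < t j" "\<And>j. t j < hi (j \<noteq> swaps w)"
        "\<And>j. \<kappa> * (slope w j * t j + shift w j) = real_of_int (n j) * \<theta>" "\<And>j. n j \<in> Q (mm j)"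
        by metis
      define x where "x = (t (False \<noteq> swaps w), t (True \<noteq> swaps w))"
      have x: "cd j x = t (j \<noteq> swaps w)" for j unfolding x_def by (cases j) auto
      have x': "cd (j \<noteq> swaps w) x = t j" for j unfolding x by (rule arg_cong[where f = t]) auto
      have "x \<in> R" unfolding R_def mem_Collect_eq
      proof
        fix j
        have "lo ((j \<noteq> swaps w) \<noteq> swaps w) < t (j \<noteq> swaps w)" "t (j \<noteq> swaps w) < hi ((j \<noteq> swaps w) \<noteq> swaps w)"
          by (rule tn)+
        moreover have "((j \<noteq> swaps w) \<noteq> swaps w) = j" by auto
        ultimately show "lo j < cd j x \<and> cd j x < hi j" unfolding x by simp
      qed
      moreover have "\<kappa> * cd j (word_map S w x) = real_of_int (n j) * \<theta>" for j
        unfolding word_coords[OF bd(1)] x' by (rule tn)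
      ultimately show ?thesis unfolding lattice_def using tn(4) by blast
    qed
    then have "\<forall>w\<in>?W. \<exists>n x. lattice w n x" by (rule ballI)
    then obtain n where "\<forall>w\<in>?W. \<exists>x. lattice w (n w) x" by (rule bchoice[THEN exE])
    then obtain x where lat: "\<forall>w\<in>?W. lattice w (n w) (x w)" by (rule bchoice[THEN exE])
    have nx: "x w \<in> R" "\<kappa> * cd j (word_map S w (x w)) = real_of_int (n w j) * \<theta>" "n w j \<in> Q (mm j)"
      if "w \<in> ?W" for w j
      using bspec[OF lat that] unfolding lattice_def by blast+
    have inj: "inj_on (\<lambda>w. (n w False, n w True)) ?W"
    proof (rule inj_onI)
      fix w w' assume w: "w \<in> ?W" "w' \<in> ?W" and "(n w False, n w True) = (n w' False, n w' True)"
      then have n: "n w j = n w' j" for j by (cases j) auto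
      have "word_map S w (x w) = word_map S w' (x w')"
      proof (rule coords_eqI)
        fix j
        have "\<kappa> * cd j (word_map S w (x w)) = \<kappa> * cd j (word_map S w' (x w'))"
          unfolding nx(2)[OF w(1)] nx(2)[OF w(2)] n ..
        then show "cd j (word_map S w (x w)) = cd j (word_map S w' (x w'))" using \<kappa>pos by simp
      qed
      moreover have "set w \<subseteq> I" "set w' \<subseteq> I" using w by (auto simp: cut_def)
      ultimately have "(\<exists>v. w' = w @ v) \<or> (\<exists>v. w = w' @ v)"
        using nx(1)[OF w(1)] nx(1)[OF w(2)] by (intro word_images_disjoint[OF invR disR]) auto
      then show "w = w'" using cut_incomparable w by blast
    qed
    have "card ?W = card ((\<lambda>w. (n w False, n w True)) ` ?W)" by (rule card_image[OF inj, symmetric])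
    also have "\<dots> \<le> card (Q (mm False) \<times> Q (mm True))"
      using nx(3) by (intro card_mono) (auto simp: Q_def)
    also have "\<dots> = M" unfolding card_cartesian_product Q_def M_def by (simp add: algebra_simps)
    finally show ?thesis .
  qed
  then show ?thesis by blast
qed

lemma ROSC_grid_comparable:
  assumes R: "ROSC I S" and k: "k \<ge> 1" and q: "q \<ge> 0"
  shows "\<exists>C>0. \<forall>\<kappa>\<ge>2. csum q (grid \<kappa>) \<le> C * cut_sum q k \<kappa> \<and> cut_sum q k \<kappa> \<le> C * csum q (grid \<kappa>)"
proof -
  obtain M where M: "\<And>\<kappa> c. \<kappa> \<ge> 2 \<Longrightarrow> card {w \<in> short_cut k \<kappa>. prob {z \<in> unit_square. word_grid \<kappa> w z = c} \<noteq> 0} \<le> M"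
    using ROSC_bounded_overlap[OF R k] by blast
  define C where "C = real M powr q + real M + 1"
  have C: "C > 0" unfolding C_def by (simp add: add_nonneg_pos)
  have "csum q (grid \<kappa>) \<le> C * cut_sum q k \<kappa> \<and> cut_sum q k \<kappa> \<le> C * csum q (grid \<kappa>)" if \<kappa>: "\<kappa> \<ge> 2" for \<kappa>
  proof -
    have \<kappa>pos: "\<kappa> > 0" using \<kappa> by simp
    obtain N where st: "stopping I (short_stop k \<kappa>) k N" using stopping_short[OF \<kappa>pos k] .
    then interpret stopping I "short_stop k \<kappa>" k N .
    define m where "m c w = pr w * prob {z \<in> unit_square. word_grid \<kappa> w z = c}" for c w
    define W where "W c = {w \<in> short_cut k \<kappa>. prob {z \<in> unit_square. word_grid \<kappa> w z = c} \<noteq> 0}" for c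
    have W: "finite (W c)" "card (W c) \<le> M" for c unfolding W_def using finite_cut M[OF \<kappa>] by auto
    have m0: "m c w \<ge> 0" if "w \<in> W c" for c w using that pr_prob_nonneg unfolding m_def W_def by auto
    have mass: "prob {z \<in> unit_square. grid \<kappa> z = c} = (\<Sum>w\<in>W c. m c w)" for c
      unfolding grid_mass_cut[OF st] m_def W_def using finite_cut by (intro sum.mono_neutral_right) auto
    have pw: "(\<Sum>w\<in>short_cut k \<kappa>. m c w powr q) = (\<Sum>w\<in>W c. m c w powr q)" for c
      unfolding m_def W_def using finite_cut by (intro sum.mono_neutral_right) auto
    have 1: "(\<Sum>w\<in>W c. m c w) powr q \<le> C * (\<Sum>w\<in>W c. m c w powr q)" for c
    proof -
      have "(\<Sum>w\<in>W c. m c w) powr q \<le> real (card (W c)) powr q * (\<Sum>w\<in>W c. m c w powr q)"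
        using W m0 q by (intro powr_sum_le) auto
      also have "\<dots> \<le> C * (\<Sum>w\<in>W c. m c w powr q)"
      proof (intro mult_right_mono sum_nonneg)
        have "real (card (W c)) powr q \<le> real M powr q" using W q by (intro powr_mono2) auto
        then show "real (card (W c)) powr q \<le> C" unfolding C_def by simp
      qed auto
      finally show ?thesis .
    qed
    have 2: "(\<Sum>w\<in>W c. m c w powr q) \<le> C * (\<Sum>w\<in>W c. m c w) powr q" for c
    proof -
      have "(\<Sum>w\<in>W c. m c w powr q) \<le> real (card (W c)) * (\<Sum>w\<in>W c. m c w) powr q"
        using W m0 q by (intro sum_powr_le_card) auto
      also have "\<dots> \<le> C * (\<Sum>w\<in>W c. m c w) powr q"
      proof (intro mult_right_mono)
        have "real (card (W c)) \<le> real M" using W by simp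
        then show "real (card (W c)) \<le> C" unfolding C_def using powr_ge_zero[of "real M" q] by linarith
      qed auto
      finally show ?thesis .
    qed
    have e1: "csum q (grid \<kappa>) = (\<Sum>c\<in>grid \<kappa> ` unit_square. (\<Sum>w\<in>W c. m c w) powr q)"
      unfolding cell_sum_def mass ..
    have e2: "cut_sum q k \<kappa> = (\<Sum>c\<in>grid \<kappa> ` unit_square. \<Sum>w\<in>W c. m c w powr q)"
      unfolding cut_sum_swap[OF k \<kappa>pos] m_def[symmetric] pw ..
    show ?thesis unfolding e1 e2 sum_distrib_left using 1 2 by (auto intro!: sum_mono simp: sum_distrib_left)
  qed
  with C show ?thesis by blast
qed

section \<open>Upper and lower bounds\<close>

abbreviation "\<gamma> q \<equiv> moment_scaling I S p \<mu> q"

lemma upper_bound: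
  assumes q: "q \<ge> 0" and "q \<le> 1 \<or> ROSC I S"
  shows "dominated (\<lambda>\<delta>. ennreal (csum q (grid (2 / \<delta>)))) (\<lambda>\<delta>. ennreal (\<delta> powr (- \<gamma> q)))"
proof (rule dominated_upper)
  fix s assume s: "s > \<gamma> q"
  obtain C where C: "C > 0" "\<And>\<kappa>. \<kappa> \<ge> 2 \<Longrightarrow> cut_sum q 1 \<kappa> \<le> C * \<kappa> powr s"
    using cut_sum_upper[OF q s, of 1] by auto
  obtain B where B: "B > 0" "\<And>\<kappa>. \<kappa> \<ge> 2 \<Longrightarrow> csum q (grid \<kappa>) \<le> B * cut_sum q 1 \<kappa>"
  proof (cases "q \<le> 1")
    case True
    then show ?thesis using grid_le_cut_sum[OF q True, of 1] by (intro that[of 1]) auto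
  next
    case False
    then show ?thesis using ROSC_grid_comparable[OF _ _ q, of 1] assms(2) that by auto
  qed
  have "csum q (grid \<kappa>) \<le> B * C * \<kappa> powr s" if "\<kappa> \<ge> 2" for \<kappa>
  proof -
    have "B * cut_sum q 1 \<kappa> \<le> B * (C * \<kappa> powr s)" using B(1) C(2)[OF that] by (intro mult_left_mono) auto
    then show ?thesis using B(2)[OF that] by (simp add: mult.assoc)
  qed
  moreover have "B * C > 0" using B C by simp
  ultimately show "\<exists>C>0. \<forall>\<kappa>\<ge>2. csum q (grid \<kappa>) \<le> C * \<kappa> powr s" by blast
qed

lemma lower_bound:
  assumes q: "q \<ge> 0" and "q \<ge> 1 \<or> ROSC I S"
  shows "dominated (\<lambda>\<delta>. ennreal (\<delta> powr (- \<gamma> q))) (\<lambda>\<delta>. ennreal (csum q (grid (2 / \<delta>))))"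
proof (rule dominated_lower)
  fix s assume s: "s < \<gamma> q"
  obtain k C where k: "k \<ge> 1" and C: "C > 0" "\<And>\<kappa>. \<kappa> \<ge> 2 \<Longrightarrow> \<kappa> powr s \<le> C * cut_sum q k \<kappa>"
    using cut_sum_lower[OF q s] by blast
  obtain B where B: "B > 0" "\<And>\<kappa>. \<kappa> \<ge> 2 \<Longrightarrow> cut_sum q k \<kappa> \<le> B * csum q (grid \<kappa>)"
  proof (cases "q \<ge> 1")
    case True
    then show ?thesis using cut_sum_le_grid[OF True k] by (intro that[of 1]) auto
  next
    case False
    then show ?thesis using ROSC_grid_comparable[OF _ k q] assms(2) that by auto
  qed
  have "\<kappa> powr s \<le> C * B * csum q (grid \<kappa>)" if "\<kappa> \<ge> 2" for \<kappa>
  proof -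
    have "C * cut_sum q k \<kappa> \<le> C * (B * csum q (grid \<kappa>))" using C(1) B(2)[OF that] by (intro mult_left_mono) auto
    then show ?thesis using C(2)[OF that] by (simp add: mult.assoc)
  qed
  moreover have "C * B > 0" using B C by simp
  ultimately show "\<exists>C>0. \<forall>\<kappa>\<ge>2. \<kappa> powr s \<le> C * csum q (grid \<kappa>)" by blast
qed

lemma dims_eq_grid_scaling:
  assumes q: "q \<ge> 0"
  shows "lower_packing_dim \<mu> q = scaling_liminf (\<lambda>\<delta>. ennreal (csum q (grid (2 / \<delta>))))"
    and "upper_packing_dim \<mu> q = scaling_limsup (\<lambda>\<delta>. ennreal (csum q (grid (2 / \<delta>))))"
    and "lower_Lq \<mu> q = scaling_liminf (\<lambda>\<delta>. ennreal (csum q (grid (2 / \<delta>))))"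
    and "upper_Lq \<mu> q = scaling_limsup (\<lambda>\<delta>. ennreal (csum q (grid (2 / \<delta>))))"
    and "q \<le> 1 \<Longrightarrow> upper_covering_dim \<mu> q = scaling_limsup (\<lambda>\<delta>. ennreal (csum q (grid (2 / \<delta>))))"
  unfolding lower_packing_dim_def upper_packing_dim_def lower_Lq_def upper_Lq_def upper_covering_dim_def
  using grid_comparable[OF q] scaling_cong by blast+

lemma grid_scaling_bounds:
  assumes q: "q \<ge> 0"
  shows "q \<le> 1 \<or> ROSC I S \<Longrightarrow> scaling_limsup (\<lambda>\<delta>. ennreal (csum q (grid (2 / \<delta>)))) \<le> ereal (\<gamma> q)"
    and "q \<ge> 1 \<or> ROSC I S \<Longrightarrow> ereal (\<gamma> q) \<le> scaling_liminf (\<lambda>\<delta>. ennreal (csum q (grid (2 / \<delta>))))"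
  using scaling_mono(2)[OF upper_bound[OF q]] scaling_mono(1)[OF lower_bound[OF q]] by (simp_all add: scaling_powr)

lemma ROSC_scaling:
  assumes q: "q \<ge> 0" and "ROSC I S"
  shows "scaling_liminf (\<lambda>\<delta>. ennreal (csum q (grid (2 / \<delta>)))) = ereal (\<gamma> q)"
    and "scaling_limsup (\<lambda>\<delta>. ennreal (csum q (grid (2 / \<delta>)))) = ereal (\<gamma> q)"
proof -
  have "comparable (\<lambda>\<delta>. ennreal (csum q (grid (2 / \<delta>)))) (\<lambda>\<delta>. ennreal (\<delta> powr (- \<gamma> q)))"
    unfolding comparable_def using upper_bound[OF q] lower_bound[OF q] assms(2) by simp
  from scaling_cong[OF this]
  show "scaling_liminf (\<lambda>\<delta>. ennreal (csum q (grid (2 / \<delta>)))) = ereal (\<gamma> q)"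
    "scaling_limsup (\<lambda>\<delta>. ennreal (csum q (grid (2 / \<delta>)))) = ereal (\<gamma> q)"
    by (simp_all add: scaling_powr)
qed

end

lemma (in box_like_measure) ex_box_coords:
  "\<exists>sw u e. box_coords I S p \<mu> sw u e"
proof -
  have "\<forall>i\<in>I. \<exists>s u e. (\<forall>j z. cd j (S i z) = u j * cd (j \<noteq> s) z + e j) \<and> (\<forall>j. 0 < \<bar>u j\<bar> \<and> \<bar>u j\<bar> < 1)"
    using box_like_map_coords[OF box_like] by blast
  then obtain sw u e where "\<forall>i\<in>I. (\<forall>j z. cd j (S i z) = u i j * cd (j \<noteq> sw i) z + e i j) \<and> (\<forall>j. 0 < \<bar>u i j\<bar> \<and> \<bar>u i j\<bar> < (1::real))"
    by metis
  then have "box_coords I S p \<mu> sw u e" by unfold_locales auto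
  then show ?thesis by blast
qed

theorem theorem2p6:
  fixes I :: "'i set"
    and S :: "'i \<Rightarrow> real \<times> real \<Rightarrow> real \<times> real"
    and p :: "'i \<Rightarrow> real"
    and \<mu> :: "(real \<times> real) measure"
  assumes "box_like_measure I S p \<mu>"
  shows "(\<forall>q. 0 \<le> q \<and> q \<le> 1 \<longrightarrow>
            upper_covering_dim \<mu> q = upper_packing_dim \<mu> q \<and>
            upper_packing_dim \<mu> q = upper_Lq \<mu> q \<and>
            upper_Lq \<mu> q \<le> ereal (moment_scaling I S p \<mu> q))
       \<and> (\<forall>q. q \<ge> 1 \<longrightarrow>
            ereal (moment_scaling I S p \<mu> q) \<le> lower_packing_dim \<mu> q \<and>
            lower_packing_dim \<mu> q = lower_Lq \<mu> q)
       \<and> (ROSC I S \<longrightarrow>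
            (\<forall>q. q \<ge> 0 \<longrightarrow>
              lower_packing_dim \<mu> q = ereal (moment_scaling I S p \<mu> q) \<and>
              upper_packing_dim \<mu> q = ereal (moment_scaling I S p \<mu> q) \<and>
              lower_Lq \<mu> q = ereal (moment_scaling I S p \<mu> q) \<and>
              upper_Lq \<mu> q = ereal (moment_scaling I S p \<mu> q)))"
proof -
  obtain sw u e where "box_coords I S p \<mu> sw u e"
    using box_like_measure.ex_box_coords[OF assms] by blast
  then interpret box_coords I S p \<mu> sw u e .
  show ?thesis using dims_eq_grid_scaling grid_scaling_bounds ROSC_scaling by simp
qed

end
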